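(* Let $\mathcal{N}_2$ be the germ $(\mathbb{C}^2,0)$, with coordinates $(t_1,t_2)$, equipped with the multiplication $\circ$ on its tangent bundle with unit field $\partial_1$ and $\partial_2\circ\partial_2=0$. Let $$C_1=\mathrm{Id}_2,\quad C_2=\begin{pmatrix}0&0\\1&0\end{pmatrix},\quad E=\begin{pmatrix}0&1\\0&0\end{pmatrix}.$$ (i) Any $(T)$-structure (or formal $(T)$-structure) over $\mathcal{N}_2$ is formally isomorphic to one of the $(T)$-structures $$(a)\ A_1=C_1,\ A_2=C_2+zE;\qquad (b)\ A_1=C_1,\ A_2=C_2+zt_2E;\qquad (c)\ A_1=C_1,\ A_2=C_2;$$ or to a holomorphic or formal $(T)$-structure of the form $$(d)\quad A_1=C_1,\quad A_2=C_2+z\Bigl(t_2^r+\sum_{k\geq1}f(k)z^k\Bigr)E,$$ where $r\in\mathbb{Z}_{\geq2}$ and each $f(k)\in\mathbb{C}[t_2]_{\leq r-2}$ is a polynomial in $t_2$ of degree at most $r-2$. (ii) Any two different $(T)$-structures (or formal $(T)$-structures) $\nabla$ and $\tilde\nabla$ from the list (a)–(d), at least one of which is not of the form (d), are formally non-isomorphic. If $\nabla$ and $\tilde\nabla$ are different and both of the form (d), then they are formally gauge non-isomorphic. If $\nabla$ and $\tilde\nabla$ are both of the form (d), with the same $r$ and with coefficients $f(k)$ and $\tilde f(k)$ ($k\geq1$) respectively, then they are formally isomorphic if and only if there is $\lambda_0\in\mathbb{C}$ with $\lambda_0^{r}=1$ such that $\tilde f(k)(t_2)=\lambda_0^{-2}f(k)\bigl(\tfrac{t_2}{\lambda_0}\bigr)$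 for any $k\geq1$.
   Context: Rings: $t=(t_1,t_2)$; $\mathbb{C}\{t,z\}$ is the ring of convergent power series. $\mathbb{C}\{t,z]]$ is the ring of formal power series $\sum_{n\geq 0}a_n z^n$ with all $a_n=a_n(t)$ holomorphic on the same neighbourhood of $0$. For a matrix $A$ with entries in these rings write $A=\sum_{n\geq0}A(n)z^n$ with $A(n)$ independent of $z$. $(T)$-structures: a $(T)$-structure over a complex manifold $M$ is a holomorphic vector bundle $H\to\mathbb{C}\times M$ with a map $\nabla:\mathcal{O}(H)\to\frac1z\mathcal{O}_{\mathbb{C}\times M}\cdot\Omega^1_M\otimes\mathcal{O}(H)$ whose restriction to $H|_{\{z\}\times M}$ is a flat connection for every $z\in\mathbb{C}^*$. Over the germ $M=(\mathbb{C}^2,0)$ the bundle $H$ (a germ along $(0,0)\in\mathbb{C}\times\mathbb{C}^2$) is assumed trivial; in the rank 2 case, in a trivialization $\underline{s}=(s_1,s_2)$, one has $\nabla\underline{s}=\underline{s}\cdot\frac1z(A_1dt_1+A_2dt_2)$ with $A_1,A_2\in M_{2\times2}(\mathbb{C}\{t,z\})$, and flatness means $z\partial_1A_2-z\partial_2A_1+[A_1,A_2]=0$. So a $(T)$-structure is given by such a pair $(A_1,A_2)$. A formal $(T)$-structure is given by a pair $(A_1,A_2)$ of matrices with entries in $\mathbb{C}\{t,z]]$ satisfying the same equation. Unfolding condition and induced multiplication: on $K=H|_{\{0\}\times M}$ one has the Higgs field $C_{\partial_i}=A_i(0)$ (these commute). The (formal) $(T)$-structure satisfies the unfolding condition if there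 is a section $\zeta\in\mathcal{O}(K)$ such that $X\mapsto C_X\zeta$ is an isomorphism $TM\to K$. It then induces a well-defined multiplication on $TM$ by $C_{X\circ Y}\zeta=C_XC_Y\zeta$, whose unit field $e$ is determined by $C_e\zeta=\zeta$. A (formal) $(T)$-structure "over $\mathcal{N}_2$" means a (formal) $(T)$-structure over $(\mathbb{C}^2,0)$ which satisfies the unfolding condition and induces the multiplication and unit field of $\mathcal{N}_2$. Isomorphisms: a formal isomorphism from $(\tilde A_1,\tilde A_2)$ to $(A_1,A_2)$ covering a germ of biholomorphic map $h=(h^1,h^2):(\mathbb{C}^2,0)\to(\mathbb{C}^2,0)$ is given by a matrix $\tilde T$ with entries in $\mathbb{C}\{t,z]]$, with $\tilde T(0)$ invertible, such that for $i=1,2$ $$z\partial_i\tilde T+\sum_{j=1}^2(\partial_ih^j)(A_j\circ h)\tilde T-\tilde T\tilde A_i=0,$$ where $A_j\circ h$ means $A_j(z,h(t))$. Two (formal) $(T)$-structures are formally isomorphic if such an isomorphism exists for some $h$, and formally gauge isomorphic if one exists with $h=\mathrm{id}$.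
   Formalization: In the last claim of (ii) the condition λ_0^r = 1 is replaced by λ_0^{r+2} = 1; as printed it fails, e.g. for r = 2, f(1) = 1, f̃(1) = −1 (other coefficients 0), which are isomorphic via h = (t_1, i t_2), T = diag(1, i). *)

theory Defs
  imports "HOL-Analysis.Analysis"
begin

section \<open>Holomorphic functions of several variables\<close>

definition mv_holomorphic_on :: "(complex^'n \<Rightarrow> complex) \<Rightarrow> (complex^'n) set \<Rightarrow> bool" where
  "mv_holomorphic_on f U \<longleftrightarrow>
     (\<forall>t\<in>U. \<exists>D. (f has_derivative D) (at t) \<and> (\<forall>c v. D (c *s v) = c * D v))"

definition holomorphic_germ :: "(complex^2 \<Rightarrow> complex) \<Rightarrow> bool" where
  "holomorphic_germ f \<longleftrightarrow> (\<exists>U. open U \<and> 0 \<in> U \<and> mv_holomorphic_on f U)"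

definition partial_deriv :: "2 \<Rightarrow> (complex^2 \<Rightarrow> complex) \<Rightarrow> complex^2 \<Rightarrow> complex" where
  "partial_deriv i f t = deriv (\<lambda>x. f (t + axis i x)) 0"

definition biholomorphic_germ :: "(complex^2 \<Rightarrow> complex^2) \<Rightarrow> bool" where
  "biholomorphic_germ h \<longleftrightarrow> h 0 = 0 \<and>
     (\<exists>U V g. open U \<and> 0 \<in> U \<and> open V \<and> homeomorphism U V h g \<and>
        (\<forall>j. mv_holomorphic_on (\<lambda>t. h t $ j) U) \<and>
        (\<forall>j. mv_holomorphic_on (\<lambda>t. g t $ j) V))"


section \<open>The coefficient rings\<close>

text \<open>
  An element \<open>\<Sum>n. a\<^sub>n(t) z\<^sup>n\<close> is a function sending \<open>t\<close> to a formal power series in \<open>z\<close>;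
  the indeterminate \<open>fps_X\<close> is \<open>z\<close>. Functions represent germs at \<open>t = 0\<close>, so equations
  are required for \<open>t\<close> near \<open>0\<close> only. As all coefficients are holomorphic on one common
  neighbourhood, equality of all coefficients as germs is the same as equality of the
  functions on one common neighbourhood (identity theorem).
\<close>

definition formal_series :: "(complex^2 \<Rightarrow> complex fps) \<Rightarrow> bool" where
  "formal_series a \<longleftrightarrow>
     (\<exists>U. open U \<and> 0 \<in> U \<and> (\<forall>n. mv_holomorphic_on (\<lambda>t. fps_nth (a t) n) U))"

text \<open>Convergent series are the expansions in \<open>z\<close> of holomorphic germs in \<open>(z, t\<^sub>1, t\<^sub>2)\<close>.\<close>

definition convergent_series :: "(complex^2 \<Rightarrow> complex fps) \<Rightarrow> bool" where
  "convergent_series a \<longleftrightarrow> formal_series a \<and>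
     (\<exists>(F :: complex^3 \<Rightarrow> complex) W. open W \<and> 0 \<in> W \<and> mv_holomorphic_on F W \<and>
        (\<forall>z t. vector [z, t $ 1, t $ 2] \<in> W \<longrightarrow>
           (\<lambda>n. fps_nth (a t) n * z ^ n) sums F (vector [z, t $ 1, t $ 2])))"

type_synonym fmat = "complex fps ^ 2 ^ 2"

definition smat :: "'a::times \<Rightarrow> 'a ^ 2 ^ 2 \<Rightarrow> 'a ^ 2 ^ 2" where
  "smat c M = map_matrix ((*) c) M"

definition coeff_mat :: "fmat \<Rightarrow> nat \<Rightarrow> complex ^ 2 ^ 2" where
  "coeff_mat M n = map_matrix (\<lambda>a. fps_nth a n) M"

definition partial_mat :: "2 \<Rightarrow> (complex^2 \<Rightarrow> fmat) \<Rightarrow> complex^2 \<Rightarrow> fmat" where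
  "partial_mat i M t =
     (\<chi> a b. Abs_fps (\<lambda>n. partial_deriv i (\<lambda>s. fps_nth (M s $ a $ b) n) t))"


section \<open>\<open>(T)\<close>-structures\<close>

text \<open>A structure is given by its two connection matrices \<open>A 1\<close> and \<open>A 2\<close>.\<close>

type_synonym tpair = "2 \<Rightarrow> complex^2 \<Rightarrow> fmat"

definition flat :: "tpair \<Rightarrow> bool" where
  "flat A \<longleftrightarrow> (\<forall>\<^sub>F t in nhds 0.
     smat fps_X (partial_mat 1 (A 2) t) - smat fps_X (partial_mat 2 (A 1) t)
       + (A 1 t ** A 2 t - A 2 t ** A 1 t) = 0)"

definition T_structure :: "tpair \<Rightarrow> bool" where
  "T_structure A \<longleftrightarrow> (\<forall>i a b. convergent_series (\<lambda>t. A i t $ a $ b)) \<and> flat A"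

definition formal_T_structure :: "tpair \<Rightarrow> bool" where
  "formal_T_structure A \<longleftrightarrow> (\<forall>i a b. formal_series (\<lambda>t. A i t $ a $ b)) \<and> flat A"

text \<open>The Higgs field \<open>C\<^sub>X\<close> at \<open>t\<close>, for a tangent vector \<open>X = X\<^sub>1 \<partial>\<^sub>1 + X\<^sub>2 \<partial>\<^sub>2\<close>.\<close>

definition higgs :: "tpair \<Rightarrow> complex^2 \<Rightarrow> complex^2 \<Rightarrow> complex^2^2" where
  "higgs A t X = (\<Sum>i\<in>UNIV. smat (X $ i) (coeff_mat (A i t) 0))"

text \<open>
  The multiplication of \<open>\<N>\<^sub>2\<close> is the \<open>\<O>\<close>-bilinear one with unit \<open>\<partial>\<^sub>1\<close> and
  \<open>\<partial>\<^sub>2 \<circ> \<partial>\<^sub>2 = 0\<close>; it has constant coefficients, so one formula serves all tangent spaces.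
\<close>

definition N2_mult :: "complex^2 \<Rightarrow> complex^2 \<Rightarrow> complex^2" where
  "N2_mult X Y = vector [X $ 1 * Y $ 1, X $ 1 * Y $ 2 + X $ 2 * Y $ 1]"

definition N2_unit :: "complex^2" where
  "N2_unit = axis 1 1"

text \<open>The unfolding condition, with induced multiplication and unit field those of \<open>\<N>\<^sub>2\<close>.\<close>

definition over_N2 :: "tpair \<Rightarrow> bool" where
  "over_N2 A \<longleftrightarrow> (\<exists>\<zeta> :: complex^2 \<Rightarrow> complex^2. (\<forall>a. holomorphic_germ (\<lambda>t. \<zeta> t $ a)) \<and>
     (\<forall>\<^sub>F t in nhds 0.
        bij (\<lambda>X. higgs A t X *v \<zeta> t) \<and>
        (\<forall>X Y. higgs A t (N2_mult X Y) *v \<zeta> t = higgs A t X *v (higgs A t Y *v \<zeta> t)) \<and>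
        higgs A t N2_unit *v \<zeta> t = \<zeta> t))"


section \<open>Formal isomorphisms\<close>

text \<open>\<open>formal_iso_over h T A' A\<close>: \<open>T\<close> is a formal isomorphism from \<open>A'\<close> to \<open>A\<close> covering \<open>h\<close>.\<close>

definition formal_iso_over ::
    "(complex^2 \<Rightarrow> complex^2) \<Rightarrow> (complex^2 \<Rightarrow> fmat) \<Rightarrow> tpair \<Rightarrow> tpair \<Rightarrow> bool" where
  "formal_iso_over h T A' A \<longleftrightarrow>
     (\<forall>a b. formal_series (\<lambda>t. T t $ a $ b)) \<and>
     (\<forall>\<^sub>F t in nhds 0. invertible (coeff_mat (T t) 0)) \<and>
     (\<forall>i. \<forall>\<^sub>F t in nhds 0.
        smat fps_X (partial_mat i T t)
          + (\<Sum>j\<in>UNIV. smat (fps_const (partial_deriv i (\<lambda>s. h s $ j) t)) (A j (h t)) ** T t)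
          - T t ** A' i t = 0)"

definition formally_isomorphic :: "tpair \<Rightarrow> tpair \<Rightarrow> bool" where
  "formally_isomorphic A' A \<longleftrightarrow> (\<exists>h T. biholomorphic_germ h \<and> formal_iso_over h T A' A)"

definition formally_gauge_isomorphic :: "tpair \<Rightarrow> tpair \<Rightarrow> bool" where
  "formally_gauge_isomorphic A' A \<longleftrightarrow> (\<exists>T. formal_iso_over (\<lambda>t. t) T A' A)"


section \<open>The normal forms\<close>

definition C1 :: fmat where "C1 = mat 1"

definition C2 :: fmat where "C2 = vector [vector [0, 0], vector [1, 0]]"

definition E :: fmat where "E = vector [vector [0, 1], vector [0, 0]]"

definition normal_form :: "(complex \<Rightarrow> complex fps) \<Rightarrow> tpair" where
  "normal_form \<phi> i t = (if i = 1 then C1 else C2 + smat (fps_X * \<phi> (t $ 2)) E)"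

definition form_a :: tpair where "form_a = normal_form (\<lambda>x. 1)"

definition form_b :: tpair where "form_b = normal_form (\<lambda>x. fps_const x)"

definition form_c :: tpair where "form_c = normal_form (\<lambda>x. 0)"

definition form_d :: "nat \<Rightarrow> (nat \<Rightarrow> complex poly) \<Rightarrow> tpair" where
  "form_d r f = normal_form
     (\<lambda>x. fps_const (x ^ r) + Abs_fps (\<lambda>k. if k \<ge> 1 then poly (f k) x else 0))"

text \<open>
  Isomorphisms covering \<open>t\<^sub>2 \<mapsto> \<lambda> t\<^sub>2\<close> rescale the whole series, including the leading term:
  \<open>t\<^sub>2\<^sup>r \<mapsto> \<lambda>\<^sup>-\<^sup>2 (t\<^sub>2/\<lambda>)\<^sup>r\<close>. Two structures with the same \<open>r\<close> are thus related by
  \<open>\<lambda>\<close> with \<open>\<lambda>\<^sup>r\<^sup>+\<^sup>2 = 1\<close>. The condition \<open>\<lambda>\<^sup>r = 1\<close> in the informal statement is incorrect: for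
  \<open>r = 2\<close> the structures with \<open>f(1) = 1\<close> and \<open>f(1) = -1\<close> (and \<open>f(k) = 0\<close> for \<open>k \<ge> 2\<close>) are
  formally isomorphic by \<open>h(t) = (t\<^sub>1, \<i> t\<^sub>2)\<close> and the constant diagonal matrix \<open>(1, \<i>)\<close>, while
  \<open>\<lambda>\<^sup>2 = 1\<close> would force \<open>f(1)\<close> to agree. Only \<open>f k\<close> with \<open>k \<ge> 1\<close> enters \<open>form_d r f\<close>.
\<close>

definition d_data :: "nat \<Rightarrow> (nat \<Rightarrow> complex poly) \<Rightarrow> bool" where
  "d_data r f \<longleftrightarrow> r \<ge> 2 \<and> (\<forall>k\<ge>1. degree (f k) \<le> r - 2)"

definition forms_abc :: "tpair set" where "forms_abc = {form_a, form_b, form_c}"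

definition forms_d :: "tpair set" where "forms_d = {form_d r f | r f. d_data r f}"

end

theory Submission
  imports Defs "HOL-Complex_Analysis.Complex_Analysis"
begin

unbundle no Formal_Power_Series.fps_syntax

text \<open>
  Row vectors flat in direction \<open>\<partial>\<^sub>1\<close> can be solved for order by order in \<open>z\<close>, and one of them is cyclic
  under \<open>A\<^sub>2\<close>. Flatness makes the coefficients of \<open>A\<^sub>2\<close> in the resulting basis depend on \<open>t\<^sub>2\<close> only;
  a further gauge and coordinate change gives \<open>A\<^sub>1 = C\<^sub>1\<close>, \<open>A\<^sub>2 = C\<^sub>2 + z \<phi>(t\<^sub>2, z) E\<close>.

  An isomorphism between two such normal forms is given by a map \<open>t\<^sub>2 \<mapsto> l(t\<^sub>2)\<close> and the first column
  \<open>(a, c)\<close> of the matrix, subject to two scalar equations. Their leading order is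
  \<open>\<phi>'(0) = (l')\<^sup>2 \<phi>(0) \<circ> l\<close>, so the vanishing order \<open>r\<close> of \<open>\<phi>(0)\<close> is an invariant and \<open>l\<close> can be chosen
  with \<open>\<phi>(0) = t\<^sub>2\<^sup>r\<close>, uniquely up to \<open>l = \<lambda> t\<^sub>2\<close> with \<open>\<lambda>\<close> a root of unity of order dividing \<open>r + 2\<close>.
  At each higher order the normal form can be changed exactly by the image of
  \<open>c \<mapsto> r t\<^sub>2\<^sup>r\<^sup>-\<^sup>1 c + 2 t\<^sub>2\<^sup>r c'\<close>, which is \<open>t\<^sub>2\<^sup>r\<^sup>-\<^sup>1 \<complex>{t\<^sub>2}\<close> for \<open>r \<ge> 1\<close>; the polynomials of degree at most
  \<open>r - 2\<close> are a complement.
\<close>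

section \<open>Holomorphic functions of two variables\<close>

text \<open>All coefficients of a formal series must be holomorphic on one common neighbourhood, so
  a recursion over the powers of z may never lose radius. This shapes the proof: at each order the
  unknown solves a first-order linear equation, an iterated primitive or an Euler equation, and each
  of these is solved by explicit integrals on the given disc. Radii shrink only finitely often,
  outside the recursions.

  The operator of the overview is a power of \<open>t\<^sub>2\<close> times
  \<open>c \<mapsto> r c + 2 t\<^sub>2 c'\<close>, which multiplies the n-th Taylor coefficient by
  \<open>r + 2n\<close>. For r > 0 this is never 0, which gives the stated image and, for
  uniqueness, the vanishing of c.

  If \<phi>(0) vanishes identically, that operator is zero. Then a coordinate change with
  \<open>l' = u\<^sup>-\<^sup>2\<close> helps: up to the factor \<open>u\<^sup>4\<close> it
  subtracts \<open>z u'' / u\<close>, a Schwarzian term, from \<phi>. Choosing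
  \<open>u'' = \<phi>(1) u\<close> leaves a multiple of \<open>z\<^sup>2\<close>, which can be
  gauged to 0; this is form (c).

  Flatness in two variables uses that partial derivatives are again holomorphic, commute, and have
  primitives; Cauchy's formula and Osgood's lemma supply this for \<open>sep_hol\<close>.\<close>

definition sep_hol :: "real \<Rightarrow> (complex \<Rightarrow> complex \<Rightarrow> complex) \<Rightarrow> bool" where
  "sep_hol r F \<longleftrightarrow> continuous_on (ball 0 r \<times> ball 0 r) (\<lambda>(x, y). F x y) \<and>
     (\<forall>y\<in>ball 0 r. (\<lambda>x. F x y) holomorphic_on ball 0 r) \<and>
     (\<forall>x\<in>ball 0 r. F x holomorphic_on ball 0 r)"

lemma sep_hol_swap:
  assumes "sep_hol r F"
  shows "sep_hol r (\<lambda>x y. F y x)"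
proof -
  have "continuous_on (ball 0 r \<times> ball 0 r) ((\<lambda>(x, y). F x y) \<circ> prod.swap)"
    using assms by (intro continuous_on_compose)
      (auto simp: sep_hol_def continuous_on_swap product_swap)
  moreover have "(\<lambda>(x, y). F x y) \<circ> prod.swap = (\<lambda>(x, y). F y x)"
    by auto
  ultimately show ?thesis using assms by (auto simp: sep_hol_def)
qed

lemma sep_hol_continuous_compose:
  assumes "sep_hol r F" "continuous_on S g" "continuous_on S h"
    and "\<And>s. s \<in> S \<Longrightarrow> norm (g s) < r" "\<And>s. s \<in> S \<Longrightarrow> norm (h s) < r"
  shows "continuous_on S (\<lambda>s. F (g s) (h s))"
proof -
  have "continuous_on S (\<lambda>s. (\<lambda>(x, y). F x y) (g s, h s))"
  proof (rule continuous_on_compose2[of "ball 0 r \<times> ball 0 r" "\<lambda>(x, y). F x y"])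
    show "continuous_on S (\<lambda>s. (g s, h s))" by (intro continuous_on_Pair assms)
  qed (use assms in \<open>auto simp: sep_hol_def\<close>)
  then show ?thesis by simp
qed

lemma holomorphic_onI_DERIV:
  assumes "\<And>x. x \<in> S \<Longrightarrow> (f has_field_derivative d x) (at x)"
  shows "f holomorphic_on S"
  using assms unfolding holomorphic_on_def field_differentiable_def
  by (meson has_field_derivative_at_within)

text \<open>The integrand of Cauchy's formula for the x-derivative on the circle of radius \<rho>,
  pulled back to the unit interval. The factor \<open>2 pi i\<close> in the velocity of the circle
  cancels the one in front of Cauchy's formula. A plain integral over a fixed interval makes the
  theorems on parameter integrals applicable.\<close>

definition cauchy_kernel :: "real \<Rightarrow> (complex \<Rightarrow> complex \<Rightarrow> complex) \<Rightarrow> complex \<Rightarrow> complex \<Rightarrow> real \<Rightarrow> complex" where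
  "cauchy_kernel \<rho> F x y s =
     F (circlepath 0 \<rho> s) y * (\<rho> * exp (2 * of_real pi * \<i> * s) / (circlepath 0 \<rho> s - x)\<^sup>2)"

lemma circlepath_continuous: "continuous_on S (circlepath 0 \<rho>)"
  by (auto simp: circlepath intro!: continuous_intros)

lemma norm_circlepath: "\<rho> \<ge> 0 \<Longrightarrow> norm (circlepath 0 \<rho> s) = \<rho>"
  by (auto simp: circlepath norm_mult)

lemma contour_integral_cauchy_kernel:
  "contour_integral (circlepath 0 \<rho>) (\<lambda>u. F u y / (u - x)\<^sup>2) =
     2 * of_real pi * \<i> * integral (cbox 0 1) (cauchy_kernel \<rho> F x y)"
proof -
  have "contour_integral (circlepath 0 \<rho>) (\<lambda>u. F u y / (u - x)\<^sup>2) =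
      integral (cbox 0 1) (\<lambda>s. 2 * of_real pi * \<i> * cauchy_kernel \<rho> F x y s)"
    unfolding contour_integral_integral vector_derivative_circlepath cauchy_kernel_def
    by (simp add: mult_ac)
  then show ?thesis by simp
qed

lemma between_norm_and_radius:
  assumes "x \<in> ball (0::complex) r"
  obtains \<rho> where "norm x < \<rho>" "\<rho> < r" "0 < \<rho>"
proof -
  from assms obtain \<rho> where "norm x < \<rho>" "\<rho> < r" using dense[of "norm x" r] by auto
  with norm_ge_zero[of x] show ?thesis by (intro that[of \<rho>]) linarith+
qed

lemma sep_hol_deriv_integral:
  assumes F: "sep_hol r F" and \<rho>: "\<rho> < r" and x: "norm x < \<rho>" and y: "norm y < r"
  shows "deriv (\<lambda>x. F x y) x = integral (cbox 0 1) (cauchy_kernel \<rho> F x y)"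
proof -
  have hol: "(\<lambda>x. F x y) holomorphic_on ball 0 r" using F y by (auto simp: sep_hol_def)
  have "continuous_on (cball 0 \<rho>) (\<lambda>x. F x y)"
    using \<rho> by (intro continuous_on_subset[OF holomorphic_on_imp_continuous_on[OF hol]]) auto
  moreover have "(\<lambda>x. F x y) holomorphic_on ball 0 \<rho>"
    using \<rho> by (intro holomorphic_on_subset[OF hol]) auto
  ultimately have "deriv (\<lambda>x. F x y) x = 1 / (2 * of_real pi * \<i>) *
     contour_integral (circlepath 0 \<rho>) (\<lambda>u. F u y / (u - x)^2)"
    using x by (intro DERIV_imp_deriv Cauchy_derivative_integral_circlepath(2)) auto
  also have "\<dots> = integral (cbox 0 1) (cauchy_kernel \<rho> F x y)"
    by (subst contour_integral_cauchy_kernel) simp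
  finally show ?thesis .
qed

lemma cauchy_kernel_continuous:
  assumes F: "sep_hol r F" and \<rho>: "0 < \<rho>" "\<rho> < r" and "continuous_on S g" "continuous_on S h" "continuous_on S k"
    and g: "\<And>s. s \<in> S \<Longrightarrow> norm (g s) < \<rho>" and h: "\<And>s. s \<in> S \<Longrightarrow> norm (h s) < r"
  shows "continuous_on S (\<lambda>s. cauchy_kernel \<rho> F (g s) (h s) (k s))"
proof -
  have k: "continuous_on S (\<lambda>s. circlepath 0 \<rho> (k s))"
    by (rule continuous_on_compose2[OF circlepath_continuous]) (use assms in auto)
  have ne: "circlepath 0 \<rho> (k s) - g s \<noteq> 0" if "s \<in> S" for s
    using g[OF that] norm_circlepath[of \<rho> "k s"] \<rho> by auto
  show ?thesis unfolding cauchy_kernel_def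
    by (intro continuous_intros sep_hol_continuous_compose[OF F] k assms)
       (use \<rho> h ne norm_circlepath[of \<rho>] in auto)
qed

text \<open>Near a given point one radius \<rho> serves all x, and there the derivative is an
  integral whose integrand is jointly continuous in x, y and the parameter. Continuity is local, so
  \<rho> may depend on the point.\<close>

lemma sep_hol_deriv_continuous:
  assumes F: "sep_hol r F"
  shows "continuous_on (ball 0 r \<times> ball 0 r) (\<lambda>(x, y). deriv (\<lambda>x. F x y) x)"
proof -
  have "isCont (\<lambda>(x, y). deriv (\<lambda>x. F x y) x) p" if p: "p \<in> ball 0 r \<times> ball 0 r" for p
  proof -
    obtain \<rho> where \<rho>: "norm (fst p) < \<rho>" "\<rho> < r" and \<rho>0: "0 < \<rho>"
      using p by (metis between_norm_and_radius mem_Times_iff)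
    have "continuous_on (ball 0 \<rho> \<times> ball 0 r) (\<lambda>p. integral (cbox 0 1) (cauchy_kernel \<rho> F (fst p) (snd p)))"
      by (rule integral_continuous_on_param, unfold split_def, rule cauchy_kernel_continuous[OF F \<rho>0 \<rho>(2)])
         (auto intro!: continuous_intros)
    then have "continuous_on (ball 0 \<rho> \<times> ball 0 r) (\<lambda>(x, y). deriv (\<lambda>x. F x y) x)"
      by (rule continuous_on_cong[THEN iffD1, OF refl, rotated])
         (auto simp: sep_hol_deriv_integral[OF F \<rho>(2)])
    moreover have "p \<in> ball 0 \<rho> \<times> ball 0 r" using p \<rho> by (auto simp: mem_Times_iff)
    ultimately show ?thesis
      by (auto simp: continuous_on_eq_continuous_at open_Times)
  qed
  then show ?thesis by (intro continuous_at_imp_continuous_on) auto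
qed

text \<open>Differentiation under the Cauchy integral: y enters only through the values of F on the
  circle. The Leibniz rule wants joint continuity of the y-derivative, which is the preceding
  continuity lemma with the two variables exchanged.\<close>

lemma sep_hol_deriv_param:
  assumes F: "sep_hol r F" and x: "x \<in> ball 0 r" and y: "y \<in> ball 0 r"
  obtains \<rho> where "norm x < \<rho>" "\<rho> < r"
    "((\<lambda>y. deriv (\<lambda>x. F x y) x) has_field_derivative
       integral (cbox 0 1) (cauchy_kernel \<rho> (\<lambda>x y. deriv (F x) y) x y)) (at y)"
proof -
  obtain \<rho> where \<rho>: "norm x < \<rho>" "\<rho> < r" and \<rho>0: "0 < \<rho>"
    using between_norm_and_radius x by metis
  let ?g = "\<lambda>y. deriv (\<lambda>x. F x y) x"
  define G where "G = (\<lambda>x y. deriv (F x) y)"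
  have contG: "continuous_on (ball 0 r \<times> ball 0 r) (\<lambda>(x, y). G x y)"
  proof -
    have "continuous_on (ball 0 r \<times> ball 0 r) ((\<lambda>(y, x). deriv (\<lambda>y. F x y) y) \<circ> prod.swap)"
      using sep_hol_deriv_continuous[OF sep_hol_swap[OF F]]
      by (intro continuous_on_compose) (auto simp: continuous_on_swap product_swap)
    then show ?thesis by (auto simp: G_def o_def split_def)
  qed
  have kG: "continuous_on (ball 0 r \<times> cbox 0 1) (\<lambda>(y, s). cauchy_kernel \<rho> G x y s)"
  proof -
    have "continuous_on (ball 0 r \<times> cbox 0 (1::real)) (\<lambda>p. (\<lambda>(x, y). G x y) (circlepath 0 \<rho> (snd p), fst p))"
      by (intro continuous_on_compose2[OF contG] continuous_intros continuous_on_compose2[OF circlepath_continuous])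
         (use \<rho> \<rho>0 norm_circlepath[of \<rho>] in auto)
    moreover have "circlepath 0 \<rho> s - x \<noteq> 0" for s using norm_circlepath[of \<rho> s] \<rho> \<rho>0 by auto
    ultimately show ?thesis unfolding cauchy_kernel_def split_def
      by (auto intro!: continuous_intros continuous_on_compose2[OF circlepath_continuous])
  qed
  have "((\<lambda>y. integral (cbox 0 1) (cauchy_kernel \<rho> F x y)) has_field_derivative
          integral (cbox 0 1) (cauchy_kernel \<rho> G x y)) (at y within ball 0 r)"
  proof (rule leibniz_rule_field_derivative[OF _ _ kG])
    fix y s :: complex
    show "cauchy_kernel \<rho> F x y integrable_on cbox 0 1" if "y \<in> ball 0 r"
      by (intro integrable_continuous cauchy_kernel_continuous[OF F \<rho>0 \<rho>(2)] continuous_intros)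
         (use \<rho> that in auto)
  next
    fix y :: complex and s :: real assume y: "y \<in> ball 0 r" and "s \<in> cbox 0 (1::real)"
    have "F (circlepath 0 \<rho> s) holomorphic_on ball 0 r"
      using F norm_circlepath[of \<rho> s] \<rho> \<rho>0 by (auto simp: sep_hol_def)
    then have "(F (circlepath 0 \<rho> s) has_field_derivative G (circlepath 0 \<rho> s) y) (at y within ball 0 r)"
      using y by (auto simp: G_def intro!: holomorphic_derivI)
    then show "((\<lambda>y. cauchy_kernel \<rho> F x y s) has_field_derivative cauchy_kernel \<rho> G x y s) (at y within ball 0 r)"
      unfolding cauchy_kernel_def by (intro DERIV_cmult_right)
  qed (use y in auto)
  then have *: "((\<lambda>y. integral (cbox 0 1) (cauchy_kernel \<rho> F x y)) has_field_derivative
          integral (cbox 0 1) (cauchy_kernel \<rho> G x y)) (at y)"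
    using y by (simp add: at_within_open[of y "ball 0 r"])
  have "(?g has_field_derivative integral (cbox 0 1) (cauchy_kernel \<rho> G x y)) (at y)"
    by (rule has_field_derivative_transform_within_open[OF * open_ball y])
       (use \<rho> in \<open>auto simp: sep_hol_deriv_integral[OF F \<rho>(2)]\<close>)
  with \<rho> show ?thesis unfolding G_def by (rule that)
qed

text \<open>The integral left by the differentiation under the integral sign is itself Cauchy's
  formula, now for the y-derivative of F. That formula asks for holomorphy in x, which comes from
  the same parameter lemma with the roles of x and y exchanged.\<close>

lemma sep_hol_deriv_swapped:
  assumes F: "sep_hol r F" and x: "x \<in> ball 0 r" and y: "y \<in> ball 0 r"
  shows "((\<lambda>y. deriv (\<lambda>x. F x y) x) has_field_derivative deriv (\<lambda>x. deriv (F x) y) x) (at y)"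
proof -
  let ?G = "\<lambda>x y. deriv (F x) y"
  obtain \<rho> where \<rho>: "norm x < \<rho>" "\<rho> < r"
    and D: "((\<lambda>y. deriv (\<lambda>x. F x y) x) has_field_derivative integral (cbox 0 1) (cauchy_kernel \<rho> ?G x y)) (at y)"
    by (rule sep_hol_deriv_param[OF F x y]) (rule that)
  have "\<exists>d. ((\<lambda>x. ?G x y) has_field_derivative d) (at x)" if "x \<in> ball 0 r" for x
    by (rule sep_hol_deriv_param[OF sep_hol_swap[OF F] y that]) (rule exI)
  then obtain d where "\<And>x. x \<in> ball 0 r \<Longrightarrow> ((\<lambda>x. ?G x y) has_field_derivative d x) (at x)" by metis
  then have hol: "(\<lambda>x. ?G x y) holomorphic_on ball 0 r" by (rule holomorphic_onI_DERIV)
  have "deriv (\<lambda>x. ?G x y) x = 1 / (2 * of_real pi * \<i>) *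
     contour_integral (circlepath 0 \<rho>) (\<lambda>u. ?G u y / (u - x)^2)"
  proof (intro DERIV_imp_deriv Cauchy_derivative_integral_circlepath(2))
    show "continuous_on (cball 0 \<rho>) (\<lambda>u. ?G u y)" "(\<lambda>u. ?G u y) holomorphic_on ball 0 \<rho>"
      using \<rho> hol by (auto intro: continuous_on_subset[OF holomorphic_on_imp_continuous_on] holomorphic_on_subset)
  qed (use \<rho> in auto)
  also have "\<dots> = integral (cbox 0 1) (cauchy_kernel \<rho> ?G x y)"
    by (subst contour_integral_cauchy_kernel) simp
  finally show ?thesis using D by simp
qed

lemma sep_hol_deriv:
  assumes F: "sep_hol r F"
  shows "sep_hol r (\<lambda>x y. deriv (\<lambda>x. F x y) x)"
  unfolding sep_hol_def
proof (intro conjI ballI)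
  show "(\<lambda>x. deriv (\<lambda>x. F x y) x) holomorphic_on ball 0 r" if "y \<in> ball 0 r" for y
    using F that by (auto simp: sep_hol_def intro!: holomorphic_deriv)
  show "(\<lambda>y. deriv (\<lambda>x. F x y) x) holomorphic_on ball 0 r" if "x \<in> ball 0 r" for x
    using sep_hol_deriv_swapped[OF F that] by (rule holomorphic_onI_DERIV)
qed (rule sep_hol_deriv_continuous[OF F])

text \<open>Integration along the segment from 0 to x, with y as a mere parameter. The segment stays
  in the disc, so the radius is kept.\<close>

lemma sep_hol_primitive:
  assumes F: "sep_hol r F"
  obtains P where "sep_hol r P"
    "\<And>x y. x \<in> ball 0 r \<Longrightarrow> y \<in> ball 0 r \<Longrightarrow> deriv (\<lambda>x. P x y) x = F x y"
proof
  define P where "P = (\<lambda>x y. integral (cbox 0 1) (\<lambda>s. F (of_real s * x) y * x))"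
  have sx: "norm (of_real s * x) < r" if "norm x < r" "s \<in> cbox 0 (1::real)" for s :: real and x :: complex
    using that mult_right_le_one_le[of "norm x" s] by (auto simp: norm_mult mult.commute)
  have D: "((\<lambda>x. P x y) has_field_derivative F x y) (at x)" if x: "x \<in> ball 0 r" and y: "y \<in> ball 0 r" for x y
  proof -
    have hol: "(\<lambda>x. F x y) holomorphic_on ball 0 r" using F y by (auto simp: sep_hol_def)
    have "r > 0" using x by (metis ball_eq_empty empty_iff linorder_not_le)
    \<comment> \<open>For fixed y some primitive g exists because the disc is convex; the segment
      integral then equals \<open>g x - g 0\<close>, which spares differentiating the integral in
      x.\<close>
    obtain g where g: "\<And>x. x \<in> ball 0 r \<Longrightarrow> (g has_field_derivative F x y) (at x)"
      using holomorphic_convex_primitive'[OF convex_ball open_ball hol]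
      by (metis at_within_open open_ball)
    have "P x y = g x - g 0" if x: "x \<in> ball 0 r" for x
    proof -
      have "((\<lambda>s. F (of_real s * x) y * x) has_integral (g (of_real 1 * x) - g (of_real 0 * x))) {0..1}"
      proof (intro fundamental_theorem_of_calculus)
        fix s :: real assume s: "s \<in> {0..1}"
        have "(g has_field_derivative F (of_real s * x) y) (at (of_real s * x))"
          using sx[of x s] x s by (intro g) auto
        then show "((\<lambda>s. g (of_real s * x)) has_vector_derivative F (of_real s * x) y * x) (at s within {0..1})"
          using DERIV_chain2[OF _ DERIV_cmult_right[OF DERIV_ident, of x], of g "F (of_real s * x) y" "of_real s" UNIV]
          by (intro has_vector_derivative_real_field) (auto simp: mult_ac)
      qed simp
      from integral_unique[OF this] show ?thesis
        by (simp only: P_def cbox_interval of_real_0 of_real_1 mult_1 mult_zero_left)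
    qed
    moreover have "((\<lambda>x. g x - g 0) has_field_derivative F x y) (at x)"
      using g[OF x] by (auto intro!: derivative_eq_intros)
    ultimately show ?thesis
      by (auto intro: has_field_derivative_transform_within_open[OF _ open_ball x])
  qed
  then show "deriv (\<lambda>x. P x y) x = F x y" if "x \<in> ball 0 r" "y \<in> ball 0 r" for x y
    using that DERIV_imp_deriv by blast
  have dy: "continuous_on (ball 0 r \<times> ball 0 r) (\<lambda>(x, y). deriv (F x) y)"
    using sep_hol_deriv[OF sep_hol_swap[OF F]] sep_hol_swap sep_hol_def by blast
  have "P x holomorphic_on ball 0 r" if x: "x \<in> ball 0 r" for x
    unfolding P_def
  proof (rule leibniz_rule_holomorphic[where fx = "\<lambda>y s. deriv (F (of_real s * x)) y * x"])
    show "((\<lambda>y. F (of_real s * x) y * x) has_field_derivative deriv (F (of_real s * x)) y * x) (at y within ball 0 r)"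
      if "y \<in> ball 0 r" "s \<in> cbox 0 1" for y and s :: real
      using F sx[of x s] that x
      by (intro DERIV_cmult_right holomorphic_derivI[of _ "ball 0 r"]) (auto simp: sep_hol_def)
    show "(\<lambda>s. F (of_real s * x) y * x) integrable_on cbox 0 1" if "y \<in> ball 0 r" for y
      using that x sx[of x]
      by (intro integrable_continuous continuous_intros sep_hol_continuous_compose[OF F]) auto
    have "continuous_on (ball 0 r \<times> cbox 0 (1::real)) (\<lambda>p. (\<lambda>(x, y). deriv (F x) y) (of_real (snd p) * x, fst p))"
      by (intro continuous_on_compose2[OF dy] continuous_intros) (use sx[of x] x in \<open>auto\<close>)
    then show "continuous_on (ball 0 r \<times> cbox 0 (1::real)) (\<lambda>(y, s). deriv (F (of_real s * x)) y * x)"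
      by (auto simp: split_def intro!: continuous_intros)
  qed auto
  moreover have "(\<lambda>x. P x y) holomorphic_on ball 0 r" if "y \<in> ball 0 r" for y
    using D[OF _ that] by (rule holomorphic_onI_DERIV)
  moreover have "continuous_on (ball 0 r \<times> ball 0 r) (\<lambda>p. P (fst p) (snd p))"
    unfolding P_def
    by (intro integral_continuous_on_param, unfold split_def)
       (intro continuous_intros sep_hol_continuous_compose[OF F], use sx in auto)
  ultimately show "sep_hol r P" by (auto simp: sep_hol_def split_def)
qed

section \<open>Partial derivatives and holomorphy on open sets of the plane
  \<open>complex^2\<close>\<close>

definition pt :: "complex \<Rightarrow> complex \<Rightarrow> complex^2" where
  "pt x y = (\<chi> i. if i = 1 then x else y)"

lemma pt_nth [simp]: "pt x y $ 1 = x" "pt x y $ 2 = y"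
  by (auto simp: pt_def)

lemma pt_eta [simp]: "pt (t $ 1) (t $ 2) = t"
  by (auto simp: vec_eq_iff forall_2)

lemma pt_axis: "pt x y = pt 0 y + axis 1 x" "pt x y = pt x 0 + axis 2 y"
  by (auto simp: vec_eq_iff forall_2 axis_def)

lemma bounded_linear_axis: "bounded_linear (axis i :: complex \<Rightarrow> complex^2)"
  by (rule linear_conv_bounded_linear[THEN iffD1], rule linearI) (auto simp: axis_def vec_eq_iff)

lemma has_derivative_translate_axis: "((\<lambda>x. t + axis i x :: complex^2) has_derivative axis i) (at x)"
  using has_derivative_add[OF has_derivative_const[of t] bounded_linear_imp_has_derivative[OF bounded_linear_axis[of i]], of "at x"]
  by simp

lemma continuous_on_pt [continuous_intros]:
  assumes "continuous_on S f" "continuous_on S g"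
  shows "continuous_on S (\<lambda>s. pt (f s) (g s))"
proof -
  have eq: "pt x y = axis 1 x + axis 2 y" for x y
    by (auto simp: vec_eq_iff forall_2 axis_def)
  show ?thesis unfolding eq
    by (intro continuous_intros bounded_linear.continuous_on[OF bounded_linear_axis] assms)
qed

lemma partial_deriv_eqI:
  assumes "(f has_derivative (\<lambda>v. a * v $ 1 + b * v $ 2)) (at t)"
  shows "partial_deriv 1 f t = a" "partial_deriv 2 f t = b"
proof -
  have "((\<lambda>x. f (t + axis i x)) has_derivative (\<lambda>x. a * axis i x $ 1 + b * axis i x $ 2)) (at 0)" for i
  proof -
    have "((\<lambda>x. t + axis i x) has_derivative axis i) (at 0)"
      by (rule has_derivative_translate_axis)
    moreover have e: "t + axis i 0 = t" by (auto simp: vec_eq_iff axis_def)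
    ultimately show ?thesis
      using has_derivative_compose[of "\<lambda>x. t + axis i x" "axis i" 0 UNIV f
          "\<lambda>v. a * v $ 1 + b * v $ 2", unfolded e] assms by blast
  qed
  from this[of 1] this[of 2] show "partial_deriv 1 f t = a" "partial_deriv 2 f t = b"
    unfolding partial_deriv_def
    by (intro DERIV_imp_deriv; simp add: has_field_derivative_def axis_def)+
qed

text \<open>A complex linear map is fixed by its values on the two axis vectors, and these values
  are the partial derivatives. This replaces the existential in the definition by an explicit
  derivative to compute with.\<close>

lemma mv_holomorphic_on_iff:
  fixes f :: "complex^2 \<Rightarrow> complex"
  shows "mv_holomorphic_on f U \<longleftrightarrow> (\<forall>t\<in>U. (f has_derivative
     (\<lambda>v. partial_deriv 1 f t * v $ 1 + partial_deriv 2 f t * v $ 2)) (at t))"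
proof (intro iffI ballI)
  fix t assume "mv_holomorphic_on f U" "t \<in> U"
  then obtain D where D: "(f has_derivative D) (at t)" "\<And>c v. D (c *s v) = c * D v"
    by (auto simp: mv_holomorphic_on_def)
  have lin: "linear D" using D(1) has_derivative_linear by blast
  have "D v = D (axis 1 1) * v $ 1 + D (axis 2 1) * v $ 2" for v
  proof -
    have "v = v $ 1 *s axis 1 1 + v $ 2 *s axis 2 1"
      by (auto simp: vec_eq_iff forall_2 axis_def)
    then have "D v = D (v $ 1 *s axis 1 1) + D (v $ 2 *s axis 2 1)"
      using linear_add[OF lin] by metis
    then show ?thesis by (simp add: D(2) mult.commute)
  qed
  then have "D = (\<lambda>v. D (axis 1 1) * v $ 1 + D (axis 2 1) * v $ 2)" by blast
  with D(1) have d: "(f has_derivative (\<lambda>v. D (axis 1 1) * v $ 1 + D (axis 2 1) * v $ 2)) (at t)"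
    by metis
  show "(f has_derivative (\<lambda>v. partial_deriv 1 f t * v $ 1 + partial_deriv 2 f t * v $ 2)) (at t)"
    using d by (simp add: partial_deriv_eqI[OF d])
next
  assume "\<forall>t\<in>U. (f has_derivative
     (\<lambda>v. partial_deriv 1 f t * v $ 1 + partial_deriv 2 f t * v $ 2)) (at t)"
  moreover have "partial_deriv 1 f t * (c *s v) $ 1 + partial_deriv 2 f t * (c *s v) $ 2 =
      c * (partial_deriv 1 f t * v $ 1 + partial_deriv 2 f t * v $ 2)" for t c v
    by (simp add: algebra_simps)
  ultimately show "mv_holomorphic_on f U" unfolding mv_holomorphic_on_def by blast
qed

lemma mv_holomorphic_onI:
  fixes f :: "complex^2 \<Rightarrow> complex"
  assumes "\<And>t. t \<in> U \<Longrightarrow> (f has_derivative (\<lambda>v. a t * v $ 1 + b t * v $ 2)) (at t)"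
  shows "mv_holomorphic_on f U"
  unfolding mv_holomorphic_on_iff
proof
  fix t assume "t \<in> U"
  from assms[OF this] partial_deriv_eqI[OF assms[OF this]]
  show "(f has_derivative (\<lambda>v. partial_deriv 1 f t * v $ 1 + partial_deriv 2 f t * v $ 2)) (at t)"
    by simp
qed

lemma mv_holomorphic_onD:
  fixes f :: "complex^2 \<Rightarrow> complex"
  assumes "mv_holomorphic_on f U" "t \<in> U"
  shows "(f has_derivative (\<lambda>v. partial_deriv 1 f t * v $ 1 + partial_deriv 2 f t * v $ 2)) (at t)"
  using assms mv_holomorphic_on_iff by blast

lemma mv_holomorphic_on_subset:
  "mv_holomorphic_on f U \<Longrightarrow> V \<subseteq> U \<Longrightarrow> mv_holomorphic_on f V"
  by (auto simp: mv_holomorphic_on_def)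

lemma mv_holomorphic_on_imp_continuous_on:
  "mv_holomorphic_on f U \<Longrightarrow> continuous_on U f"
  by (meson mv_holomorphic_on_def has_derivative_continuous continuous_at_imp_continuous_on)

lemma partial_deriv_eqI':
  assumes "(f has_derivative (\<lambda>v. a * v $ 1 + b * v $ 2)) (at t)"
  shows "partial_deriv i f t = (if i = 1 then a else b)"
  using partial_deriv_eqI[OF assms] exhaust_2[of i] by auto

lemma mv_holomorphic_on_const [simp]: "mv_holomorphic_on (\<lambda>t::complex^2. c) U"
  by (rule mv_holomorphic_onI[where a="\<lambda>_. 0" and b="\<lambda>_. 0"]) simp

lemma partial_deriv_const [simp]: "partial_deriv i (\<lambda>_. c) t = 0"
  by (simp add: partial_deriv_def)

lemma mv_holomorphic_on_nth: "mv_holomorphic_on (\<lambda>t::complex^2. t $ i) U"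
  by (rule mv_holomorphic_onI[where a="\<lambda>_. if i = 1 then 1 else 0" and b="\<lambda>_. if i = 1 then 0 else 1"])
     (use exhaust_2[of i] in \<open>auto intro!: bounded_linear_imp_has_derivative bounded_linear_vec_nth\<close>)

lemma partial_deriv_nth: "partial_deriv i (\<lambda>t. t $ j) t = (if i = j then 1 else 0)"
proof -
  have "((\<lambda>t::complex^2. t $ j) has_derivative (\<lambda>v. (if j = 1 then 1 else 0) * v $ 1 + (if j = 1 then 0 else 1) * v $ 2)) (at t)"
    using exhaust_2[of j] by (auto intro!: bounded_linear_imp_has_derivative bounded_linear_vec_nth)
  from partial_deriv_eqI'[OF this, of i] show ?thesis using exhaust_2[of j] exhaust_2[of i] by auto
qed

context
  fixes f g :: "complex^2 \<Rightarrow> complex" and U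
  assumes f: "mv_holomorphic_on f U" and g: "mv_holomorphic_on g U"
begin

lemma mv_has_derivative_add:
  "t \<in> U \<Longrightarrow> ((\<lambda>t. f t + g t) has_derivative (\<lambda>v. (partial_deriv 1 f t + partial_deriv 1 g t) * v $ 1
     + (partial_deriv 2 f t + partial_deriv 2 g t) * v $ 2)) (at t)"
  by (rule has_derivative_eq_rhs, rule has_derivative_add[OF mv_holomorphic_onD[OF f] mv_holomorphic_onD[OF g]])
     (auto simp: algebra_simps)

lemma mv_holomorphic_on_add: "mv_holomorphic_on (\<lambda>t. f t + g t) U"
  using mv_has_derivative_add by (rule mv_holomorphic_onI)

lemma partial_deriv_add:
  "t \<in> U \<Longrightarrow> partial_deriv i (\<lambda>t. f t + g t) t = partial_deriv i f t + partial_deriv i g t"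
  using partial_deriv_eqI[OF mv_has_derivative_add] exhaust_2[of i] by auto

lemma mv_has_derivative_mult:
  "t \<in> U \<Longrightarrow> ((\<lambda>t. f t * g t) has_derivative (\<lambda>v. (partial_deriv 1 f t * g t + f t * partial_deriv 1 g t) * v $ 1
     + (partial_deriv 2 f t * g t + f t * partial_deriv 2 g t) * v $ 2)) (at t)"
  by (rule has_derivative_eq_rhs, rule has_derivative_mult[OF mv_holomorphic_onD[OF f] mv_holomorphic_onD[OF g]])
     (auto simp: algebra_simps)

lemma mv_holomorphic_on_mult: "mv_holomorphic_on (\<lambda>t. f t * g t) U"
  using mv_has_derivative_mult by (rule mv_holomorphic_onI)

lemma partial_deriv_mult:
  "t \<in> U \<Longrightarrow> partial_deriv i (\<lambda>t. f t * g t) t = partial_deriv i f t * g t + f t * partial_deriv i g t"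
  using partial_deriv_eqI[OF mv_has_derivative_mult] exhaust_2[of i] by auto

end

lemma mv_has_derivative_compose:
  assumes f: "mv_holomorphic_on f U" and t: "t \<in> U" and g: "(g has_field_derivative g') (at (f t))"
  shows "((\<lambda>t. g (f t)) has_derivative (\<lambda>v. g' * partial_deriv 1 f t * v $ 1 + g' * partial_deriv 2 f t * v $ 2)) (at t)"
  by (rule has_derivative_eq_rhs, rule has_derivative_compose[OF mv_holomorphic_onD[OF f t]],
      rule has_field_derivative_imp_has_derivative[OF g]) (auto simp: algebra_simps)

lemma partial_deriv_compose:
  assumes "mv_holomorphic_on f U" "t \<in> U" "(g has_field_derivative g') (at (f t))"
  shows "partial_deriv i (\<lambda>t. g (f t)) t = g' * partial_deriv i f t"
  using partial_deriv_eqI[OF mv_has_derivative_compose[OF assms]] exhaust_2[of i] by auto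

lemma mv_holomorphic_on_compose:
  fixes f :: "complex^2 \<Rightarrow> complex"
  assumes f: "mv_holomorphic_on f U" and g: "g holomorphic_on S" "open S" "f ` U \<subseteq> S"
  shows "mv_holomorphic_on (\<lambda>t. g (f t)) U"
proof (rule mv_holomorphic_onI)
  fix t assume "t \<in> U"
  then have "(g has_field_derivative deriv g (f t)) (at (f t))"
    using g by (intro holomorphic_derivI[of g S]) auto
  from mv_has_derivative_compose[OF f \<open>t \<in> U\<close> this]
  show "((\<lambda>t. g (f t)) has_derivative (\<lambda>v. deriv g (f t) * partial_deriv 1 f t * v $ 1 + deriv g (f t) * partial_deriv 2 f t * v $ 2)) (at t)" .
qed

lemma mv_holomorphic_on_sum:
  "(\<And>k. k \<in> K \<Longrightarrow> mv_holomorphic_on (f k) U) \<Longrightarrow> mv_holomorphic_on (\<lambda>t::complex^2. \<Sum>k\<in>K. f k t) U"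
  by (induction K rule: infinite_finite_induct) (auto intro: mv_holomorphic_on_add)

lemma partial_deriv_sum:
  "(\<And>k. k \<in> K \<Longrightarrow> mv_holomorphic_on (f k) U) \<Longrightarrow> t \<in> U \<Longrightarrow>
     partial_deriv i (\<lambda>t::complex^2. \<Sum>k\<in>K. f k t) t = (\<Sum>k\<in>K. partial_deriv i (f k) t)"
  by (induction K rule: infinite_finite_induct)
     (auto simp: partial_deriv_add[of _ U] mv_holomorphic_on_sum)

lemma mv_holomorphic_on_minus: "mv_holomorphic_on f U \<Longrightarrow> mv_holomorphic_on (\<lambda>t::complex^2. - f t) U"
  using mv_holomorphic_on_mult[of "\<lambda>_. -1" U f] by simp

lemma mv_holomorphic_on_diff:
  "mv_holomorphic_on f U \<Longrightarrow> mv_holomorphic_on g U \<Longrightarrow> mv_holomorphic_on (\<lambda>t::complex^2. f t - g t) U"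
  using mv_holomorphic_on_add[OF _ mv_holomorphic_on_minus, of f U g] by simp

lemma mv_holomorphic_on_exp: "mv_holomorphic_on f U \<Longrightarrow> mv_holomorphic_on (\<lambda>t::complex^2. exp (f t)) U"
  by (rule mv_holomorphic_on_compose[of _ _ exp UNIV]) (auto intro: holomorphic_intros)

lemma mv_holomorphic_on_inverse:
  "mv_holomorphic_on f U \<Longrightarrow> (\<And>t. t \<in> U \<Longrightarrow> f t \<noteq> 0) \<Longrightarrow> mv_holomorphic_on (\<lambda>t::complex^2. inverse (f t)) U"
  by (rule mv_holomorphic_on_compose[of _ _ inverse "-{0}"]) (auto intro!: holomorphic_intros)

lemma mv_holomorphic_on_divide:
  "mv_holomorphic_on f U \<Longrightarrow> mv_holomorphic_on g U \<Longrightarrow> (\<And>t. t \<in> U \<Longrightarrow> g t \<noteq> 0) \<Longrightarrow>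
     mv_holomorphic_on (\<lambda>t::complex^2. f t / g t) U"
  unfolding divide_inverse by (intro mv_holomorphic_on_mult mv_holomorphic_on_inverse)

lemmas mv_holomorphic_intros = mv_holomorphic_on_add mv_holomorphic_on_mult mv_holomorphic_on_const
  mv_holomorphic_on_nth mv_holomorphic_on_sum mv_holomorphic_on_minus mv_holomorphic_on_diff
  mv_holomorphic_on_exp mv_holomorphic_on_inverse mv_holomorphic_on_divide

lemma partial_deriv_cong:
  assumes "open U" "t \<in> U" "\<And>s. s \<in> U \<Longrightarrow> f s = g s"
  shows "partial_deriv i f t = partial_deriv i g t"
  unfolding partial_deriv_def
proof (rule deriv_cong_ev)
  have "((\<lambda>x. t + axis i x) \<longlongrightarrow> t + axis i 0) (nhds 0)"
    by (intro tendsto_intros bounded_linear.tendsto[OF bounded_linear_axis] filterlim_ident)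
  moreover have "t + axis i 0 = t" by (auto simp: vec_eq_iff axis_def)
  ultimately have "\<forall>\<^sub>F x in nhds 0. t + axis i x \<in> U"
    using assms by (auto simp: tendsto_def)
  then show "\<forall>\<^sub>F x in nhds 0. f (t + axis i x) = g (t + axis i x)"
    by eventually_elim (use assms in auto)
qed simp

lemma partial_deriv_chain:
  fixes f :: "complex^2 \<Rightarrow> complex" and h :: "complex^2 \<Rightarrow> complex^2"
  assumes h: "\<And>j. mv_holomorphic_on (\<lambda>t. h t $ j) U" and f: "mv_holomorphic_on f V"
    and t: "t \<in> U" "h t \<in> V"
  shows mv_has_derivative_chain: "((\<lambda>t. f (h t)) has_derivative
          (\<lambda>v. (\<Sum>j\<in>UNIV. partial_deriv 1 (\<lambda>t. h t $ j) t * partial_deriv j f (h t)) * v $ 1 +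
               (\<Sum>j\<in>UNIV. partial_deriv 2 (\<lambda>t. h t $ j) t * partial_deriv j f (h t)) * v $ 2)) (at t)"
    and "partial_deriv i (\<lambda>t. f (h t)) t =
      (\<Sum>j\<in>UNIV. partial_deriv i (\<lambda>t. h t $ j) t * partial_deriv j f (h t))"
proof -
  define D where "D = (\<lambda>v :: complex^2. \<chi> j. partial_deriv 1 (\<lambda>t. h t $ j) t * v $ 1 + partial_deriv 2 (\<lambda>t. h t $ j) t * v $ 2)"
  have "(h has_derivative D) (at t)"
  proof (subst has_derivative_componentwise_within, intro ballI)
    fix b :: "complex^2" assume "b \<in> Basis"
    then obtain j and c :: complex where b: "b = axis j c" by (auto simp: Basis_vec_def)
    have "((\<lambda>x. h x $ j \<bullet> c) has_derivative (\<lambda>v. D v $ j \<bullet> c)) (at t)"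
      using mv_holomorphic_onD[OF h t(1), of j] unfolding D_def by (auto intro: has_derivative_inner_left)
    then show "((\<lambda>x. h x \<bullet> b) has_derivative (\<lambda>x. D x \<bullet> b)) (at t)"
      by (simp add: b inner_axis)
  qed
  from has_derivative_compose[OF this mv_holomorphic_onD[OF f t(2)]]
  show *: "((\<lambda>t. f (h t)) has_derivative
          (\<lambda>v. (\<Sum>j\<in>UNIV. partial_deriv 1 (\<lambda>t. h t $ j) t * partial_deriv j f (h t)) * v $ 1 +
               (\<Sum>j\<in>UNIV. partial_deriv 2 (\<lambda>t. h t $ j) t * partial_deriv j f (h t)) * v $ 2)) (at t)"
    by (rule has_derivative_eq_rhs) (auto simp: D_def sum_2 algebra_simps)
  show "partial_deriv i (\<lambda>t. f (h t)) t =
      (\<Sum>j\<in>UNIV. partial_deriv i (\<lambda>t. h t $ j) t * partial_deriv j f (h t))"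
    using partial_deriv_eqI[OF *] exhaust_2[of i] by auto
qed

lemma mv_holomorphic_on_compose_map:
  fixes f :: "complex^2 \<Rightarrow> complex" and h :: "complex^2 \<Rightarrow> complex^2"
  assumes "\<And>j. mv_holomorphic_on (\<lambda>t. h t $ j) U" "mv_holomorphic_on f V" "h ` U \<subseteq> V"
  shows "mv_holomorphic_on (\<lambda>t. f (h t)) U"
  by (rule mv_holomorphic_onI, rule mv_has_derivative_chain[OF assms(1,2)]) (use assms(3) in auto)

text \<open>A product of discs instead of a ball: each coordinate can move over its whole disc while
  the other is fixed, so primitives along \<open>t\<^sub>1\<close> and restriction to
  \<open>t\<^sub>1 = 0\<close> stay inside the domain.\<close>

definition bidisc :: "real \<Rightarrow> (complex^2) set" where
  "bidisc r = {t. norm (t $ 1) < r \<and> norm (t $ 2) < r}"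

lemma open_bidisc: "open (bidisc r)"
  unfolding bidisc_def by (intro open_Collect_conj open_Collect_less continuous_intros)

lemma bidisc_mono: "r \<le> s \<Longrightarrow> bidisc r \<subseteq> bidisc s"
  by (auto simp: bidisc_def)

lemma open_contains_bidisc:
  assumes "open U" "0 \<in> U"
  obtains r where "r > 0" "bidisc r \<subseteq> U"
proof -
  obtain e where e: "e > 0" "ball 0 e \<subseteq> U" using assms openE by blast
  have "norm t < e" if "t \<in> bidisc (e / 2)" for t
  proof -
    have "norm t \<le> (\<Sum>i\<in>UNIV. norm (t $ i))"
      unfolding norm_vec_def by (rule L2_set_le_sum) simp
    also have "\<dots> < e" using that by (simp add: sum_2 bidisc_def)
    finally show ?thesis .
  qed
  then show ?thesis using that[of "e/2"] e by (auto simp: subset_iff)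
qed

lemma mv_holomorphic_DERIV_axis:
  assumes "mv_holomorphic_on f U" "t + axis i x \<in> U"
  shows "((\<lambda>x. f (t + axis i x)) has_field_derivative partial_deriv i f (t + axis i x)) (at x)"
proof -
  have "((\<lambda>x. t + axis i x) has_derivative axis i) (at x)"
    by (rule has_derivative_translate_axis)
  from has_derivative_compose[OF this mv_holomorphic_onD[OF assms]]
  show ?thesis unfolding has_field_derivative_def
    by (rule has_derivative_eq_rhs) (use exhaust_2[of i] in \<open>auto simp: axis_def\<close>)
qed

lemma mv_holomorphic_DERIV_pt:
  assumes "mv_holomorphic_on f U" "pt x y \<in> U"
  shows "((\<lambda>x. f (pt x y)) has_field_derivative partial_deriv 1 f (pt x y)) (at x)"
    and "((\<lambda>y. f (pt x y)) has_field_derivative partial_deriv 2 f (pt x y)) (at y)"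
  using mv_holomorphic_DERIV_axis[OF assms(1), of "pt 0 y" 1 x]
    mv_holomorphic_DERIV_axis[OF assms(1), of "pt x 0" 2 y] assms(2)
  by (auto simp flip: pt_axis)

lemma mv_holomorphic_imp_sep_hol:
  assumes f: "mv_holomorphic_on f (bidisc r)"
  shows "sep_hol r (\<lambda>x y. f (pt x y))"
  unfolding sep_hol_def split_def
proof (intro conjI ballI)
  show "continuous_on (ball 0 r \<times> ball 0 r) (\<lambda>p. f (pt (fst p) (snd p)))"
    by (intro continuous_on_compose2[OF mv_holomorphic_on_imp_continuous_on[OF f]] continuous_intros)
       (auto simp: bidisc_def)
  show "(\<lambda>x. f (pt x y)) holomorphic_on ball 0 r" if "y \<in> ball 0 r" for y
    using mv_holomorphic_DERIV_pt(1)[OF f, of _ y] that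
    by (intro holomorphic_onI_DERIV) (auto simp: bidisc_def)
  show "(\<lambda>y. f (pt x y)) holomorphic_on ball 0 r" if "x \<in> ball 0 r" for x
    using mv_holomorphic_DERIV_pt(2)[OF f, of x] that
    by (intro holomorphic_onI_DERIV) (auto simp: bidisc_def)
qed

text \<open>Osgood's lemma. Existence of the x-derivative together with a jointly continuous
  y-derivative gives total differentiability, and the continuity was obtained from Cauchy's
  formula.\<close>

lemma osgood_has_derivative:
  assumes F: "sep_hol r F" and t: "t \<in> bidisc r"
  shows "((\<lambda>t. F (t $ 1) (t $ 2)) has_derivative
     (\<lambda>v. deriv (\<lambda>x. F x (t $ 2)) (t $ 1) * v $ 1 + deriv (F (t $ 1)) (t $ 2) * v $ 2)) (at t)"
proof -
  let ?x = "t $ 1" and ?y = "t $ 2" and ?B = "ball 0 r :: complex set"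
  let ?L = "\<lambda>x y. blinfun_mult_left (deriv (F x) y)"
  have xy: "?x \<in> ?B" "?y \<in> ?B" using t by (auto simp: bidisc_def)
  have c: "continuous_on (?B \<times> ?B) (\<lambda>(x, y). deriv (F x) y)"
    using sep_hol_swap[OF sep_hol_deriv[OF sep_hol_swap[OF F]]] by (auto simp: sep_hol_def)
  have "((\<lambda>(x, y). F x y) has_derivative (\<lambda>(u, v). deriv (\<lambda>x. F x ?y) ?x * u + blinfun_apply (?L ?x ?y) v))
          (at (?x, ?y) within ?B \<times> ?B)"
  proof (rule has_derivative_partialsI)
    have "(\<lambda>x. F x ?y) holomorphic_on ?B" using F xy by (auto simp: sep_hol_def)
    then show "((\<lambda>x. F x ?y) has_derivative (*) (deriv (\<lambda>x. F x ?y) ?x)) (at ?x within ?B)"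
      using xy by (intro has_field_derivative_imp_has_derivative holomorphic_derivI) auto
    show "(F x has_derivative blinfun_apply (?L x y)) (at y within ?B)" if "x \<in> ?B" "y \<in> ?B" for x y
    proof -
      have "(F x has_field_derivative deriv (F x) y) (at y within ?B)"
        using F that by (intro holomorphic_derivI[of "F x" ?B]) (auto simp: sep_hol_def)
      then show ?thesis by (simp add: has_field_derivative_def mult.commute[of _ "deriv (F x) y"] fun_eq_iff)
    qed
    have "continuous_on (?B \<times> ?B) (\<lambda>p. blinfun_mult_left ((\<lambda>(x, y). deriv (F x) y) p))"
      by (intro bounded_linear.continuous_on[OF bounded_linear_blinfun_mult_left] c)
    then show "continuous (at (?x, ?y) within ?B \<times> ?B) (\<lambda>(x, y). ?L x y)"
      using xy by (auto simp: continuous_on_eq_continuous_within split_def)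
  qed (use xy in auto)
  then have "((\<lambda>(x, y). F x y) has_derivative (\<lambda>(u, v). deriv (\<lambda>x. F x ?y) ?x * u + deriv (F ?x) ?y * v)) (at (?x, ?y))"
    using xy by (simp add: at_within_open[of _ "?B \<times> ?B"] open_Times split_def mult.commute)
  moreover have "((\<lambda>t::complex^2. (t $ 1, t $ 2)) has_derivative (\<lambda>v. (v $ 1, v $ 2))) (at t)"
    by (intro has_derivative_Pair bounded_linear_imp_has_derivative bounded_linear_vec_nth)
  ultimately show ?thesis
    using has_derivative_compose[of "\<lambda>t::complex^2. (t $ 1, t $ 2)" "\<lambda>v. (v $ 1, v $ 2)" t UNIV "\<lambda>(x, y). F x y"
        "\<lambda>(u, v). deriv (\<lambda>x. F x ?y) ?x * u + deriv (F ?x) ?y * v"] by simp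
qed

lemma sep_hol_imp_mv_holomorphic:
  "sep_hol r F \<Longrightarrow> mv_holomorphic_on (\<lambda>t. F (t $ 1) (t $ 2)) (bidisc r)"
  using osgood_has_derivative by (rule mv_holomorphic_onI)

lemma partial_deriv_pt:
  assumes "mv_holomorphic_on f U" "t \<in> U"
  shows "partial_deriv 1 f t = deriv (\<lambda>x. f (pt x (t $ 2))) (t $ 1)"
    and "partial_deriv 2 f t = deriv (\<lambda>y. f (pt (t $ 1) y)) (t $ 2)"
  using mv_holomorphic_DERIV_pt[OF assms(1), of "t $ 1" "t $ 2"] assms(2)
  by (auto intro!: DERIV_imp_deriv[symmetric])

lemma mv_holomorphic_on_cong:
  assumes "mv_holomorphic_on f U" "open U" "\<And>t. t \<in> U \<Longrightarrow> f t = g t"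
  shows "mv_holomorphic_on g (U :: (complex^2) set)"
proof -
  have "(g has_derivative D) (at t)" if "(f has_derivative D) (at t)" "t \<in> U" for D t
    using that assms by (auto intro: has_derivative_transform_within_open)
  then show ?thesis using assms(1) unfolding mv_holomorphic_on_def by blast
qed

lemma mv_holomorphic_partial_deriv:
  assumes f: "mv_holomorphic_on f (bidisc r)"
  shows "mv_holomorphic_on (partial_deriv i f) (bidisc r)"
proof -
  note F = mv_holomorphic_imp_sep_hol[OF f]
  have "mv_holomorphic_on (partial_deriv 1 f) (bidisc r)"
    by (rule mv_holomorphic_on_cong[OF sep_hol_imp_mv_holomorphic[OF sep_hol_deriv[OF F]] open_bidisc])
       (simp add: partial_deriv_pt[OF f])
  moreover have "mv_holomorphic_on (partial_deriv 2 f) (bidisc r)"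
    by (rule mv_holomorphic_on_cong[OF sep_hol_imp_mv_holomorphic[OF sep_hol_swap[OF sep_hol_deriv[OF sep_hol_swap[OF F]]]] open_bidisc])
       (simp add: partial_deriv_pt[OF f])
  ultimately show ?thesis using exhaust_2[of i] by auto
qed

lemma partial_deriv_commute:
  assumes f: "mv_holomorphic_on f (bidisc r)" and t: "t \<in> bidisc r"
  shows "partial_deriv 2 (partial_deriv 1 f) t = partial_deriv 1 (partial_deriv 2 f) t"
proof -
  note F = mv_holomorphic_imp_sep_hol[OF f]
  let ?x = "t $ 1" and ?y = "t $ 2"
  have in_bidisc: "pt x y \<in> bidisc r \<longleftrightarrow> x \<in> ball 0 r \<and> y \<in> ball 0 r" for x y
    by (auto simp: bidisc_def)
  have xy: "?x \<in> ball 0 r" "?y \<in> ball 0 r" using t by (auto simp: bidisc_def)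
  have "partial_deriv 2 (partial_deriv 1 f) t = deriv (\<lambda>y. partial_deriv 1 f (pt ?x y)) ?y"
    by (rule partial_deriv_pt[OF mv_holomorphic_partial_deriv[OF f] t])
  also have "\<dots> = deriv (\<lambda>y. deriv (\<lambda>x. f (pt x y)) ?x) ?y"
    by (rule deriv_cong_ev) (use xy in \<open>auto intro!: eventually_mono[OF eventually_nhds_in_open[of "ball 0 r"]]
          simp: partial_deriv_pt[OF f] in_bidisc\<close>)
  also have "\<dots> = deriv (\<lambda>x. deriv (\<lambda>y. f (pt x y)) ?y) ?x"
    using sep_hol_deriv_swapped[OF F xy] by (rule DERIV_imp_deriv)
  also have "\<dots> = deriv (\<lambda>x. partial_deriv 2 f (pt x ?y)) ?x"
    by (rule deriv_cong_ev) (use xy in \<open>auto intro!: eventually_mono[OF eventually_nhds_in_open[of "ball 0 r"]]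
          simp: partial_deriv_pt[OF f] in_bidisc\<close>)
  also have "\<dots> = partial_deriv 1 (partial_deriv 2 f) t"
    by (rule partial_deriv_pt[OF mv_holomorphic_partial_deriv[OF f] t, symmetric])
  finally show ?thesis .
qed

lemma mv_holomorphic_primitive:
  assumes f: "mv_holomorphic_on f (bidisc r)"
  obtains P where "mv_holomorphic_on P (bidisc r)" "\<And>t. t \<in> bidisc r \<Longrightarrow> partial_deriv 1 P t = f t"
proof -
  obtain P where P: "sep_hol r P" "\<And>x y. x \<in> ball 0 r \<Longrightarrow> y \<in> ball 0 r \<Longrightarrow> deriv (\<lambda>x. P x y) x = f (pt x y)"
    using sep_hol_primitive[OF mv_holomorphic_imp_sep_hol[OF f]] by metis
  show ?thesis
  proof
    show hol: "mv_holomorphic_on (\<lambda>t. P (t $ 1) (t $ 2)) (bidisc r)"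
      by (rule sep_hol_imp_mv_holomorphic[OF P(1)])
    show "partial_deriv 1 (\<lambda>t. P (t $ 1) (t $ 2)) t = f t" if "t \<in> bidisc r" for t
      using partial_deriv_pt(1)[OF hol that] P(2)[of "t $ 1" "t $ 2"] that by (auto simp: bidisc_def)
  qed
qed

section \<open>Formal series with holomorphic coefficients\<close>

definition formal_on :: "(complex^2) set \<Rightarrow> (complex^2 \<Rightarrow> complex fps) \<Rightarrow> bool" where
  "formal_on U a \<longleftrightarrow> (\<forall>n. mv_holomorphic_on (\<lambda>t. fps_nth (a t) n) U)"

definition fps_partial :: "2 \<Rightarrow> (complex^2 \<Rightarrow> complex fps) \<Rightarrow> complex^2 \<Rightarrow> complex fps" where
  "fps_partial i a t = Abs_fps (\<lambda>n. partial_deriv i (\<lambda>s. fps_nth (a s) n) t)"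

lemma formal_onD: "formal_on U a \<Longrightarrow> mv_holomorphic_on (\<lambda>t. fps_nth (a t) n) U"
  by (simp add: formal_on_def)

lemma formal_on_subset: "formal_on U a \<Longrightarrow> V \<subseteq> U \<Longrightarrow> formal_on V a"
  by (auto simp: formal_on_def intro: mv_holomorphic_on_subset)

lemma formal_on_const [simp]: "formal_on U (\<lambda>t. c)"
  by (simp add: formal_on_def)

lemma formal_on_fps_const: "mv_holomorphic_on f U \<Longrightarrow> formal_on U (\<lambda>t. fps_const (f t))"
  unfolding formal_on_def
proof
  fix n assume "mv_holomorphic_on f U"
  then show "mv_holomorphic_on (\<lambda>t. fps_nth (fps_const (f t)) n) U" by (cases n) auto
qed

lemma formal_on_add: "formal_on U a \<Longrightarrow> formal_on U b \<Longrightarrow> formal_on U (\<lambda>t. a t + b t)"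
  by (simp add: formal_on_def mv_holomorphic_on_add)

lemma formal_on_minus: "formal_on U a \<Longrightarrow> formal_on U (\<lambda>t. - a t)"
  by (simp add: formal_on_def mv_holomorphic_on_minus)

lemma formal_on_diff: "formal_on U a \<Longrightarrow> formal_on U b \<Longrightarrow> formal_on U (\<lambda>t. a t - b t)"
  by (simp add: formal_on_def mv_holomorphic_on_diff)

lemma formal_on_mult: "formal_on U a \<Longrightarrow> formal_on U b \<Longrightarrow> formal_on U (\<lambda>t. a t * b t)"
  by (auto simp: formal_on_def fps_mult_nth intro!: mv_holomorphic_intros)

lemma formal_on_shift: "formal_on U a \<Longrightarrow> formal_on U (\<lambda>t. fps_shift k (a t))"
  by (simp add: formal_on_def)

lemma formal_on_inverse:
  assumes a: "formal_on U a" and nz: "\<And>t. t \<in> U \<Longrightarrow> fps_nth (a t) 0 \<noteq> 0"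
  shows "formal_on U (\<lambda>t. inverse (a t))"
  unfolding formal_on_def
proof
  fix n show "mv_holomorphic_on (\<lambda>t. fps_nth (inverse (a t)) n) U"
  proof (induction n rule: less_induct)
    case (less n)
    show ?case
    proof (cases n)
      case 0
      with nz show ?thesis by (auto simp: intro!: mv_holomorphic_intros formal_onD[OF a])
    next
      case (Suc m)
      have eq: "fps_nth (inverse (a t)) n =
          - inverse (fps_nth (a t) 0) * (\<Sum>i = 1..n. fps_nth (a t) i * fps_nth (inverse (a t)) (n - i))" for t
        using Suc by (simp add: fps_inverse_def)
      show ?thesis unfolding eq
        by (intro mv_holomorphic_intros formal_onD[OF a] nz less) (use Suc in auto)
    qed
  qed
qed

lemma formal_on_partial: "formal_on (bidisc r) a \<Longrightarrow> formal_on (bidisc r) (fps_partial i a)"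
  by (simp add: formal_on_def fps_partial_def mv_holomorphic_partial_deriv)

lemma formal_on_sum:
  "(\<And>k. k \<in> K \<Longrightarrow> formal_on U (a k)) \<Longrightarrow> formal_on U (\<lambda>t. \<Sum>k\<in>K. a k t)"
  by (induction K rule: infinite_finite_induct) (auto intro: formal_on_add)

lemmas formal_intros = formal_on_const formal_on_add formal_on_minus formal_on_diff formal_on_mult
  formal_on_shift formal_on_inverse formal_on_partial formal_on_sum

lemma fps_partial_const [simp]: "fps_partial i (\<lambda>t. c) t = 0"
  by (simp add: fps_partial_def fps_eq_iff)

lemma fps_partial_add:
  "formal_on U a \<Longrightarrow> formal_on U b \<Longrightarrow> t \<in> U \<Longrightarrow>
     fps_partial i (\<lambda>t. a t + b t) t = fps_partial i a t + fps_partial i b t"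
  by (auto simp: fps_partial_def fps_eq_iff formal_on_def partial_deriv_add[of _ U])

lemma fps_partial_mult:
  assumes "formal_on U a" "formal_on U b" "t \<in> U"
  shows "fps_partial i (\<lambda>t. a t * b t) t = fps_partial i a t * b t + a t * fps_partial i b t"
proof -
  have "partial_deriv i (\<lambda>s. \<Sum>k=0..n. fps_nth (a s) k * fps_nth (b s) (n - k)) t =
     (\<Sum>k=0..n. partial_deriv i (\<lambda>s. fps_nth (a s) k) t * fps_nth (b t) (n - k)) +
     (\<Sum>k=0..n. fps_nth (a t) k * partial_deriv i (\<lambda>s. fps_nth (b s) (n - k)) t)" for n
    using assms
    by (subst partial_deriv_sum[of _ _ U])
       (auto simp: formal_on_def partial_deriv_mult[of _ U] sum.distrib intro!: mv_holomorphic_on_mult)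
  then show ?thesis by (simp add: fps_partial_def fps_eq_iff fps_mult_nth)
qed

lemma fps_partial_cmult:
  "formal_on U a \<Longrightarrow> t \<in> U \<Longrightarrow> fps_partial i (\<lambda>t. c * a t) t = c * fps_partial i a t"
  using fps_partial_mult[of U "\<lambda>_. c" a t i] by simp

lemma fps_partial_diff:
  "formal_on U a \<Longrightarrow> formal_on U b \<Longrightarrow> t \<in> U \<Longrightarrow>
     fps_partial i (\<lambda>t. a t - b t) t = fps_partial i a t - fps_partial i b t"
  using fps_partial_add[of U a "\<lambda>t. -1 * b t" t i] fps_partial_cmult[of U b t i "-1"]
    formal_on_minus[of U b] by simp

lemma fps_partial_cong:
  "open U \<Longrightarrow> t \<in> U \<Longrightarrow> (\<And>s. s \<in> U \<Longrightarrow> a s = b s) \<Longrightarrow> fps_partial i a t = fps_partial i b t"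
  unfolding fps_partial_def fps_eq_iff by (auto intro!: partial_deriv_cong[of U])

lemma fps_partial_commute:
  "formal_on (bidisc r) a \<Longrightarrow> t \<in> bidisc r \<Longrightarrow>
     fps_partial 2 (fps_partial 1 a) t = fps_partial 1 (fps_partial 2 a) t"
  unfolding fps_partial_def fps_eq_iff formal_on_def
  using partial_deriv_commute[of "\<lambda>t. fps_nth (a t) n" r t for n] by simp

lemma partial_mat_nth: "partial_mat i M t $ j $ k = fps_partial i (\<lambda>t. M t $ j $ k) t"
  by (simp add: partial_mat_def fps_partial_def)

lemma zero_in_bidisc: "r > 0 \<Longrightarrow> 0 \<in> bidisc r"
  by (simp add: bidisc_def)

text \<open>Statements about germs become statements about all small radii. Finitely many of them
  can then be combined as filter statements, and one common radius is extracted at the end.\<close>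

lemma eventually_nhds_bidisc:
  "(\<forall>\<^sub>F t in nhds 0. P t) \<longleftrightarrow> (\<forall>\<^sub>F r in at_right 0. \<forall>t\<in>bidisc r. P t)"
proof
  assume "\<forall>\<^sub>F t in nhds 0. P t"
  then obtain U where "open U" "0 \<in> U" "\<And>t. t \<in> U \<Longrightarrow> P t"
    by (auto simp: eventually_nhds)
  then obtain r where "r > 0" "bidisc r \<subseteq> U" using open_contains_bidisc by metis
  then show "\<forall>\<^sub>F r in at_right 0. \<forall>t\<in>bidisc r. P t"
    using \<open>\<And>t. t \<in> U \<Longrightarrow> P t\<close>
    by (intro eventually_at_rightI[of 0 r]) (auto dest!: less_imp_le bidisc_mono)
next
  assume "\<forall>\<^sub>F r in at_right 0. \<forall>t\<in>bidisc r. P t"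
  then have "\<forall>\<^sub>F r in at_right (0::real). r > 0 \<and> (\<forall>t\<in>bidisc r. P t)"
    by (intro eventually_conj eventually_at_right_less)
  then obtain r :: real where "r > 0" "\<forall>t\<in>bidisc r. P t"
    using eventually_happens[of _ "at_right (0::real)"] by auto
  then show "\<forall>\<^sub>F t in nhds 0. P t"
    unfolding eventually_nhds by (intro exI[of _ "bidisc r"]) (simp_all add: open_bidisc zero_in_bidisc)
qed

lemma formal_series_iff: "formal_series a \<longleftrightarrow> (\<forall>\<^sub>F r in at_right 0. formal_on (bidisc r) a)"
proof
  assume "formal_series a"
  then obtain U where U: "open U" "0 \<in> U" "formal_on U a"
    by (auto simp: formal_series_def formal_on_def)
  then obtain r where "r > 0" "bidisc r \<subseteq> U" using open_contains_bidisc by metis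
  then show "\<forall>\<^sub>F r in at_right 0. formal_on (bidisc r) a"
    by (intro eventually_at_rightI[of 0 r] formal_on_subset[OF U(3)]) (auto dest!: less_imp_le bidisc_mono)
next
  assume "\<forall>\<^sub>F r in at_right 0. formal_on (bidisc r) a"
  then have "\<forall>\<^sub>F r in at_right (0::real). r > 0 \<and> formal_on (bidisc r) a"
    by (intro eventually_conj eventually_at_right_less)
  then obtain r :: real where "r > 0" "formal_on (bidisc r) a"
    using eventually_happens[of _ "at_right (0::real)"] by auto
  then show "formal_series a"
    unfolding formal_series_def formal_on_def
    by (intro exI[of _ "bidisc r"]) (simp_all add: open_bidisc zero_in_bidisc)
qed

lemma formal_seriesI: "r > 0 \<Longrightarrow> formal_on (bidisc r) a \<Longrightarrow> formal_series a"
  unfolding formal_series_def formal_on_def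
  by (intro exI[of _ "bidisc r"]) (simp_all add: open_bidisc zero_in_bidisc)

lemma eventually_nhds_bidiscI: "r > 0 \<Longrightarrow> (\<And>t. t \<in> bidisc r \<Longrightarrow> P t) \<Longrightarrow> \<forall>\<^sub>F t in nhds 0. P t"
  unfolding eventually_nhds by (intro exI[of _ "bidisc r"]) (simp_all add: open_bidisc zero_in_bidisc)


section \<open>Formal series whose coefficients depend on one variable only\<close>

definition hol_fps :: "complex set \<Rightarrow> (complex \<Rightarrow> complex fps) \<Rightarrow> bool" where
  "hol_fps S a \<longleftrightarrow> (\<forall>n. (\<lambda>x. fps_nth (a x) n) holomorphic_on S)"

definition fps_d :: "(complex \<Rightarrow> complex fps) \<Rightarrow> complex \<Rightarrow> complex fps" where
  "fps_d a x = Abs_fps (\<lambda>n. deriv (\<lambda>y. fps_nth (a y) n) x)"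

lemma fps_d_nth [simp]: "fps_nth (fps_d a x) n = deriv (\<lambda>y. fps_nth (a y) n) x"
  by (simp add: fps_d_def)

lemma hol_fpsD: "hol_fps S a \<Longrightarrow> (\<lambda>x. fps_nth (a x) n) holomorphic_on S"
  by (simp add: hol_fps_def)

lemma hol_fps_subset: "hol_fps S a \<Longrightarrow> V \<subseteq> S \<Longrightarrow> hol_fps V a"
  by (auto simp: hol_fps_def intro: holomorphic_on_subset)

lemma hol_fps_const [simp]: "hol_fps S (\<lambda>t. c)"
  by (simp add: hol_fps_def)

lemma hol_fps_fps_const: "f holomorphic_on S \<Longrightarrow> hol_fps S (\<lambda>t. fps_const (f t))"
  unfolding hol_fps_def
proof
  fix n assume "f holomorphic_on S"
  then show "(\<lambda>x. fps_nth (fps_const (f x)) n) holomorphic_on S" by (cases n) auto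
qed

lemma hol_fps_add: "hol_fps S a \<Longrightarrow> hol_fps S b \<Longrightarrow> hol_fps S (\<lambda>t. a t + b t)"
  by (auto simp: hol_fps_def intro: holomorphic_intros)

lemma hol_fps_minus: "hol_fps S a \<Longrightarrow> hol_fps S (\<lambda>t. - a t)"
  by (auto simp: hol_fps_def intro: holomorphic_intros)

lemma hol_fps_diff: "hol_fps S a \<Longrightarrow> hol_fps S b \<Longrightarrow> hol_fps S (\<lambda>t. a t - b t)"
  by (auto simp: hol_fps_def intro: holomorphic_intros)

lemma hol_fps_mult: "hol_fps S a \<Longrightarrow> hol_fps S b \<Longrightarrow> hol_fps S (\<lambda>t. a t * b t)"
  by (auto simp: hol_fps_def fps_mult_nth intro!: holomorphic_intros)

lemma hol_fps_shift: "hol_fps S a \<Longrightarrow> hol_fps S (\<lambda>t. fps_shift k (a t))"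
  by (simp add: hol_fps_def)

lemma hol_fps_inverse:
  assumes a: "hol_fps S a" and nz: "\<And>t. t \<in> S \<Longrightarrow> fps_nth (a t) 0 \<noteq> 0"
  shows "hol_fps S (\<lambda>t. inverse (a t))"
  unfolding hol_fps_def
proof
  fix n show "(\<lambda>t. fps_nth (inverse (a t)) n) holomorphic_on S"
  proof (induction n rule: less_induct)
    case (less n)
    show ?case
    proof (cases n)
      case 0
      with nz show ?thesis by (auto simp: intro!: holomorphic_intros hol_fpsD[OF a])
    next
      case (Suc m)
      have eq: "fps_nth (inverse (a t)) n =
          - inverse (fps_nth (a t) 0) * (\<Sum>i = 1..n. fps_nth (a t) i * fps_nth (inverse (a t)) (n - i))" for t
        using Suc by (simp add: fps_inverse_def)
      show ?thesis unfolding eq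
        by (intro holomorphic_intros hol_fpsD[OF a] nz less) (use Suc in auto)
    qed
  qed
qed

lemma hol_fps_d: "hol_fps S a \<Longrightarrow> open S \<Longrightarrow> hol_fps S (fps_d a)"
  by (simp add: hol_fps_def holomorphic_deriv)

lemma hol_fps_compose:
  "hol_fps S a \<Longrightarrow> f holomorphic_on V \<Longrightarrow> f ` V \<subseteq> S \<Longrightarrow> hol_fps V (\<lambda>x. a (f x))"
  unfolding hol_fps_def using holomorphic_on_compose_gen[of f V _ S] by (auto simp: o_def)

lemmas hol_fps_intros = hol_fps_const hol_fps_add hol_fps_minus hol_fps_diff hol_fps_mult
  hol_fps_shift hol_fps_inverse hol_fps_d hol_fps_fps_const

lemma hol_fps_differentiable:
  "hol_fps S a \<Longrightarrow> open S \<Longrightarrow> x \<in> S \<Longrightarrow> (\<lambda>y. fps_nth (a y) n) field_differentiable at x"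
  unfolding hol_fps_def using holomorphic_on_imp_differentiable_at by blast

lemma fps_d_const [simp]: "fps_d (\<lambda>t. c) x = 0"
  by (simp add: fps_eq_iff)

lemma fps_d_fps_const: "fps_d (\<lambda>t. fps_const (f t)) x = fps_const (deriv f x)"
proof -
  have "deriv (\<lambda>y. fps_nth (fps_const (f y)) n) x = fps_nth (fps_const (deriv f x)) n" for n
    by (cases n) auto
  then show ?thesis by (simp add: fps_eq_iff)
qed

lemma fps_d_add:
  "hol_fps S a \<Longrightarrow> hol_fps S b \<Longrightarrow> open S \<Longrightarrow> x \<in> S \<Longrightarrow>
     fps_d (\<lambda>t. a t + b t) x = fps_d a x + fps_d b x"
  by (auto simp: fps_eq_iff hol_fps_differentiable[of S])

lemma fps_d_mult:
  assumes "hol_fps S a" "hol_fps S b" "open S" "x \<in> S"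
  shows "fps_d (\<lambda>t. a t * b t) x = fps_d a x * b x + a x * fps_d b x"
proof -
  have d: "((\<lambda>y. fps_nth (a y) k) has_field_derivative fps_nth (fps_d a x) k) (at x)"
    "((\<lambda>y. fps_nth (b y) k) has_field_derivative fps_nth (fps_d b x) k) (at x)" for k
    using assms by (auto intro!: holomorphic_derivI[of _ S] hol_fpsD)
  have "deriv (\<lambda>s. \<Sum>k=0..n. fps_nth (a s) k * fps_nth (b s) (n - k)) x =
     (\<Sum>k=0..n. fps_nth (a x) k * fps_nth (fps_d b x) (n - k) + fps_nth (fps_d a x) k * fps_nth (b x) (n - k))" for n
    by (intro DERIV_imp_deriv DERIV_sum DERIV_mult' d)
  then show ?thesis
    by (simp add: fps_eq_iff fps_mult_nth sum.distrib add.commute del: fps_d_nth)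
      (simp add: fps_mult_nth)
qed

lemma fps_d_cmult:
  "hol_fps S a \<Longrightarrow> open S \<Longrightarrow> x \<in> S \<Longrightarrow> fps_d (\<lambda>t. c * a t) x = c * fps_d a x"
  using fps_d_mult[of S "\<lambda>_. c" a x] by simp

lemma fps_d_cong:
  assumes "open S" "x \<in> S" "\<And>y. y \<in> S \<Longrightarrow> a y = b y"
  shows "fps_d a x = fps_d b x"
proof -
  have "\<forall>\<^sub>F y in nhds x. a y = b y"
    using assms by (auto simp: eventually_nhds)
  then have "deriv (\<lambda>y. fps_nth (a y) n) x = deriv (\<lambda>y. fps_nth (b y) n) x" for n
    by (intro deriv_cong_ev) (auto elim: eventually_mono)
  then show ?thesis by (simp add: fps_eq_iff)
qed

lemma formal_on_hol_fps:
  assumes "hol_fps (ball 0 r) a"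
  shows "formal_on (bidisc r) (\<lambda>t. a (t $ 2))"
  unfolding formal_on_def
proof
  fix n show "mv_holomorphic_on (\<lambda>t. fps_nth (a (t $ 2)) n) (bidisc r)"
    by (rule mv_holomorphic_on_compose[OF mv_holomorphic_on_nth hol_fpsD[OF assms]])
       (auto simp: bidisc_def)
qed

lemma fps_partial_hol_fps:
  assumes a: "hol_fps (ball 0 r) a" and t: "t \<in> bidisc r"
  shows "fps_partial i (\<lambda>t. a (t $ 2)) t = (if i = 1 then 0 else fps_d a (t $ 2))"
proof -
  have "partial_deriv i (\<lambda>s. fps_nth (a (s $ 2)) n) t =
      deriv (\<lambda>y. fps_nth (a y) n) (t $ 2) * partial_deriv i (\<lambda>t. t $ 2) t" for n
    by (rule partial_deriv_compose[OF mv_holomorphic_on_nth t])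
       (use t in \<open>auto intro!: holomorphic_derivI[OF hol_fpsD[OF a]] simp: bidisc_def\<close>)
  then show ?thesis using exhaust_2[of i] by (auto simp: fps_partial_def fps_eq_iff partial_deriv_nth)
qed

lemma formal_on_restrict:
  assumes "formal_on (bidisc r) a" "r > 0"
  shows "hol_fps (ball 0 r) (\<lambda>y. a (pt 0 y))"
  unfolding hol_fps_def
  using mv_holomorphic_imp_sep_hol[OF formal_onD[OF assms(1)]] assms(2) by (auto simp: sep_hol_def)

lemma fps_partial_2_restrict:
  assumes "formal_on (bidisc r) a" "y \<in> ball 0 r"
  shows "fps_partial 2 a (pt 0 y) = fps_d (\<lambda>y. a (pt 0 y)) y"
proof -
  have "r > 0" using assms(2) by (metis ball_eq_empty empty_iff not_le)
  then have "pt 0 y \<in> bidisc r" using assms(2) by (auto simp: bidisc_def)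
  then show ?thesis
    using partial_deriv_pt(2)[OF formal_onD[OF assms(1)], of "pt 0 y"]
    by (simp add: fps_partial_def fps_eq_iff)
qed

lemma formal_on_independent:
  assumes a: "formal_on (bidisc r) a" and d: "\<And>t. t \<in> bidisc r \<Longrightarrow> fps_partial 1 a t = 0" and t: "t \<in> bidisc r"
  shows "a t = a (pt 0 (t $ 2))"
proof -
  have r: "r > 0" using t norm_ge_zero[of "t $ 1"] by (auto simp: bidisc_def simp del: norm_ge_zero)
  have "fps_nth (a (pt (t $ 1) (t $ 2))) n = fps_nth (a (pt 0 (t $ 2))) n" for n
  proof (rule has_field_derivative_zero_constant[of "ball 0 r" "\<lambda>x. fps_nth (a (pt x (t $ 2))) n", THEN exE])
    fix x :: complex assume x: "x \<in> ball 0 r"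
    then have "pt x (t $ 2) \<in> bidisc r" using t by (auto simp: bidisc_def)
    from mv_holomorphic_DERIV_pt(1)[OF formal_onD[OF a] this, of n] d[OF this]
    have "((\<lambda>x. fps_nth (a (pt x (t $ 2))) n) has_field_derivative 0) (at x)"
      by (simp add: fps_partial_def fps_eq_iff)
    then show "((\<lambda>x. fps_nth (a (pt x (t $ 2))) n) has_field_derivative 0) (at x within ball 0 r)"
      by (rule has_field_derivative_at_within)
  next
    fix c assume "\<forall>x\<in>ball 0 r. fps_nth (a (pt x (t $ 2))) n = c"
    moreover have "t $ 1 \<in> ball 0 r" "0 \<in> ball (0::complex) r" using t r by (auto simp: bidisc_def)
    ultimately show ?thesis by (simp del: pt_eta)
  qed auto
  then show ?thesis by (simp add: fps_eq_iff)
qed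

text \<open>Well-founded dependent choice, the engine of all order-by-order constructions. The first
  assumption says that the n-th requirement looks only at earlier values; the second may use that
  the earlier values met their requirements.\<close>

lemma recursive_choice:
  assumes "\<And>n s s' y. (\<And>k. k < n \<Longrightarrow> s k = s' k) \<Longrightarrow> P s n y = P s' n y"
    and "\<And>n s. (\<And>k. k < n \<Longrightarrow> P s k (s k)) \<Longrightarrow> \<exists>y. P s n y"
  shows "\<exists>s. \<forall>n::nat. P s n (s n)"
proof (rule dependent_wf_choice[OF wf_less_than])
  show "P f x r = P g x r" if "\<And>z. (z, x) \<in> less_than \<Longrightarrow> f z = g z" for f g x r
    by (rule assms(1)) (simp add: that)
  show "\<exists>r. P f x r" if "\<And>y. (y, x) \<in> less_than \<Longrightarrow> P f y (f y)" for f x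
    by (rule assms(2)) (simp add: that)
qed

text \<open>Separates the term with the highest coefficient of a, the unknown at order n, from the
  terms that involve only coefficients already found.\<close>

lemma fps_mult_nth_last:
  "fps_nth (a * b) n = a' * fps_nth b 0 + (\<Sum>i<n. fps_nth a i * fps_nth b (n - i))" if "fps_nth a n = a'"
  by (simp add: fps_mult_nth atLeast0AtMost that add.commute flip: lessThan_Suc_atMost)

lemma linear_ode_nonvanishing:
  assumes a: "mv_holomorphic_on a (bidisc r)"
  obtains u where "mv_holomorphic_on u (bidisc r)" "\<And>t. u t \<noteq> 0"
    "\<And>t. t \<in> bidisc r \<Longrightarrow> partial_deriv 1 u t = a t * u t"
proof -
  obtain G where G: "mv_holomorphic_on G (bidisc r)" "\<And>t. t \<in> bidisc r \<Longrightarrow> partial_deriv 1 G t = a t"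
    using mv_holomorphic_primitive[OF a] by metis
  have "partial_deriv 1 (\<lambda>t. exp (G t)) t = a t * exp (G t)" if "t \<in> bidisc r" for t
    using partial_deriv_compose[OF G(1) that DERIV_exp, of 1] G(2)[OF that] by (simp add: mult.commute)
  then show ?thesis using G by (intro that[of "\<lambda>t. exp (G t)"] mv_holomorphic_on_exp) auto
qed

text \<open>Variation of constants with a zero-free solution e of the homogeneous equation: u = e G,
  where G is a primitive of g / e. Only primitives occur, so the bidisc is the given one.\<close>

lemma linear_ode:
  assumes a: "mv_holomorphic_on a (bidisc r)" and g: "mv_holomorphic_on g (bidisc r)"
  obtains u where "mv_holomorphic_on u (bidisc r)"
    "\<And>t. t \<in> bidisc r \<Longrightarrow> partial_deriv 1 u t = a t * u t + g t"
proof -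
  obtain e where e: "mv_holomorphic_on e (bidisc r)" "\<And>t. e t \<noteq> 0"
    "\<And>t. t \<in> bidisc r \<Longrightarrow> partial_deriv 1 e t = a t * e t"
    using linear_ode_nonvanishing[OF a] by metis
  obtain G where G: "mv_holomorphic_on G (bidisc r)" "\<And>t. t \<in> bidisc r \<Longrightarrow> partial_deriv 1 G t = g t / e t"
    using mv_holomorphic_primitive[OF mv_holomorphic_on_divide[OF g e(1) e(2)]] by metis
  have "partial_deriv 1 (\<lambda>t. e t * G t) t = a t * (e t * G t) + g t" if "t \<in> bidisc r" for t
    using partial_deriv_mult[OF e(1) G(1) that, of 1] G(2)[OF that] e(2)[of t] e(3)[OF that]
    by (simp add: mult_ac)
  then show ?thesis using G e by (intro that[of "\<lambda>t. e t * G t"] mv_holomorphic_on_mult) auto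
qed

section \<open>Flat rows and the companion form\<close>

text \<open>
  Below, \<open>m\<close> and \<open>b\<close> are the entries of \<open>(A\<^sub>1 - 1) / z\<close> and \<open>A\<^sub>2\<close>. Row vectors \<open>u\<close> with
  \<open>\<partial>\<^sub>1 u = u m\<close> are flat in direction 1; the row \<open>\<eta>\<close> is constant and \<open>\<eta>, \<eta> b(0)\<close> is a frame.
\<close>

context
  fixes r :: real and m b :: "2 \<Rightarrow> 2 \<Rightarrow> complex^2 \<Rightarrow> complex fps"
    and \<eta> :: "2 \<Rightarrow> complex" and \<nu> :: "2 \<Rightarrow> complex^2 \<Rightarrow> complex"
  assumes m: "\<And>j k. formal_on (bidisc r) (m j k)"
    and b: "\<And>j k. formal_on (bidisc r) (b j k)"
    and flat: "\<And>j k t. t \<in> bidisc r \<Longrightarrow>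
       fps_partial 1 (b j k) t - fps_X * fps_partial 2 (m j k) t +
         (\<Sum>l\<in>UNIV. m j l t * b l k t - b j l t * m l k t) = 0"
    and nilpotent: "\<And>j k t. t \<in> bidisc r \<Longrightarrow>
       (\<Sum>l\<in>UNIV. fps_nth (b j l t) 0 * fps_nth (b l k t) 0) = 0"
    and \<nu>: "\<And>k t. \<nu> k t = (\<Sum>j\<in>UNIV. \<eta> j * fps_nth (b j k t) 0)"
    and det: "\<And>t. t \<in> bidisc r \<Longrightarrow> \<eta> 1 * \<nu> 2 t - \<eta> 2 * \<nu> 1 t \<noteq> 0"
begin

lemma frame_hol: "mv_holomorphic_on (\<nu> k) (bidisc r)"
  unfolding \<nu>[abs_def] by (intro mv_holomorphic_intros formal_onD[OF b])

lemma frame_nilpotent: "t \<in> bidisc r \<Longrightarrow> (\<Sum>l\<in>UNIV. \<nu> l t * fps_nth (b l k t) 0) = 0"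
proof -
  assume t: "t \<in> bidisc r"
  have "(\<Sum>l\<in>UNIV. \<nu> l t * fps_nth (b l k t) 0) =
     (\<Sum>j\<in>UNIV. \<eta> j * (\<Sum>l\<in>UNIV. fps_nth (b j l t) 0 * fps_nth (b l k t) 0))"
    by (simp add: \<nu> sum_2 algebra_simps)
  with nilpotent[OF t] show ?thesis by simp
qed

text \<open>Cramer's rule in the frame \<open>\<eta>, \<nu>\<close>; the denominator is the
  determinant assumed to be nonzero.\<close>

lemma frame_decompose:
  assumes g: "\<And>k. mv_holomorphic_on (g k) (bidisc r)"
  obtains x y where "mv_holomorphic_on x (bidisc r)" "mv_holomorphic_on y (bidisc r)"
    "\<And>k t. t \<in> bidisc r \<Longrightarrow> g k t = x t * \<eta> k + y t * \<nu> k t"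
proof
  let ?d = "\<lambda>t. \<eta> 1 * \<nu> 2 t - \<eta> 2 * \<nu> 1 t"
  let ?x = "\<lambda>t. (g 1 t * \<nu> 2 t - g 2 t * \<nu> 1 t) / ?d t" and ?y = "\<lambda>t. (\<eta> 1 * g 2 t - \<eta> 2 * g 1 t) / ?d t"
  show "mv_holomorphic_on ?x (bidisc r)" "mv_holomorphic_on ?y (bidisc r)"
    by (intro mv_holomorphic_intros g frame_hol det; assumption)+
  show "g k t = ?x t * \<eta> k + ?y t * \<nu> k t" if t: "t \<in> bidisc r" for k t
  proof -
    have "?d t * g k t = (g 1 t * \<nu> 2 t - g 2 t * \<nu> 1 t) * \<eta> k + (\<eta> 1 * g 2 t - \<eta> 2 * g 1 t) * \<nu> k t"
      using exhaust_2[of k] by (auto simp: algebra_simps)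
    then have "g k t = ((g 1 t * \<nu> 2 t - g 2 t * \<nu> 1 t) * \<eta> k + (\<eta> 1 * g 2 t - \<eta> 2 * g 1 t) * \<nu> k t) / ?d t"
      using det[OF t] by (metis nonzero_mult_div_cancel_left)
    then show ?thesis by (simp add: add_divide_distrib)
  qed
qed

text \<open>At order 0 flatness reads \<open>\<partial>\<^sub>1 b = b m - m b\<close>. Multiplying
  by the constant row \<eta> gives \<nu> m minus \<eta> m b, and in \<eta> m b the \<nu>-part of
  \<eta> m is killed by nilpotency of b(0), which leaves a \<nu>.\<close>

lemma frame_partial:
  assumes t: "t \<in> bidisc r"
    and a: "\<And>k. (\<Sum>j\<in>UNIV. \<eta> j * fps_nth (m j k t) 0) = a * \<eta> k + c * \<nu> k t"
  shows "partial_deriv 1 (\<nu> k) t = (\<Sum>l\<in>UNIV. \<nu> l t * fps_nth (m l k t) 0) - a * \<nu> k t"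
proof -
  have flat0: "partial_deriv 1 (\<lambda>t. fps_nth (b j k t) 0) t =
     (\<Sum>l\<in>UNIV. fps_nth (b j l t) 0 * fps_nth (m l k t) 0 - fps_nth (m j l t) 0 * fps_nth (b l k t) 0)" for j
    using arg_cong[OF flat[OF t, of j k], of "\<lambda>f. fps_nth f 0"]
    by (simp add: fps_partial_def fps_sum_nth sum_2 algebra_simps)
  have "partial_deriv 1 (\<nu> k) t = (\<Sum>j\<in>UNIV. \<eta> j * partial_deriv 1 (\<lambda>t. fps_nth (b j k t) 0) t)"
    unfolding \<nu>[abs_def]
    by (subst partial_deriv_sum[OF _ t])
       (auto intro!: mv_holomorphic_intros formal_onD[OF b] simp: partial_deriv_mult[OF mv_holomorphic_on_const formal_onD[OF b] t])
  also have "\<dots> = (\<Sum>l\<in>UNIV. \<nu> l t * fps_nth (m l k t) 0)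
      - (\<Sum>l\<in>UNIV. (\<Sum>j\<in>UNIV. \<eta> j * fps_nth (m j l t) 0) * fps_nth (b l k t) 0)"
    unfolding flat0 by (simp add: \<nu> sum_2 algebra_simps)
  also have "(\<Sum>l\<in>UNIV. (\<Sum>j\<in>UNIV. \<eta> j * fps_nth (m j l t) 0) * fps_nth (b l k t) 0) =
      a * (\<Sum>l\<in>UNIV. \<eta> l * fps_nth (b l k t) 0) + c * (\<Sum>l\<in>UNIV. \<nu> l t * fps_nth (b l k t) 0)"
    unfolding a by (simp add: sum_2 algebra_simps)
  also have "\<dots> = a * \<nu> k t" using frame_nilpotent[OF t] by (simp add: \<nu>)
  finally show ?thesis .
qed

text \<open>With \<open>u = \<alpha> \<eta> + \<beta> \<nu>\<close> the two-dimensional system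
  becomes triangular, again because \<nu> b(0) = 0: first
  \<open>\<partial>\<^sub>1 \<alpha> = a \<alpha> + x\<close>, then
  \<open>\<partial>\<^sub>1 \<beta> = a \<beta> + (c \<alpha> + y)\<close>. Here a, c and x, y are
  the frame components of \<eta> m(0) and g. Both are scalar equations. The last conjunct secures a
  cyclic row at order 0.\<close>

lemma flat_row_step:
  assumes g: "\<And>k. mv_holomorphic_on (g k) (bidisc r)"
  shows "\<exists>u. (\<forall>k. mv_holomorphic_on (u k) (bidisc r)) \<and>
    (\<forall>k. \<forall>t\<in>bidisc r. partial_deriv 1 (u k) t = (\<Sum>j\<in>UNIV. u j t * fps_nth (m j k t) 0) + g k t) \<and>
    ((\<forall>k t. g k t = 0) \<longrightarrow> (\<exists>\<alpha> \<beta>. \<forall>t\<in>bidisc r. \<alpha> t \<noteq> 0 \<and> (\<forall>k. u k t = \<alpha> t * \<eta> k + \<beta> t * \<nu> k t)))"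
proof -
  have \<mu>: "mv_holomorphic_on (\<lambda>t. \<Sum>j\<in>UNIV. \<eta> j * fps_nth (m j k t) 0) (bidisc r)" for k
    by (intro mv_holomorphic_intros formal_onD[OF m])
  obtain a c where ac: "mv_holomorphic_on a (bidisc r)" "mv_holomorphic_on c (bidisc r)"
    "\<And>k t. t \<in> bidisc r \<Longrightarrow> (\<Sum>j\<in>UNIV. \<eta> j * fps_nth (m j k t) 0) = a t * \<eta> k + c t * \<nu> k t"
    by (rule frame_decompose[of "\<lambda>k t. \<Sum>j\<in>UNIV. \<eta> j * fps_nth (m j k t) 0", OF \<mu>]) (rule that)
  obtain x y where xy: "mv_holomorphic_on x (bidisc r)" "mv_holomorphic_on y (bidisc r)"
    "\<And>k t. t \<in> bidisc r \<Longrightarrow> g k t = x t * \<eta> k + y t * \<nu> k t"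
    by (rule frame_decompose[of g, OF g]) (rule that)
  \<comment> \<open>If g = 0, then x = 0 and the equation for \<alpha> is homogeneous, so an
    exponential without zeros can be taken; otherwise any solution will do.\<close>
  have "\<exists>\<alpha>. mv_holomorphic_on \<alpha> (bidisc r) \<and> (\<forall>t\<in>bidisc r. partial_deriv 1 \<alpha> t = a t * \<alpha> t + x t) \<and>
     ((\<forall>k t. g k t = 0) \<longrightarrow> (\<forall>t\<in>bidisc r. \<alpha> t \<noteq> 0))"
  proof (cases "\<forall>k t. g k t = 0")
    case True
    have "x t = 0" if t: "t \<in> bidisc r" for t
    proof -
      have "(\<eta> 1 * \<nu> 2 t - \<eta> 2 * \<nu> 1 t) * x t = g 1 t * \<nu> 2 t - g 2 t * \<nu> 1 t"
        by (simp add: xy(3)[OF t] algebra_simps)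
      then show ?thesis using det[OF t] True by simp
    qed
    moreover obtain \<alpha> where "mv_holomorphic_on \<alpha> (bidisc r)" "\<And>t. \<alpha> t \<noteq> 0"
      "\<And>t. t \<in> bidisc r \<Longrightarrow> partial_deriv 1 \<alpha> t = a t * \<alpha> t"
      using linear_ode_nonvanishing[OF ac(1)] by metis
    ultimately show ?thesis by (intro exI[of _ \<alpha>]) auto
  next
    case False
    obtain \<alpha> where \<alpha>: "mv_holomorphic_on \<alpha> (bidisc r)"
      "\<And>t. t \<in> bidisc r \<Longrightarrow> partial_deriv 1 \<alpha> t = a t * \<alpha> t + x t"
      by (rule linear_ode[OF ac(1) xy(1)]) (rule that)
    have "(\<forall>k t. g k t = 0) \<longrightarrow> (\<forall>t\<in>bidisc r. \<alpha> t \<noteq> 0)" using False by blast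
    with \<alpha> show ?thesis by (intro exI[of _ \<alpha>] conjI ballI)
  qed
  then obtain \<alpha> where \<alpha>: "mv_holomorphic_on \<alpha> (bidisc r)"
    "\<And>t. t \<in> bidisc r \<Longrightarrow> partial_deriv 1 \<alpha> t = a t * \<alpha> t + x t"
    "(\<forall>k t. g k t = 0) \<longrightarrow> (\<forall>t\<in>bidisc r. \<alpha> t \<noteq> 0)" by (elim exE conjE) simp
  have h: "mv_holomorphic_on (\<lambda>t. c t * \<alpha> t + y t) (bidisc r)"
    by (intro mv_holomorphic_intros ac \<alpha> xy)
  obtain \<beta> where \<beta>: "mv_holomorphic_on \<beta> (bidisc r)"
    "\<And>t. t \<in> bidisc r \<Longrightarrow> partial_deriv 1 \<beta> t = a t * \<beta> t + (c t * \<alpha> t + y t)"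
    by (rule linear_ode[OF ac(1) h]) (rule that)
  show ?thesis
  proof (rule exI[of _ "\<lambda>k t. \<alpha> t * \<eta> k + \<beta> t * \<nu> k t"], intro conjI allI ballI impI)
    show "mv_holomorphic_on (\<lambda>t. \<alpha> t * \<eta> k + \<beta> t * \<nu> k t) (bidisc r)" for k
      by (intro mv_holomorphic_intros \<alpha> \<beta> frame_hol)
    show "partial_deriv 1 (\<lambda>t. \<alpha> t * \<eta> k + \<beta> t * \<nu> k t) t =
        (\<Sum>j\<in>UNIV. (\<alpha> t * \<eta> j + \<beta> t * \<nu> j t) * fps_nth (m j k t) 0) + g k t" if t: "t \<in> bidisc r" for k t
    proof -
      have "partial_deriv 1 (\<lambda>t. \<alpha> t * \<eta> k + \<beta> t * \<nu> k t) t =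
          partial_deriv 1 \<alpha> t * \<eta> k + (partial_deriv 1 \<beta> t * \<nu> k t + \<beta> t * partial_deriv 1 (\<nu> k) t)"
        by (simp add: partial_deriv_add[OF mv_holomorphic_on_mult[OF \<alpha>(1) mv_holomorphic_on_const] mv_holomorphic_on_mult[OF \<beta>(1) frame_hol] t]
            partial_deriv_mult[OF \<alpha>(1) mv_holomorphic_on_const t] partial_deriv_mult[OF \<beta>(1) frame_hol t])
      also have "\<dots> = \<alpha> t * (a t * \<eta> k + c t * \<nu> k t) + \<beta> t * (\<Sum>j\<in>UNIV. \<nu> j t * fps_nth (m j k t) 0)
          + (x t * \<eta> k + y t * \<nu> k t)"
        by (simp add: frame_partial[OF t ac(3)[OF t]] \<alpha>(2)[OF t] \<beta>(2)[OF t] algebra_simps)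
      also have "\<dots> = (\<Sum>j\<in>UNIV. (\<alpha> t * \<eta> j + \<beta> t * \<nu> j t) * fps_nth (m j k t) 0) + g k t"
        unfolding ac(3)[OF t, symmetric] xy(3)[OF t, symmetric] by (simp add: sum_2 algebra_simps)
      finally show ?thesis .
    qed
    show "\<exists>\<alpha>' \<beta>'. \<forall>t\<in>bidisc r. \<alpha>' t \<noteq> 0 \<and> (\<forall>k. \<alpha> t * \<eta> k + \<beta> t * \<nu> k t = \<alpha>' t * \<eta> k + \<beta>' t * \<nu> k t)"
      if "\<forall>k t. g k t = 0"
      using \<alpha>(3) that by (intro exI[of _ \<alpha>] exI[of _ \<beta>]) simp
  qed
qed

text \<open>At order n the equation for the row is the one of \<open>flat_row_step\<close>, with g
  built from the lower orders. At order 0 this g is an empty sum, so the zero-free choice of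
  \<alpha> is available exactly there.\<close>

lemma flat_row_exists:
  obtains \<sigma> where "\<And>k. formal_on (bidisc r) (\<sigma> k)"
    "\<And>k t. t \<in> bidisc r \<Longrightarrow> fps_partial 1 (\<sigma> k) t = (\<Sum>j\<in>UNIV. \<sigma> j t * m j k t)"
    "\<exists>\<alpha> \<beta>. \<forall>t\<in>bidisc r. \<alpha> t \<noteq> 0 \<and> (\<forall>k. fps_nth (\<sigma> k t) 0 = \<alpha> t * \<eta> k + \<beta> t * \<nu> k t)"
proof -
  let ?g = "\<lambda>s n k t. \<Sum>j\<in>UNIV. \<Sum>i<n. s i j t * fps_nth (m j k t) (n - i)"
  define P where "P s n u \<longleftrightarrow> (\<forall>k. mv_holomorphic_on (u k) (bidisc r)) \<and>
     (\<forall>k. \<forall>t\<in>bidisc r. partial_deriv 1 (u k) t = (\<Sum>j\<in>UNIV. u j t * fps_nth (m j k t) 0) + ?g s n k t) \<and>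
     (n = 0 \<longrightarrow> (\<exists>\<alpha> \<beta>. \<forall>t\<in>bidisc r. \<alpha> t \<noteq> 0 \<and> (\<forall>k. u k t = \<alpha> t * \<eta> k + \<beta> t * \<nu> k t)))"
    for s :: "nat \<Rightarrow> 2 \<Rightarrow> complex^2 \<Rightarrow> complex" and n :: nat and u
  have "\<exists>s. \<forall>n. P s n (s n)"
  proof (rule recursive_choice)
    show "P s n u = P s' n u" if "\<And>k. k < n \<Longrightarrow> s k = s' k" for s s' n u
      using that by (simp add: P_def)
    show "\<exists>u. P s n u" if "\<And>k. k < n \<Longrightarrow> P s k (s k)" for s n
    proof -
      have "mv_holomorphic_on (?g s n k) (bidisc r)" for k
        by (intro mv_holomorphic_intros formal_onD[OF m]) (use that in \<open>auto simp: P_def\<close>)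
      from flat_row_step[of "?g s n", OF this] show ?thesis
        unfolding P_def by (rule ex_forward) (intro conjI impI; simp)
    qed
  qed
  then obtain s where s: "\<And>n. P s n (s n)" by blast
  show ?thesis
  proof (rule that[of "\<lambda>k t. Abs_fps (\<lambda>n. s n k t)"])
    show "formal_on (bidisc r) (\<lambda>t. Abs_fps (\<lambda>n. s n k t))" for k
      using s by (auto simp: formal_on_def P_def)
    show "fps_partial 1 (\<lambda>t. Abs_fps (\<lambda>n. s n k t)) t = (\<Sum>j\<in>UNIV. Abs_fps (\<lambda>n. s n j t) * m j k t)"
      if t: "t \<in> bidisc r" for k t
    proof (rule fps_ext)
      fix n
      have "fps_nth (fps_partial 1 (\<lambda>t. Abs_fps (\<lambda>n. s n k t)) t) n = partial_deriv 1 (s n k) t"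
        by (simp add: fps_partial_def)
      also have "\<dots> = (\<Sum>j\<in>UNIV. s n j t * fps_nth (m j k t) 0) + ?g s n k t"
        using s[of n] t by (auto simp: P_def)
      also have "\<dots> = fps_nth (\<Sum>j\<in>UNIV. Abs_fps (\<lambda>n. s n j t) * m j k t) n"
        by (simp add: fps_sum_nth fps_mult_nth_last sum.distrib)
      finally show "fps_nth (fps_partial 1 (\<lambda>t. Abs_fps (\<lambda>n. s n k t)) t) n =
         fps_nth (\<Sum>j\<in>UNIV. Abs_fps (\<lambda>n. s n j t) * m j k t) n" .
    qed
    show "\<exists>\<alpha> \<beta>. \<forall>t\<in>bidisc r. \<alpha> t \<noteq> 0 \<and> (\<forall>k. fps_nth (Abs_fps (\<lambda>n. s n k t)) 0 = \<alpha> t * \<eta> k + \<beta> t * \<nu> k t)"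
      using s[of 0] by (auto simp: P_def)
  qed
qed

definition flat_row :: "(2 \<Rightarrow> complex^2 \<Rightarrow> complex fps) \<Rightarrow> bool" where
  "flat_row u \<longleftrightarrow> (\<forall>k. formal_on (bidisc r) (u k)) \<and>
     (\<forall>k. \<forall>t\<in>bidisc r. fps_partial 1 (u k) t = (\<Sum>j\<in>UNIV. u j t * m j k t))"

text \<open>If T is a gauge transformation from \<open>A\<^sub>2\<close> to \<open>B\<close>, then
  \<open>T A\<^sub>2 - z \<partial>\<^sub>2 T = B T\<close>. Thus \<open>row_deriv\<close> sends a
  row of T to the corresponding row of B T, and iterating it on a cyclic row produces a companion
  matrix B.\<close>

definition row_deriv :: "(2 \<Rightarrow> complex^2 \<Rightarrow> complex fps) \<Rightarrow> 2 \<Rightarrow> complex^2 \<Rightarrow> complex fps" where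
  "row_deriv u k t = (\<Sum>j\<in>UNIV. u j t * b j k t) - fps_X * fps_partial 2 (u k) t"

text \<open>Flatness means that the operator \<open>\<partial>\<^sub>1 u - u m\<close> on rows
  commutes with \<open>row_deriv\<close>; hence the latter preserves the kernel of the
  former.\<close>

lemma flat_row_deriv:
  assumes u: "flat_row u"
  shows "flat_row (row_deriv u)"
  unfolding flat_row_def
proof (intro conjI allI ballI)
  have uf: "formal_on (bidisc r) (u k)" for k using u by (simp add: flat_row_def)
  have ud: "fps_partial 1 (u k) t = (\<Sum>j\<in>UNIV. u j t * m j k t)" if "t \<in> bidisc r" for k t
    using u that by (simp add: flat_row_def)
  fix k
  show "formal_on (bidisc r) (row_deriv u k)"
    unfolding row_deriv_def[abs_def] by (intro formal_intros uf b)
  fix t assume t: "t \<in> bidisc r"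
  have "fps_partial 1 (row_deriv u k) t = fps_partial 1 (\<lambda>t. u 1 t * b 1 k t + u 2 t * b 2 k t) t
     - fps_X * fps_partial 1 (fps_partial 2 (u k)) t"
    unfolding row_deriv_def[abs_def] sum_2
    by (subst fps_partial_diff[OF _ _ t]; (subst fps_partial_cmult[OF _ t])?) (intro formal_intros uf b refl)+
  also have "fps_partial 1 (\<lambda>t. u 1 t * b 1 k t + u 2 t * b 2 k t) t =
      (\<Sum>j\<in>UNIV. fps_partial 1 (u j) t * b j k t + u j t * fps_partial 1 (b j k) t)"
    by (simp add: fps_partial_add[OF formal_on_mult[OF uf b] formal_on_mult[OF uf b] t] fps_partial_mult[OF uf b t] sum_2)
  also have "fps_partial 1 (fps_partial 2 (u k)) t = fps_partial 2 (fps_partial 1 (u k)) t"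
    by (rule fps_partial_commute[OF uf t, symmetric])
  also have "fps_partial 2 (fps_partial 1 (u k)) t = fps_partial 2 (\<lambda>t. u 1 t * m 1 k t + u 2 t * m 2 k t) t"
    by (rule fps_partial_cong[OF open_bidisc t]) (simp add: ud sum_2)
  also have "\<dots> = (\<Sum>j\<in>UNIV. fps_partial 2 (u j) t * m j k t + u j t * fps_partial 2 (m j k) t)"
    by (simp add: fps_partial_add[OF formal_on_mult[OF uf m] formal_on_mult[OF uf m] t] fps_partial_mult[OF uf m t] sum_2)
  finally have D: "fps_partial 1 (row_deriv u k) t =
      (\<Sum>j\<in>UNIV. fps_partial 1 (u j) t * b j k t + u j t * fps_partial 1 (b j k) t) -
      fps_X * (\<Sum>j\<in>UNIV. fps_partial 2 (u j) t * m j k t + u j t * fps_partial 2 (m j k) t)" .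
  \<comment> \<open>After inserting the equation for u, all that is left is u times the flatness
    expression.\<close>
  have "fps_partial 1 (row_deriv u k) t - (\<Sum>j\<in>UNIV. row_deriv u j t * m j k t) =
     (\<Sum>j\<in>UNIV. u j t * (fps_partial 1 (b j k) t - fps_X * fps_partial 2 (m j k) t +
         (\<Sum>l\<in>UNIV. m j l t * b l k t - b j l t * m l k t)))"
    unfolding D unfolding row_deriv_def ud[OF t] by (simp add: sum_2 algebra_simps)
  then show "fps_partial 1 (row_deriv u k) t = (\<Sum>j\<in>UNIV. row_deriv u j t * m j k t)"
    by (simp add: flat[OF t])
qed

definition row_det :: "(2 \<Rightarrow> complex^2 \<Rightarrow> complex fps) \<Rightarrow> (2 \<Rightarrow> complex^2 \<Rightarrow> complex fps) \<Rightarrow> complex^2 \<Rightarrow> complex fps" where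
  "row_det u v t = u 1 t * v 2 t - u 2 t * v 1 t"

lemma row_det_formal: "flat_row u \<Longrightarrow> flat_row v \<Longrightarrow> formal_on (bidisc r) (row_det u v)"
  unfolding row_det_def[abs_def] flat_row_def by (intro formal_intros) auto

text \<open>Liouville's formula for two solutions of the linear system
  \<open>\<partial>\<^sub>1 u = u m\<close>.\<close>

lemma row_det_partial:
  assumes "flat_row u" "flat_row v" and t: "t \<in> bidisc r"
  shows "fps_partial 1 (row_det u v) t = (m 1 1 t + m 2 2 t) * row_det u v t"
proof -
  have uv: "formal_on (bidisc r) (u k)" "formal_on (bidisc r) (v k)" for k
    using assms by (auto simp: flat_row_def)
  have d: "fps_partial 1 (u k) t = u 1 t * m 1 k t + u 2 t * m 2 k t"
     "fps_partial 1 (v k) t = v 1 t * m 1 k t + v 2 t * m 2 k t" for k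
    using assms by (auto simp: flat_row_def sum_2)
  have "fps_partial 1 (row_det u v) t =
      (fps_partial 1 (u 1) t * v 2 t + u 1 t * fps_partial 1 (v 2) t) -
      (fps_partial 1 (u 2) t * v 1 t + u 2 t * fps_partial 1 (v 1) t)"
    unfolding row_det_def[abs_def]
    by (simp add: fps_partial_diff[OF formal_on_mult[OF uv] formal_on_mult[OF uv] t]
        fps_partial_mult[OF uv t])
  then show ?thesis unfolding d row_det_def by (simp add: algebra_simps)
qed

text \<open>Wronskians of flat rows all satisfy \<open>\<partial>\<^sub>1 w = tr(m) w\<close>, so their quotients depend on \<open>t\<^sub>2\<close> only.\<close>

lemma row_det_quotient:
  assumes "flat_row u" "flat_row v" "flat_row w" "flat_row y" and t: "t \<in> bidisc r"
    and nz: "\<And>t. t \<in> bidisc r \<Longrightarrow> fps_nth (row_det w y t) 0 \<noteq> 0"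
  shows "formal_on (bidisc r) (\<lambda>t. row_det u v t * inverse (row_det w y t))" (is "formal_on _ ?q")
    and "fps_partial 1 (\<lambda>t. row_det u v t * inverse (row_det w y t)) t = 0"
proof -
  have f: "formal_on (bidisc r) (row_det u v)" "formal_on (bidisc r) (row_det w y)"
    using assms row_det_formal by auto
  show q: "formal_on (bidisc r) ?q" by (intro formal_intros f nz)
  have "row_det w y t * ?q t = row_det u v t" if "t \<in> bidisc r" for t
    using inverse_mult_eq_1[OF nz[OF that]] by (simp add: mult_ac)
  then have "fps_partial 1 (row_det u v) t = fps_partial 1 (\<lambda>t. row_det w y t * ?q t) t"
    and e: "row_det w y t * ?q t = row_det u v t"
    using t by (auto intro!: fps_partial_cong[OF open_bidisc t])
  then have "(m 1 1 t + m 2 2 t) * row_det u v t =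
      (m 1 1 t + m 2 2 t) * row_det w y t * ?q t + row_det w y t * fps_partial 1 ?q t"
    by (simp add: fps_partial_mult[OF f(2) q t] row_det_partial assms)
  then have "row_det w y t * fps_partial 1 ?q t = 0"
    by (simp add: mult.assoc e)
  then show "fps_partial 1 ?q t = 0" using nz[OF t] by auto
qed

text \<open>Take \<sigma> flat with leading part \<alpha> \<eta> + \<beta> \<nu>, then \<rho> and
  \<tau> by applying \<open>row_deriv\<close> once and twice. Since \<nu> b(0) = 0, their leading
  parts are \<alpha> \<nu> and 0. So \<sigma>, \<rho> form a frame, and \<tau> is a combination of
  them whose coefficients vanish at z = 0.\<close>

lemma cyclic_row_exists:
  obtains \<sigma> \<rho> x y where
    "\<And>k. formal_on (bidisc r) (\<sigma> k)" "\<And>k. formal_on (bidisc r) (\<rho> k)"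
    "formal_on (bidisc r) x" "formal_on (bidisc r) y"
    "\<And>t. t \<in> bidisc r \<Longrightarrow> fps_nth (\<rho> 1 t * \<sigma> 2 t - \<rho> 2 t * \<sigma> 1 t) 0 \<noteq> 0"
    "\<And>k t. t \<in> bidisc r \<Longrightarrow> fps_partial 1 (\<sigma> k) t = (\<Sum>j\<in>UNIV. \<sigma> j t * m j k t)"
    "\<And>k t. t \<in> bidisc r \<Longrightarrow> fps_partial 1 (\<rho> k) t = (\<Sum>j\<in>UNIV. \<rho> j t * m j k t)"
    "\<And>k t. t \<in> bidisc r \<Longrightarrow> fps_X * fps_partial 2 (\<sigma> k) t = (\<Sum>j\<in>UNIV. \<sigma> j t * b j k t) - \<rho> k t"
    "\<And>k t. t \<in> bidisc r \<Longrightarrow> fps_X * fps_partial 2 (\<rho> k) t =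
        (\<Sum>j\<in>UNIV. \<rho> j t * b j k t) - x t * \<sigma> k t - y t * \<rho> k t"
    "\<And>t. t \<in> bidisc r \<Longrightarrow> fps_partial 1 x t = 0" "\<And>t. t \<in> bidisc r \<Longrightarrow> fps_partial 1 y t = 0"
    "\<And>t. t \<in> bidisc r \<Longrightarrow> fps_nth (x t) 0 = 0" "\<And>t. t \<in> bidisc r \<Longrightarrow> fps_nth (y t) 0 = 0"
proof -
  obtain \<sigma> where s: "\<And>k. formal_on (bidisc r) (\<sigma> k)"
    "\<And>k t. t \<in> bidisc r \<Longrightarrow> fps_partial 1 (\<sigma> k) t = (\<Sum>j\<in>UNIV. \<sigma> j t * m j k t)"
    and "\<exists>\<alpha> \<beta>. \<forall>t\<in>bidisc r. \<alpha> t \<noteq> 0 \<and> (\<forall>k. fps_nth (\<sigma> k t) 0 = \<alpha> t * \<eta> k + \<beta> t * \<nu> k t)"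
    by (rule flat_row_exists) (rule that)
  then obtain \<alpha> \<beta> where nz: "\<And>t. t \<in> bidisc r \<Longrightarrow> \<alpha> t \<noteq> 0"
    and s0: "\<And>k t. t \<in> bidisc r \<Longrightarrow> fps_nth (\<sigma> k t) 0 = \<alpha> t * \<eta> k + \<beta> t * \<nu> k t" by metis
  define \<rho> \<tau> where "\<rho> = row_deriv \<sigma>" and "\<tau> = row_deriv \<rho>"
  have fs: "flat_row \<sigma>" using s by (simp add: flat_row_def)
  have fr: "flat_row \<rho>" unfolding \<rho>_def by (rule flat_row_deriv[OF fs])
  have ft: "flat_row \<tau>" unfolding \<tau>_def by (rule flat_row_deriv[OF fr])
  have r0: "fps_nth (\<rho> k t) 0 = \<alpha> t * \<nu> k t" if t: "t \<in> bidisc r" for k t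
  proof -
    have "fps_nth (\<rho> k t) 0 = (\<Sum>j\<in>UNIV. (\<alpha> t * \<eta> j + \<beta> t * \<nu> j t) * fps_nth (b j k t) 0)"
      by (simp add: \<rho>_def row_deriv_def fps_sum_nth s0[OF t])
    also have "\<dots> = \<alpha> t * \<nu> k t + \<beta> t * (\<Sum>j\<in>UNIV. \<nu> j t * fps_nth (b j k t) 0)"
      by (simp add: \<nu> sum_2 algebra_simps)
    finally show ?thesis by (simp add: frame_nilpotent[OF t])
  qed
  have t0: "fps_nth (\<tau> k t) 0 = 0" if t: "t \<in> bidisc r" for k t
  proof -
    have "fps_nth (\<tau> k t) 0 = \<alpha> t * (\<Sum>j\<in>UNIV. \<nu> j t * fps_nth (b j k t) 0)"
      by (simp add: \<tau>_def row_deriv_def fps_sum_nth r0[OF t] sum_distrib_left mult_ac)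
    then show ?thesis by (simp add: frame_nilpotent[OF t])
  qed
  have nzd: "fps_nth (row_det \<sigma> \<rho> t) 0 \<noteq> 0" if t: "t \<in> bidisc r" for t
  proof -
    have "fps_nth (row_det \<sigma> \<rho> t) 0 = \<alpha> t ^ 2 * (\<eta> 1 * \<nu> 2 t - \<eta> 2 * \<nu> 1 t)"
      by (simp add: row_det_def r0[OF t] s0[OF t] algebra_simps power2_eq_square)
    then show ?thesis using nz[OF t] det[OF t] by simp
  qed
  \<comment> \<open>Cramer's coefficients in \<open>\<tau> = x \<sigma> + y \<rho>\<close>. Being
    quotients of determinants of flat rows, they do not depend on \<open>t\<^sub>1\<close>.\<close>
  define x y where "x t = row_det \<tau> \<rho> t * inverse (row_det \<sigma> \<rho> t)"
    and "y t = row_det \<sigma> \<tau> t * inverse (row_det \<sigma> \<rho> t)" for t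
  show ?thesis
  proof (rule that[of \<sigma> \<rho> x y])
    show "\<And>k. formal_on (bidisc r) (\<sigma> k)" "\<And>k. formal_on (bidisc r) (\<rho> k)"
      "\<And>k t. t \<in> bidisc r \<Longrightarrow> fps_partial 1 (\<sigma> k) t = (\<Sum>j\<in>UNIV. \<sigma> j t * m j k t)"
      "\<And>k t. t \<in> bidisc r \<Longrightarrow> fps_partial 1 (\<rho> k) t = (\<Sum>j\<in>UNIV. \<rho> j t * m j k t)"
      using fs fr by (auto simp: flat_row_def)
    show "formal_on (bidisc r) x" "formal_on (bidisc r) y"
      unfolding x_def[abs_def] y_def[abs_def]
      by (intro formal_on_mult formal_on_inverse row_det_formal fs fr ft nzd; assumption)+
    show "fps_partial 1 x t = 0" "fps_partial 1 y t = 0" if "t \<in> bidisc r" for t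
      unfolding x_def[abs_def] y_def[abs_def]
      by (rule row_det_quotient(2); use fs fr ft nzd that in blast)+
    show "fps_nth (x t) 0 = 0" "fps_nth (y t) 0 = 0" if "t \<in> bidisc r" for t
      by (simp_all add: x_def y_def row_det_def t0[OF that])
    show "fps_nth (\<rho> 1 t * \<sigma> 2 t - \<rho> 2 t * \<sigma> 1 t) 0 \<noteq> 0" if "t \<in> bidisc r" for t
      using nzd[OF that] by (auto simp: row_det_def algebra_simps)
    show "fps_X * fps_partial 2 (\<sigma> k) t = (\<Sum>j\<in>UNIV. \<sigma> j t * b j k t) - \<rho> k t" for k t
      by (simp add: \<rho>_def row_deriv_def)
    show "fps_X * fps_partial 2 (\<rho> k) t = (\<Sum>j\<in>UNIV. \<rho> j t * b j k t) - x t * \<sigma> k t - y t * \<rho> k t"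
      if t: "t \<in> bidisc r" for k t
    proof -
      have "x t * \<sigma> k t + y t * \<rho> k t = (row_det \<tau> \<rho> t * \<sigma> k t + row_det \<sigma> \<tau> t * \<rho> k t) * inverse (row_det \<sigma> \<rho> t)"
        by (simp add: x_def y_def algebra_simps)
      also have "row_det \<tau> \<rho> t * \<sigma> k t + row_det \<sigma> \<tau> t * \<rho> k t = \<tau> k t * row_det \<sigma> \<rho> t"
        using exhaust_2[of k] by (auto simp: row_det_def algebra_simps)
      also have "\<tau> k t * row_det \<sigma> \<rho> t * inverse (row_det \<sigma> \<rho> t) = \<tau> k t"
        using inverse_mult_eq_1[OF nzd[OF t]] by (simp add: mult_ac)
      finally show ?thesis by (simp add: \<tau>_def row_deriv_def algebra_simps)
    qed
  qed
qed

end

section \<open>Isomorphisms on a fixed bidisc, their composition, and reduction to companion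
  form\<close>

definition mat2 :: "'a \<Rightarrow> 'a \<Rightarrow> 'a \<Rightarrow> 'a \<Rightarrow> 'a ^ 2 ^ 2" where
  "mat2 a b c d = (\<chi> i j. if i = 1 then (if j = 1 then a else b) else (if j = 1 then c else d))"

lemma mat2_nth [simp]:
  "mat2 a b c d $ 1 $ 1 = a" "mat2 a b c d $ 1 $ 2 = b" "mat2 a b c d $ 2 $ 1 = c" "mat2 a b c d $ 2 $ 2 = d"
  by (auto simp: mat2_def)

lemma smat_nth [simp]: "smat c M $ i $ j = c * M $ i $ j"
  by (simp add: smat_def map_matrix_def)

lemma coeff_mat_nth [simp]: "coeff_mat M n $ i $ j = fps_nth (M $ i $ j) n"
  by (simp add: coeff_mat_def map_matrix_def)

lemma matrix_mult_nth: "((A :: 'a::semiring_1 ^ 2 ^ 2) ** B) $ i $ j = (\<Sum>l\<in>UNIV. A $ i $ l * B $ l $ j)"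
  by (simp add: matrix_matrix_mult_def)

lemma invertible_2_iff:
  "invertible (M :: complex ^ 2 ^ 2) \<longleftrightarrow> M $ 1 $ 1 * M $ 2 $ 2 - M $ 1 $ 2 * M $ 2 $ 1 \<noteq> 0"
  by (simp add: invertible_det_nz det_2)

lemma eventually_all_iff:
  "(\<forall>\<^sub>F x in F. \<forall>y::'b::finite. P x y) \<longleftrightarrow> (\<forall>y. \<forall>\<^sub>F x in F. P x y)"
  by (auto intro: eventually_all_finite elim: eventually_mono)

text \<open>\<open>formal_iso_over\<close> on one explicit bidisc: the equation is written
  entrywise, and invertibility of the leading matrix as a nonzero determinant, so that identities
  can be checked by ring arithmetic.\<close>

definition iso_on :: "real \<Rightarrow> (complex^2 \<Rightarrow> complex^2) \<Rightarrow> (complex^2 \<Rightarrow> fmat) \<Rightarrow> tpair \<Rightarrow> tpair \<Rightarrow> bool" where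
  "iso_on r h T A' A \<longleftrightarrow>
     (\<forall>a b. formal_on (bidisc r) (\<lambda>t. T t $ a $ b)) \<and>
     (\<forall>t\<in>bidisc r. fps_nth (T t $ 1 $ 1 * T t $ 2 $ 2 - T t $ 1 $ 2 * T t $ 2 $ 1) 0 \<noteq> 0) \<and>
     (\<forall>i. \<forall>t\<in>bidisc r. \<forall>a b. fps_X * fps_partial i (\<lambda>t. T t $ a $ b) t +
        (\<Sum>j\<in>UNIV. \<Sum>l\<in>UNIV. fps_const (partial_deriv i (\<lambda>s. h s $ j) t) * A j (h t) $ a $ l * T t $ l $ b) -
        (\<Sum>l\<in>UNIV. T t $ a $ l * A' i t $ l $ b) = 0)"

lemma formal_iso_over_iff:
  "formal_iso_over h T A' A \<longleftrightarrow> (\<forall>\<^sub>F r in at_right 0. iso_on r h T A' A)"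
proof -
  have eq: "(smat fps_X (partial_mat i T t)
          + (\<Sum>j\<in>UNIV. smat (fps_const (partial_deriv i (\<lambda>s. h s $ j) t)) (A j (h t)) ** T t)
          - T t ** A' i t = 0) \<longleftrightarrow> (\<forall>a b. fps_X * fps_partial i (\<lambda>t. T t $ a $ b) t +
        (\<Sum>j\<in>UNIV. \<Sum>l\<in>UNIV. fps_const (partial_deriv i (\<lambda>s. h s $ j) t) * A j (h t) $ a $ l * T t $ l $ b) -
        (\<Sum>l\<in>UNIV. T t $ a $ l * A' i t $ l $ b) = 0)" for i t
    by (simp add: vec_eq_iff[where 'b = 2] vec_eq_iff[where 'b = 2 and 'a = "complex fps"]
         partial_mat_nth matrix_mult_nth sum_2)
  show ?thesis
    unfolding formal_iso_over_def iso_on_def eq eventually_nhds_bidisc formal_series_iff invertible_2_iff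
    by (simp add: eventually_conj_iff eventually_all_iff)
qed

lemma iso_onI:
  assumes "\<And>a b. formal_on (bidisc r) (\<lambda>t. T t $ a $ b)"
    and "\<And>t. t \<in> bidisc r \<Longrightarrow> fps_nth (T t $ 1 $ 1 * T t $ 2 $ 2 - T t $ 1 $ 2 * T t $ 2 $ 1) 0 \<noteq> 0"
    and "\<And>i t a b. t \<in> bidisc r \<Longrightarrow> fps_X * fps_partial i (\<lambda>t. T t $ a $ b) t +
        (\<Sum>j\<in>UNIV. \<Sum>l\<in>UNIV. fps_const (partial_deriv i (\<lambda>s. h s $ j) t) * A j (h t) $ a $ l * T t $ l $ b) -
        (\<Sum>l\<in>UNIV. T t $ a $ l * A' i t $ l $ b) = 0"
  shows "iso_on r h T A' A"
  using assms by (simp add: iso_on_def)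

lemma eventually_at_right_0_obtain:
  assumes "\<forall>\<^sub>F r in at_right (0::real). P r"
  obtains r where "r > 0" "P r"
  using eventually_happens[OF eventually_conj[OF eventually_at_right_less assms]] by auto

lemma iso_on_imp_formal_iso_over:
  assumes "iso_on r h T A' A" "r > 0"
  shows "formal_iso_over h T A' A"
  unfolding formal_iso_over_iff
proof (rule eventually_at_rightI[OF _ assms(2)])
  fix s assume "s \<in> {0<..<r}"
  then have "bidisc s \<subseteq> bidisc r" by (intro bidisc_mono) auto
  moreover have "formal_on (bidisc s) (\<lambda>t. T t $ a $ b)" for a b
    by (rule formal_on_subset[of "bidisc r"]) (use assms(1) \<open>bidisc s \<subseteq> bidisc r\<close> in \<open>auto simp: iso_on_def\<close>)
  ultimately show "iso_on s h T A' A"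
    using assms(1) unfolding iso_on_def by blast
qed

lemma fps_partial_chain:
  fixes h :: "complex^2 \<Rightarrow> complex^2"
  assumes h: "\<And>j. mv_holomorphic_on (\<lambda>t. h t $ j) U" and a: "formal_on V a" and t: "t \<in> U" "h t \<in> V"
  shows "fps_partial i (\<lambda>t. a (h t)) t =
     (\<Sum>j\<in>UNIV. fps_const (partial_deriv i (\<lambda>t. h t $ j) t) * fps_partial j a (h t))"
  unfolding fps_partial_def fps_eq_iff
  by (simp add: partial_deriv_chain[OF h formal_onD[OF a] t] sum_2)

lemma formal_on_compose_map:
  fixes h :: "complex^2 \<Rightarrow> complex^2"
  assumes "\<And>j. mv_holomorphic_on (\<lambda>t. h t $ j) U" "formal_on V a" "h ` U \<subseteq> V"
  shows "formal_on U (\<lambda>t. a (h t))"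
  using assms mv_holomorphic_on_compose_map unfolding formal_on_def by blast

text \<open>The regularity of h under which formal isomorphisms can be composed; that h is
  biholomorphic is tracked separately, since all but one of the maps composed below are the
  identity.\<close>

definition hol_map :: "(complex^2 \<Rightarrow> complex^2) \<Rightarrow> bool" where
  "hol_map h \<longleftrightarrow> h 0 = 0 \<and> (\<forall>j. \<forall>\<^sub>F r in at_right 0. mv_holomorphic_on (\<lambda>t. h t $ j) (bidisc r))"

lemma hol_map_id: "hol_map (\<lambda>t. t)"
  by (simp add: hol_map_def mv_holomorphic_on_nth)

lemma hol_map_into_bidisc:
  assumes "hol_map h" "s > 0"
  shows "\<forall>\<^sub>F t in nhds 0. h t \<in> bidisc s"
proof -
  have "\<forall>\<^sub>F t in nhds 0. norm (h t $ j) < s" for j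
  proof -
    have "\<forall>\<^sub>F r in at_right 0. mv_holomorphic_on (\<lambda>t. h t $ j) (bidisc r)"
      using assms by (simp add: hol_map_def)
    then obtain r where r: "r > 0" "mv_holomorphic_on (\<lambda>t. h t $ j) (bidisc r)"
      by (rule eventually_at_right_0_obtain)
    have "open ((\<lambda>t. h t $ j) -` ball 0 s \<inter> bidisc r)"
      using continuous_on_open_vimage[OF open_bidisc, THEN iffD1, OF mv_holomorphic_on_imp_continuous_on[OF r(2)]]
      by simp
    then show ?thesis using assms r zero_in_bidisc[OF r(1)] unfolding eventually_nhds
      by (intro exI[of _ "(\<lambda>t. h t $ j) -` ball 0 s \<inter> bidisc r"]) (auto simp: hol_map_def)
  qed
  from this[of 1] this[of 2] show ?thesis
    by eventually_elim (auto simp: bidisc_def)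
qed

text \<open>The product rule splits the derivative of the product of matrices. The equation for T2,
  pulled back along h1 by the chain rule, and the equation for T1 contribute the B-terms with
  opposite signs, so they cancel.\<close>

lemma formal_iso_over_compose:
  assumes 1: "formal_iso_over h1 T1 A B" and 2: "formal_iso_over h2 T2 B C"
    and h1: "hol_map h1" and h2: "hol_map h2"
  shows "formal_iso_over (\<lambda>t. h2 (h1 t)) (\<lambda>t. T2 (h1 t) ** T1 t) A C"
proof -
  have "\<forall>\<^sub>F s in at_right 0. iso_on s h2 T2 B C \<and> (\<forall>j. mv_holomorphic_on (\<lambda>t. h2 t $ j) (bidisc s))"
    using 2 h2 by (simp add: formal_iso_over_iff hol_map_def eventually_conj_iff eventually_all_iff)
  then obtain s where s: "s > 0"
    and s': "iso_on s h2 T2 B C \<and> (\<forall>j. mv_holomorphic_on (\<lambda>t. h2 t $ j) (bidisc s))"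
    by (rule eventually_at_right_0_obtain)
  note s = s conjunct1[OF s'] conjunct2[OF s', rule_format]
  have "\<forall>\<^sub>F r in at_right 0. iso_on r h1 T1 A B \<and> (\<forall>j. mv_holomorphic_on (\<lambda>t. h1 t $ j) (bidisc r)) \<and>
      (\<forall>t\<in>bidisc r. h1 t \<in> bidisc s)"
    using 1 h1 hol_map_into_bidisc[OF h1 s(1)]
    by (simp add: formal_iso_over_iff hol_map_def eventually_conj_iff eventually_all_iff eventually_nhds_bidisc)
  then obtain r where r: "r > 0"
    and r': "iso_on r h1 T1 A B \<and> (\<forall>j. mv_holomorphic_on (\<lambda>t. h1 t $ j) (bidisc r)) \<and>
      (\<forall>t\<in>bidisc r. h1 t \<in> bidisc s)"
    by (rule eventually_at_right_0_obtain)
  note r = r conjunct1[OF r'] r'[THEN conjunct2, THEN conjunct1, rule_format]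
    r'[THEN conjunct2, THEN conjunct2, rule_format]
  have T1: "formal_on (bidisc r) (\<lambda>t. T1 t $ a $ b)" for a b using r(2) by (simp add: iso_on_def)
  have T2: "formal_on (bidisc s) (\<lambda>t. T2 t $ a $ b)" for a b using s(2) by (simp add: iso_on_def)
  have S: "formal_on (bidisc r) (\<lambda>t. T2 (h1 t) $ a $ b)" for a b
    by (rule formal_on_compose_map[OF r(3) T2]) (use r(4) in auto)
  show ?thesis
  proof (rule iso_on_imp_formal_iso_over[OF _ r(1)], rule iso_onI)
    show "formal_on (bidisc r) (\<lambda>t. (T2 (h1 t) ** T1 t) $ a $ b)" for a b
      unfolding matrix_mult_nth by (intro formal_intros S T1)
    fix t assume t: "t \<in> bidisc r"
    note ht = r(4)[OF t]
    let ?S = "T2 (h1 t)" and ?T = "T1 t"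
    have "(?S ** ?T) $ 1 $ 1 * (?S ** ?T) $ 2 $ 2 - (?S ** ?T) $ 1 $ 2 * (?S ** ?T) $ 2 $ 1 =
      (?S $ 1 $ 1 * ?S $ 2 $ 2 - ?S $ 1 $ 2 * ?S $ 2 $ 1) * (?T $ 1 $ 1 * ?T $ 2 $ 2 - ?T $ 1 $ 2 * ?T $ 2 $ 1)"
      by (simp add: matrix_mult_nth sum_2 algebra_simps)
    moreover have "fps_nth (?S $ 1 $ 1 * ?S $ 2 $ 2 - ?S $ 1 $ 2 * ?S $ 2 $ 1) 0 \<noteq> 0"
      "fps_nth (?T $ 1 $ 1 * ?T $ 2 $ 2 - ?T $ 1 $ 2 * ?T $ 2 $ 1) 0 \<noteq> 0"
      using r(2) s(2) t ht unfolding iso_on_def by blast+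
    ultimately show "fps_nth ((?S ** ?T) $ 1 $ 1 * (?S ** ?T) $ 2 $ 2 - (?S ** ?T) $ 1 $ 2 * (?S ** ?T) $ 2 $ 1) 0 \<noteq> 0"
      by (simp only: fps_mult_nth_0 mult_eq_0_iff not_False_eq_True de_Morgan_disj simp_thms)
    fix i a b
    let ?p = "\<lambda>j. fps_const (partial_deriv i (\<lambda>s. h1 s $ j) t)"
    let ?q = "\<lambda>j k. fps_const (partial_deriv j (\<lambda>s. h2 s $ k) (h1 t))"
    have pq: "fps_const (partial_deriv i (\<lambda>s. h2 (h1 s) $ k) t) = (\<Sum>j\<in>UNIV. ?p j * ?q j k)" for k
      by (simp add: partial_deriv_chain[OF r(3) s(3) t ht] sum_2)
    have Z1: "fps_X * fps_partial i (\<lambda>t. T1 t $ l $ b) t = (\<Sum>m\<in>UNIV. ?T $ l $ m * A i t $ m $ b) -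
        (\<Sum>j\<in>UNIV. \<Sum>m\<in>UNIV. ?p j * B j (h1 t) $ l $ m * ?T $ m $ b)" for l
      using r(2) t unfolding iso_on_def by (simp add: algebra_simps)
    have Z2: "fps_X * fps_partial j (\<lambda>t. T2 t $ a $ l) (h1 t) = (\<Sum>m\<in>UNIV. ?S $ a $ m * B j (h1 t) $ m $ l) -
        (\<Sum>k\<in>UNIV. \<Sum>m\<in>UNIV. ?q j k * C k (h2 (h1 t)) $ a $ m * ?S $ m $ l)" for j l
      using s(2) ht unfolding iso_on_def by (simp add: algebra_simps)
    have "fps_partial i (\<lambda>t. (T2 (h1 t) ** T1 t) $ a $ b) t =
       (\<Sum>l\<in>UNIV. fps_partial i (\<lambda>t. T2 (h1 t) $ a $ l) t * ?T $ l $ b + ?S $ a $ l * fps_partial i (\<lambda>t. T1 t $ l $ b) t)"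
      unfolding matrix_mult_nth sum_2
      by (simp only: fps_partial_add[OF formal_on_mult[OF S T1] formal_on_mult[OF S T1] t] fps_partial_mult[OF S T1 t])
    \<comment> \<open>Both derivatives are grouped with their factor z, so that the two isomorphism
      equations can be inserted as rewrite rules.\<close>
    then have Z: "fps_X * fps_partial i (\<lambda>t. (T2 (h1 t) ** T1 t) $ a $ b) t =
       (\<Sum>l\<in>UNIV. (\<Sum>j\<in>UNIV. ?p j * (fps_X * fps_partial j (\<lambda>t. T2 t $ a $ l) (h1 t))) * ?T $ l $ b
          + ?S $ a $ l * (fps_X * fps_partial i (\<lambda>t. T1 t $ l $ b) t))"
      unfolding fps_partial_chain[OF r(3) T2 t ht] by (simp add: sum_2 algebra_simps)
    then show "fps_X * fps_partial i (\<lambda>t. (T2 (h1 t) ** T1 t) $ a $ b) t +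
        (\<Sum>j\<in>UNIV. \<Sum>l\<in>UNIV. fps_const (partial_deriv i (\<lambda>s. h2 (h1 s) $ j) t) * C j (h2 (h1 t)) $ a $ l * (?S ** ?T) $ l $ b) -
        (\<Sum>l\<in>UNIV. (?S ** ?T) $ a $ l * A i t $ l $ b) = 0"
      unfolding Z unfolding Z1 Z2 pq unfolding matrix_mult_nth sum_2 by (simp add: algebra_simps del: fps_const_mult fps_const_add)
  qed
qed

text \<open>By surjectivity every vector has the form S Y v. Multiplicativity with the unit
  \<partial>1 then makes P the identity on all vectors, and multiplicativity with \<partial>2 gives
  N N v = 0. Injectivity excludes N = 0.\<close>

lemma over_N2_pointwise:
  fixes P N :: "complex ^ 2 ^ 2" and v :: "complex ^ 2"
  defines "S \<equiv> \<lambda>X. (smat (X $ 1) P + smat (X $ 2) N)"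
  assumes bij: "bij (\<lambda>X. S X *v v)"
    and mult: "\<And>X Y. S (N2_mult X Y) *v v = S X *v (S Y *v v)"
    and unit: "S N2_unit *v v = v"
  shows "P = mat 1" "\<And>j k. (\<Sum>l\<in>UNIV. N $ j $ l * N $ l $ k) = 0" "\<exists>j k. N $ j $ k \<noteq> 0"
proof -
  have S: "S X *v w = X $ 1 *s (P *v w) + X $ 2 *s (N *v w)" for X w
    by (auto simp: S_def vec_eq_iff matrix_vector_mult_def sum_2 algebra_simps)
  have surj: "\<exists>Y. w = S Y *v v" for w using surjD[OF bij_is_surj[OF bij], of w] by simp
  have Pv: "P *v w = w" for w
  proof -
    obtain Y where Y: "w = S Y *v v" using surj by blast
    have "N2_mult (axis 1 1) Y = Y" by (auto simp: N2_mult_def vec_eq_iff forall_2 axis_def)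
    with mult[of "axis 1 1" Y] have "S (axis 1 1) *v w = w" by (simp add: Y)
    then show ?thesis by (simp add: S axis_def)
  qed
  have Pw: "(\<Sum>l\<in>UNIV. P $ j $ l * axis k 1 $ l) = axis k 1 $ j" for j k :: 2
    using Pv[of "axis k 1"] by (simp add: vec_eq_iff matrix_vector_mult_def)
  show "P = mat 1"
    using Pw[of 1 1] Pw[of 1 2] Pw[of 2 1] Pw[of 2 2]
    by (simp add: sum_2 axis_def vec_eq_iff forall_2 mat_def)
  have NNv: "N *v (N *v v) = 0"
  proof -
    have "N2_mult (axis 2 1) (axis 2 1) = 0" by (auto simp: N2_mult_def vec_eq_iff forall_2 axis_def)
    with mult[of "axis 2 1" "axis 2 1"] show ?thesis by (simp add: S axis_def)
  qed
  \<comment> \<open>As P is the identity, w is a combination of v and N v, and N N kills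
    both.\<close>
  have NN: "N *v (N *v w) = 0" for w
  proof -
    obtain Y where Y: "w = S Y *v v" using surj by blast
    show ?thesis unfolding Y S Pv
      by (simp add: matrix_vector_right_distrib vector_scalar_commute NNv)
  qed
  show "(\<Sum>l\<in>UNIV. N $ j $ l * N $ l $ k) = 0" for j k
    using arg_cong[OF NN[of "axis k 1"], of "\<lambda>w. w $ j"] exhaust_2[of k]
    by (auto simp: matrix_vector_mult_def sum_2 axis_def)
  show "\<exists>j k. N $ j $ k \<noteq> 0"
  proof (rule ccontr)
    assume "\<not> ?thesis"
    then have "N *v w = 0" for w by (simp add: matrix_vector_mult_def vec_eq_iff)
    then have "S (axis 2 1) *v v = S 0 *v v" by (simp add: S axis_def)
    then have "axis 2 1 = (0 :: complex ^ 2)" using injD[OF bij_is_inj[OF bij], of "axis 2 1" 0] by simp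
    from arg_cong[OF this, of "\<lambda>w. w $ 2"] show False by (simp add: axis_def)
  qed
qed

text \<open>A 2 by 2 matrix of square zero without off-diagonal entries has vanishing diagonal too.
  So a nonzero one has an off-diagonal entry, and the unit row through that entry is cyclic.\<close>

lemma nilpotent_cyclic_row:
  fixes N :: "complex ^ 2 ^ 2"
  assumes "\<And>j k. (\<Sum>l\<in>UNIV. N $ j $ l * N $ l $ k) = 0" "\<exists>j k. N $ j $ k \<noteq> 0"
  obtains \<eta> :: "2 \<Rightarrow> complex"
    where "\<eta> 1 * (\<Sum>j\<in>UNIV. \<eta> j * N $ j $ 2) - \<eta> 2 * (\<Sum>j\<in>UNIV. \<eta> j * N $ j $ 1) \<noteq> 0"
proof (cases "N $ 1 $ 2 \<noteq> 0 \<or> N $ 2 $ 1 \<noteq> 0")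
  case True
  then show ?thesis
    using that[of "\<lambda>i. if i = 1 then 1 else 0"] that[of "\<lambda>i. if i = 1 then 0 else 1"] by (auto simp: sum_2)
next
  case False
  with assms(1)[of 1 1] assms(1)[of 2 2] have "N $ j $ k = 0" for j k
    using exhaust_2[of j] exhaust_2[of k] by (auto simp: sum_2)
  with assms(2) show ?thesis by blast
qed

lemma fps_eq_const_plus_shift: "(f :: complex fps) = fps_const (fps_nth f 0) + fps_X * fps_shift 1 f"
proof (rule fps_ext)
  fix n show "fps_nth f n = fps_nth (fps_const (fps_nth f 0) + fps_X * fps_shift 1 f) n"
    by (cases n) auto
qed

text \<open>Companion matrix of the relation \<open>\<tau> = x \<sigma> + y \<rho>\<close> for the
  rows ordered as \<rho>, \<sigma>. When x and y vanish at z = 0, its leading part is the matrix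
  \<open>C2\<close>.\<close>

definition companion :: "(complex \<Rightarrow> complex fps) \<Rightarrow> (complex \<Rightarrow> complex fps) \<Rightarrow> tpair" where
  "companion y x i t = (if i = 1 then C1 else mat2 (y (t $ 2)) (x (t $ 2)) 1 0)"

lemma eventually_mv_nonzero:
  assumes f: "mv_holomorphic_on f (bidisc r)" and r: "r > 0" and "f 0 \<noteq> 0"
  shows "\<forall>\<^sub>F t in nhds 0. f t \<noteq> 0"
proof -
  have "open (f -` (- {0}) \<inter> bidisc r)"
    using continuous_on_open_vimage[OF open_bidisc, THEN iffD1, OF mv_holomorphic_on_imp_continuous_on[OF f]]
    by blast
  then show ?thesis using assms(3) zero_in_bidisc[OF r] unfolding eventually_nhds
    by (intro exI[of _ "f -` (- {0}) \<inter> bidisc r"]) auto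
qed

lemma over_N2_leading:
  assumes "over_N2 A"
  shows "\<forall>\<^sub>F t in nhds 0. coeff_mat (A 1 t) 0 = mat 1 \<and>
    (\<forall>j k. (\<Sum>l\<in>UNIV. coeff_mat (A 2 t) 0 $ j $ l * coeff_mat (A 2 t) 0 $ l $ k) = 0) \<and>
    (\<exists>j k. coeff_mat (A 2 t) 0 $ j $ k \<noteq> 0)"
proof -
  obtain \<zeta> where "\<forall>\<^sub>F t in nhds 0. bij (\<lambda>X. higgs A t X *v \<zeta> t) \<and>
        (\<forall>X Y. higgs A t (N2_mult X Y) *v \<zeta> t = higgs A t X *v (higgs A t Y *v \<zeta> t)) \<and>
        higgs A t N2_unit *v \<zeta> t = \<zeta> t"
    using assms unfolding over_N2_def by (elim exE conjE) (rule that)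
  then show ?thesis
  proof eventually_elim
    case (elim t)
    then have "bij (\<lambda>X. higgs A t X *v \<zeta> t)"
      "\<And>X Y. higgs A t (N2_mult X Y) *v \<zeta> t = higgs A t X *v (higgs A t Y *v \<zeta> t)"
      "higgs A t N2_unit *v \<zeta> t = \<zeta> t" by blast+
    from over_N2_pointwise[OF this[unfolded higgs_def sum_2]] show ?case by blast
  qed
qed

text \<open>The cyclic row and its derivative, stacked as a matrix, are the gauge transformation.
  What has to be supplied is the input of the cyclic row construction:
  \<open>A\<^sub>1 = 1 + z m\<close>, a nilpotent leading part of \<open>A\<^sub>2\<close>, and a
  row \<eta> that is cyclic for it.\<close>

lemma gauge_to_companion:
  assumes A: "formal_T_structure A" and N2: "over_N2 A"
  obtains R x y T where "R > 0" "hol_fps (ball 0 R) x" "hol_fps (ball 0 R) y"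
    "\<And>s. s \<in> ball 0 R \<Longrightarrow> fps_nth (x s) 0 = 0" "\<And>s. s \<in> ball 0 R \<Longrightarrow> fps_nth (y s) 0 = 0"
    "formal_iso_over (\<lambda>t. t) T A (companion y x)"
proof -
  define m where "m j k t = fps_shift 1 (A 1 t $ j $ k)" for j k t
  define b where "b j k t = A 2 t $ j $ k" for j k t
  have formal: "\<forall>i a b. \<forall>\<^sub>F r in at_right 0. formal_on (bidisc r) (\<lambda>t. A i t $ a $ b)"
    using A by (simp add: formal_T_structure_def formal_series_iff)
  have lead: "\<forall>\<^sub>F t in nhds 0. (\<forall>j k. fps_nth (A 1 t $ j $ k) 0 = (if j = k then 1 else 0)) \<and>
    (\<forall>j k. (\<Sum>l\<in>UNIV. fps_nth (b j l t) 0 * fps_nth (b l k t) 0) = 0)"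
    using over_N2_leading[OF N2]
    by eventually_elim (simp add: b_def vec_eq_iff mat_def)
  \<comment> \<open>Chosen at t = 0 and kept constant; the determinant stays nonzero on a
    neighbourhood by continuity.\<close>
  obtain \<eta> where \<eta>: "\<eta> 1 * (\<Sum>j\<in>UNIV. \<eta> j * fps_nth (b j 2 0) 0) - \<eta> 2 * (\<Sum>j\<in>UNIV. \<eta> j * fps_nth (b j 1 0) 0) \<noteq> 0"
    using nilpotent_cyclic_row[of "coeff_mat (A 2 0) 0"] eventually_nhds_x_imp_x[OF over_N2_leading[OF N2]]
    by (auto simp: b_def)
  define \<nu> where "\<nu> k t = (\<Sum>j\<in>UNIV. \<eta> j * fps_nth (b j k t) 0)" for k t
  have "\<forall>\<^sub>F r in at_right 0. \<forall>j k. formal_on (bidisc r) (b j k)"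
    using formal unfolding b_def[abs_def] eventually_all_iff by blast
  then obtain r0 where r0: "r0 > 0" and "\<forall>j k. formal_on (bidisc r0) (b j k)"
    by (rule eventually_at_right_0_obtain)
  then have "mv_holomorphic_on (\<lambda>t. \<eta> 1 * \<nu> 2 t - \<eta> 2 * \<nu> 1 t) (bidisc r0)"
    unfolding \<nu>_def by (intro mv_holomorphic_intros formal_onD) auto
  from eventually_mv_nonzero[OF this r0] \<eta>
  have det: "\<forall>\<^sub>F t in nhds 0. \<eta> 1 * \<nu> 2 t - \<eta> 2 * \<nu> 1 t \<noteq> 0"
    by (simp add: \<nu>_def)
  have "\<forall>\<^sub>F t in nhds 0. \<forall>j k. fps_X * fps_partial 1 (b j k) t - fps_X * fps_partial 2 (\<lambda>t. A 1 t $ j $ k) t +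
      (\<Sum>l\<in>UNIV. A 1 t $ j $ l * b l k t - b j l t * A 1 t $ l $ k) = 0"
    using A unfolding formal_T_structure_def flat_def
  proof (elim conjE)
    assume "\<forall>\<^sub>F t in nhds 0.
       smat fps_X (partial_mat 1 (A 2) t) - smat fps_X (partial_mat 2 (A 1) t) + (A 1 t ** A 2 t - A 2 t ** A 1 t) = 0"
    then show ?thesis
    proof eventually_elim
      case (elim t)
      show ?case
      proof (intro allI)
        fix j k
        show "fps_X * fps_partial 1 (b j k) t - fps_X * fps_partial 2 (\<lambda>t. A 1 t $ j $ k) t +
          (\<Sum>l\<in>UNIV. A 1 t $ j $ l * b l k t - b j l t * A 1 t $ l $ k) = 0"
          using arg_cong[OF elim, of "\<lambda>M. M $ j $ k"]
          by (simp add: partial_mat_nth matrix_mult_nth b_def[abs_def] sum_2 algebra_simps)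
      qed
    qed
  qed
  with formal lead det have "\<forall>\<^sub>F r in at_right 0. (\<forall>i a b. formal_on (bidisc r) (\<lambda>t. A i t $ a $ b)) \<and>
    ((\<forall>t\<in>bidisc r. (\<forall>j k. fps_nth (A 1 t $ j $ k) 0 = (if j = k then 1 else 0)) \<and>
      (\<forall>j k. (\<Sum>l\<in>UNIV. fps_nth (b j l t) 0 * fps_nth (b l k t) 0) = 0)) \<and>
    ((\<forall>t\<in>bidisc r. \<eta> 1 * \<nu> 2 t - \<eta> 2 * \<nu> 1 t \<noteq> 0) \<and>
    (\<forall>t\<in>bidisc r. \<forall>j k. fps_X * fps_partial 1 (b j k) t - fps_X * fps_partial 2 (\<lambda>t. A 1 t $ j $ k) t +
      (\<Sum>l\<in>UNIV. A 1 t $ j $ l * b l k t - b j l t * A 1 t $ l $ k) = 0)))"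
    unfolding eventually_nhds_bidisc by (intro eventually_conj) (simp_all add: eventually_all_iff)
  then obtain r where r: "r > 0" and r': "(\<forall>i a b. formal_on (bidisc r) (\<lambda>t. A i t $ a $ b)) \<and>
    ((\<forall>t\<in>bidisc r. (\<forall>j k. fps_nth (A 1 t $ j $ k) 0 = (if j = k then 1 else 0)) \<and>
      (\<forall>j k. (\<Sum>l\<in>UNIV. fps_nth (b j l t) 0 * fps_nth (b l k t) 0) = 0)) \<and>
    ((\<forall>t\<in>bidisc r. \<eta> 1 * \<nu> 2 t - \<eta> 2 * \<nu> 1 t \<noteq> 0) \<and>
    (\<forall>t\<in>bidisc r. \<forall>j k. fps_X * fps_partial 1 (b j k) t - fps_X * fps_partial 2 (\<lambda>t. A 1 t $ j $ k) t +
      (\<Sum>l\<in>UNIV. A 1 t $ j $ l * b l k t - b j l t * A 1 t $ l $ k) = 0)))"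
    by (rule eventually_at_right_0_obtain)
  have fA: "formal_on (bidisc r) (\<lambda>t. A i t $ a $ b)" for i a b using r' by blast
  have fm: "formal_on (bidisc r) (m j k)" for j k unfolding m_def[abs_def] by (intro formal_intros fA)
  have fb: "formal_on (bidisc r) (b j k)" for j k unfolding b_def[abs_def] by (rule fA)
  have A1: "A 1 t $ j $ k = (if j = k then 1 else 0) + fps_X * m j k t" if "t \<in> bidisc r" for j k t
  proof -
    have n0: "fps_nth (A 1 t $ j $ k) 0 = (if j = k then 1 else 0)" using r' that by blast
    have "A 1 t $ j $ k = fps_const (if j = k then 1 else 0) + fps_X * m j k t"
      unfolding m_def n0[symmetric] by (rule fps_eq_const_plus_shift)
    also have "fps_const (if j = k then 1 else 0 :: complex) = (if j = k then 1 else 0)" by simp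
    finally show ?thesis .
  qed
  \<comment> \<open>The identity part of \<open>A\<^sub>1\<close> drops out of the commutator and of
    the derivative, so every term of the flatness equation carries a factor z, which is
    cancelled.\<close>
  have flat: "fps_partial 1 (b j k) t - fps_X * fps_partial 2 (m j k) t +
         (\<Sum>l\<in>UNIV. m j l t * b l k t - b j l t * m l k t) = 0" if t: "t \<in> bidisc r" for j k t
  proof -
    have "fps_partial 2 (\<lambda>t. A 1 t $ j $ k) t = fps_partial 2 (\<lambda>t. (if j = k then 1 else 0) + fps_X * m j k t) t"
      by (rule fps_partial_cong[OF open_bidisc t A1])
    also have "\<dots> = fps_X * fps_partial 2 (m j k) t"
      by (simp add: fps_partial_add[OF formal_on_const formal_on_mult[OF formal_on_const fm] t] fps_partial_cmult[OF fm t])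
    finally have d: "fps_partial 2 (\<lambda>t. A 1 t $ j $ k) t = fps_X * fps_partial 2 (m j k) t" .
    have "fps_X * fps_partial 1 (b j k) t - fps_X * fps_partial 2 (\<lambda>t. A 1 t $ j $ k) t +
      (\<Sum>l\<in>UNIV. A 1 t $ j $ l * b l k t - b j l t * A 1 t $ l $ k) = 0" using r' t by blast
    then have "fps_X * (fps_partial 1 (b j k) t - fps_X * fps_partial 2 (m j k) t +
         (\<Sum>l\<in>UNIV. m j l t * b l k t - b j l t * m l k t)) = 0"
      unfolding d A1[OF t] using exhaust_2[of j] exhaust_2[of k] by (auto simp: sum_2 algebra_simps)
    then show ?thesis by simp
  qed
  have nil: "\<And>j k t. t \<in> bidisc r \<Longrightarrow> (\<Sum>l\<in>UNIV. fps_nth (b j l t) 0 * fps_nth (b l k t) 0) = 0"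
    and det: "\<And>t. t \<in> bidisc r \<Longrightarrow> \<eta> 1 * \<nu> 2 t - \<eta> 2 * \<nu> 1 t \<noteq> 0" using r' by blast+
  show ?thesis
  proof (rule cyclic_row_exists[OF fm fb flat nil \<nu>_def det])
    fix \<sigma> \<rho> x y
    assume c:
      "\<And>k. formal_on (bidisc r) (\<sigma> k)" "\<And>k. formal_on (bidisc r) (\<rho> k)"
      "formal_on (bidisc r) x" "formal_on (bidisc r) y"
      "\<And>t. t \<in> bidisc r \<Longrightarrow> fps_nth (\<rho> 1 t * \<sigma> 2 t - \<rho> 2 t * \<sigma> 1 t) 0 \<noteq> 0"
      "\<And>k t. t \<in> bidisc r \<Longrightarrow> fps_partial 1 (\<sigma> k) t = (\<Sum>j\<in>UNIV. \<sigma> j t * m j k t)"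
      "\<And>k t. t \<in> bidisc r \<Longrightarrow> fps_partial 1 (\<rho> k) t = (\<Sum>j\<in>UNIV. \<rho> j t * m j k t)"
      "\<And>k t. t \<in> bidisc r \<Longrightarrow> fps_X * fps_partial 2 (\<sigma> k) t = (\<Sum>j\<in>UNIV. \<sigma> j t * b j k t) - \<rho> k t"
      "\<And>k t. t \<in> bidisc r \<Longrightarrow> fps_X * fps_partial 2 (\<rho> k) t =
          (\<Sum>j\<in>UNIV. \<rho> j t * b j k t) - x t * \<sigma> k t - y t * \<rho> k t"
      "\<And>t. t \<in> bidisc r \<Longrightarrow> fps_partial 1 x t = 0" "\<And>t. t \<in> bidisc r \<Longrightarrow> fps_partial 1 y t = 0"
      "\<And>t. t \<in> bidisc r \<Longrightarrow> fps_nth (x t) 0 = 0" "\<And>t. t \<in> bidisc r \<Longrightarrow> fps_nth (y t) 0 = 0"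
    define T :: "complex^2 \<Rightarrow> fmat" where "T t = (\<chi> i k. if i = 1 then \<rho> k t else \<sigma> k t)" for t
    have T: "T t $ 1 $ k = \<rho> k t" "T t $ 2 $ k = \<sigma> k t" for t k by (auto simp: T_def)
    \<comment> \<open>Independence of \<open>t\<^sub>1\<close> turns x and y into series in the
      single variable \<open>t\<^sub>2\<close>, as \<open>companion\<close> demands.\<close>
    have restrict: "x t = x (pt 0 (t $ 2))" "y t = y (pt 0 (t $ 2))" if "t \<in> bidisc r" for t
      using formal_on_independent[OF c(3,10) that] formal_on_independent[OF c(4,11) that] by auto
    show thesis
    proof (rule that[of r "\<lambda>s. x (pt 0 s)" "\<lambda>s. y (pt 0 s)" T])
      show "hol_fps (ball 0 r) (\<lambda>s. x (pt 0 s))" "hol_fps (ball 0 r) (\<lambda>s. y (pt 0 s))"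
        by (rule formal_on_restrict[OF c(3) r] formal_on_restrict[OF c(4) r])+
      show "fps_nth (x (pt 0 s)) 0 = 0" "fps_nth (y (pt 0 s)) 0 = 0" if "s \<in> ball 0 r" for s
        using c(12,13)[of "pt 0 s"] that r by (auto simp: bidisc_def)
      have "iso_on r (\<lambda>t. t) T A (companion (\<lambda>s. y (pt 0 s)) (\<lambda>s. x (pt 0 s)))"
      proof (rule iso_onI)
        show "formal_on (bidisc r) (\<lambda>t. T t $ a $ b)" for a b
          using exhaust_2[of a] c(1,2) by (auto simp: T)
        fix t assume t: "t \<in> bidisc r"
        show "fps_nth (T t $ 1 $ 1 * T t $ 2 $ 2 - T t $ 1 $ 2 * T t $ 2 $ 1) 0 \<noteq> 0"
          using c(5)[OF t] by (simp add: T)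
        fix i a k
        have d: "fps_X * fps_partial 1 (\<lambda>t. T t $ a $ k) t = fps_X * (\<Sum>j\<in>UNIV. T t $ a $ j * m j k t)"
          using exhaust_2[of a] by (auto simp: T c(6,7)[OF t])
        show "fps_X * fps_partial i (\<lambda>t. T t $ a $ k) t +
          (\<Sum>j\<in>UNIV. \<Sum>l\<in>UNIV. fps_const (partial_deriv i (\<lambda>s. s $ j) t) *
              companion (\<lambda>s. y (pt 0 s)) (\<lambda>s. x (pt 0 s)) j t $ a $ l * T t $ l $ k) -
          (\<Sum>l\<in>UNIV. T t $ a $ l * A i t $ l $ k) = 0"
        proof (cases "i = 1")
          case True
          show ?thesis unfolding True d A1[OF t] using exhaust_2[of k] exhaust_2[of a]
            by (auto simp: sum_2 partial_deriv_nth companion_def C1_def mat_def algebra_simps)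
        next
          case False
          then have i: "i = 2" using exhaust_2[of i] by auto
          have b: "A 2 t $ l $ k = b l k t" for l k by (simp add: b_def)
          show ?thesis unfolding i b using exhaust_2[of a]
            by (auto simp: sum_2 T partial_deriv_nth companion_def c(8,9)[OF t] restrict[OF t, symmetric] algebra_simps)
        qed
      qed
      then show "formal_iso_over (\<lambda>t. t) T A (companion (\<lambda>s. y (pt 0 s)) (\<lambda>s. x (pt 0 s)))"
        using r by (rule iso_on_imp_formal_iso_over)
    qed fact
  qed
qed

section \<open>Isomorphisms of normal forms\<close>

lemma hol_primitive:
  assumes "f holomorphic_on ball 0 R"
  obtains g where "g holomorphic_on ball 0 R" "\<And>x. x \<in> ball 0 R \<Longrightarrow> (g has_field_derivative f x) (at x)" "g 0 = 0"
proof -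
  obtain g where g: "\<And>x. x \<in> ball 0 R \<Longrightarrow> (g has_field_derivative f x) (at x within ball 0 R)"
    using holomorphic_convex_primitive'[OF convex_ball open_ball assms] by blast
  have g': "((\<lambda>x. g x - g 0) has_field_derivative f x) (at x)" if "x \<in> ball 0 R" for x
    using g[OF that] that by (auto intro!: derivative_eq_intros simp: at_within_open[of x "ball 0 R"])
  show ?thesis
    by (rule that[OF holomorphic_onI_DERIV[OF g'] g']) auto
qed

lemma linear_ode1_nonvanishing:
  assumes "a holomorphic_on ball 0 R"
  obtains u where "u holomorphic_on ball 0 R" "\<And>x. u x \<noteq> 0" "\<And>x. x \<in> ball 0 R \<Longrightarrow> deriv u x = a x * u x"
proof -
  obtain g where g: "g holomorphic_on ball 0 R" "\<And>x. x \<in> ball 0 R \<Longrightarrow> (g has_field_derivative a x) (at x)"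
    by (rule hol_primitive[OF assms]) (rule that)
  have "deriv (\<lambda>x. exp (g x)) x = a x * exp (g x)" if "x \<in> ball 0 R" for x
    by (intro DERIV_imp_deriv) (auto intro!: derivative_eq_intros g(2)[OF that])
  then show ?thesis using g(1) by (intro that[of "\<lambda>x. exp (g x)"]) (auto intro: holomorphic_intros)
qed

lemma linear_ode1:
  assumes "a holomorphic_on ball 0 R" "g holomorphic_on ball 0 R"
  obtains u where "u holomorphic_on ball 0 R" "\<And>x. x \<in> ball 0 R \<Longrightarrow> deriv u x = a x * u x + g x"
proof -
  obtain e where e: "e holomorphic_on ball 0 R" "\<And>x. e x \<noteq> 0" "\<And>x. x \<in> ball 0 R \<Longrightarrow> deriv e x = a x * e x"
    by (rule linear_ode1_nonvanishing[OF assms(1)]) (rule that)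
  have "(\<lambda>x. g x / e x) holomorphic_on ball 0 R" by (intro holomorphic_intros assms e)
  then obtain G where G: "G holomorphic_on ball 0 R" "\<And>x. x \<in> ball 0 R \<Longrightarrow> (G has_field_derivative g x / e x) (at x)"
    by (rule hol_primitive) (rule that)
  have "deriv (\<lambda>x. e x * G x) x = a x * (e x * G x) + g x" if x: "x \<in> ball 0 R" for x
  proof -
    have "(e has_field_derivative deriv e x) (at x)" using e(1) x by (intro holomorphic_derivI) auto
    from DERIV_mult'[OF this G(2)[OF x]] show ?thesis
      using e by (intro DERIV_imp_deriv) (simp add: e(3)[OF x] mult_ac add.commute)
  qed
  then show ?thesis using e G by (intro that[of "\<lambda>x. e x * G x"] holomorphic_intros) auto
qed

text \<open>Order by order in z: homogeneous at order 0, where an exponential keeps u invertible as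
  a series, and inhomogeneous with known right-hand side afterwards.\<close>

lemma linear_ode_fps:
  assumes a: "hol_fps (ball 0 R) a"
  obtains u where "hol_fps (ball 0 R) u" "\<And>x. x \<in> ball 0 R \<Longrightarrow> fps_nth (u x) 0 \<noteq> 0"
    "\<And>x. x \<in> ball 0 R \<Longrightarrow> fps_d u x = a x * u x"
proof -
  let ?g = "\<lambda>s n x. \<Sum>i<n. s i x * fps_nth (a x) (n - i)"
  define P where "P s n u \<longleftrightarrow> u holomorphic_on ball 0 R \<and>
     (\<forall>x\<in>ball 0 R. deriv u x = fps_nth (a x) 0 * u x + ?g s n x) \<and> (n = 0 \<longrightarrow> (\<forall>x\<in>ball 0 R. u x \<noteq> 0))"
    for s :: "nat \<Rightarrow> complex \<Rightarrow> complex" and n :: nat and u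
  have "\<exists>s. \<forall>n. P s n (s n)"
  proof (rule recursive_choice)
    show "P s n u = P s' n u" if "\<And>k. k < n \<Longrightarrow> s k = s' k" for s s' n u
      using that by (simp add: P_def)
    show "\<exists>u. P s n u" if IH: "\<And>k. k < n \<Longrightarrow> P s k (s k)" for s n
    proof (cases "n = 0")
      case True
      obtain u where "u holomorphic_on ball 0 R" "\<And>x. u x \<noteq> 0" "\<And>x. x \<in> ball 0 R \<Longrightarrow> deriv u x = fps_nth (a x) 0 * u x"
        by (rule linear_ode1_nonvanishing[OF hol_fpsD[OF a, of 0]]) (rule that)
      then show ?thesis using True unfolding P_def by (intro exI[of _ u]) simp
    next
      case False
      have "?g s n holomorphic_on ball 0 R"
        by (intro holomorphic_intros hol_fpsD[OF a]) (use IH in \<open>auto simp: P_def\<close>)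
      then obtain u where "u holomorphic_on ball 0 R"
        "\<And>x. x \<in> ball 0 R \<Longrightarrow> deriv u x = fps_nth (a x) 0 * u x + ?g s n x"
        by (rule linear_ode1[OF hol_fpsD[OF a, of 0]]) (rule that)
      then show ?thesis using False unfolding P_def by (intro exI[of _ u]) simp
    qed
  qed
  then obtain s where s: "\<And>n. P s n (s n)" by blast
  show ?thesis
  proof (rule that[of "\<lambda>x. Abs_fps (\<lambda>n. s n x)"])
    show "hol_fps (ball 0 R) (\<lambda>x. Abs_fps (\<lambda>n. s n x))"
      using s by (auto simp: hol_fps_def P_def)
    show "fps_nth (Abs_fps (\<lambda>n. s n x)) 0 \<noteq> 0" if "x \<in> ball 0 R" for x
      using s[of 0] that by (auto simp: P_def)
    show "fps_d (\<lambda>x. Abs_fps (\<lambda>n. s n x)) x = a x * Abs_fps (\<lambda>n. s n x)" if x: "x \<in> ball 0 R" for x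
    proof (rule fps_ext)
      fix n
      have "fps_nth (Abs_fps (\<lambda>n. s n x) * a x) n = s n x * fps_nth (a x) 0 + ?g s n x"
        by (simp add: fps_mult_nth_last)
      moreover have "deriv (s n) x = fps_nth (a x) 0 * s n x + ?g s n x"
        using s[of n] x by (auto simp: P_def)
      ultimately show "fps_nth (fps_d (\<lambda>x. Abs_fps (\<lambda>n. s n x)) x) n = fps_nth (a x * Abs_fps (\<lambda>n. s n x)) n"
        by (simp add: mult.commute)
    qed
  qed
qed

section \<open>Isomorphisms covering a change of the second coordinate\<close>

lemma normal_form_eq: "normal_form \<phi> i t = (if i = 1 then C1 else mat2 0 (fps_X * \<phi> (t $ 2)) 1 0)"
  by (simp add: normal_form_def C2_def E_def vec_eq_iff forall_2)

lemma partial_deriv_snd_map: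
  assumes "l holomorphic_on ball 0 R" "t \<in> bidisc R"
  shows "partial_deriv i (\<lambda>s. pt (s $ 1) (l (s $ 2)) $ j) t =
    (if i = 1 then if j = 1 then 1 else 0 else if j = 1 then 0 else deriv l (t $ 2))"
proof -
  have "partial_deriv i (\<lambda>s. l (s $ 2)) t = deriv l (t $ 2) * partial_deriv i (\<lambda>s. s $ 2) t"
    by (rule partial_deriv_compose[OF mv_holomorphic_on_nth assms(2)])
       (use assms in \<open>auto intro!: holomorphic_derivI simp: bidisc_def\<close>)
  then show ?thesis
    using exhaust_2[of i] exhaust_2[of j] by (auto simp: partial_deriv_nth)
qed

lemma hol_map_snd_map:
  assumes "l holomorphic_on ball 0 R" "R > 0" "l 0 = 0"
  shows "hol_map (\<lambda>t. pt (t $ 1) (l (t $ 2)))"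
  unfolding hol_map_def
proof (intro conjI allI eventually_at_rightI[OF _ assms(2)])
  show "pt ((0::complex^2) $ 1) (l ((0::complex^2) $ 2)) = 0"
    using assms(3) by (simp add: vec_eq_iff forall_2)
  fix j and r :: real assume r: "r \<in> {0<..<R}"
  have "mv_holomorphic_on (\<lambda>t. l (t $ 2)) (bidisc r)"
    by (rule mv_holomorphic_on_compose[OF mv_holomorphic_on_nth assms(1)]) (use r in \<open>auto simp: bidisc_def\<close>)
  then show "mv_holomorphic_on (\<lambda>t. pt (t $ 1) (l (t $ 2)) $ j) (bidisc r)"
    using exhaust_2[of j] by (auto simp: mv_holomorphic_on_nth)
qed

text \<open>The second column of the matrix is determined by the first column \<open>(a, c)\<close>; with it, \<open>I\<close> and \<open>II\<close>
  are what remains of the isomorphism equation.\<close>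

lemma normal_form_iso:
  assumes R: "R > 0" and l: "l holomorphic_on ball 0 R" "\<And>x. x \<in> ball 0 R \<Longrightarrow> deriv l x \<noteq> 0"
    and a: "hol_fps (ball 0 R) a" "\<And>x. x \<in> ball 0 R \<Longrightarrow> fps_nth (a x) 0 \<noteq> 0" and c: "hol_fps (ball 0 R) c"
    and \<psi>: "hol_fps (ball 0 R) \<psi>" "\<And>x. x \<in> ball 0 R \<Longrightarrow> \<psi> x = fps_const (deriv l x) * \<phi> (l x)"
    and I: "\<And>x. x \<in> ball 0 R \<Longrightarrow> (\<phi>' x - fps_const (deriv l x) * \<psi> x) * a x =
       fps_X * (fps_d (fps_d a) x + fps_d \<psi> x * c x + 2 * \<psi> x * fps_d c x)"
    and II: "\<And>x. x \<in> ball 0 R \<Longrightarrow> (\<phi>' x - fps_const (deriv l x) * \<psi> x) * c x =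
       2 * fps_const (deriv l x) * fps_d a x + fps_const (deriv (deriv l) x) * a x + fps_X * fps_d (fps_d c) x"
  shows "formal_iso_over (\<lambda>t. pt (t $ 1) (l (t $ 2)))
     (\<lambda>t. mat2 (a (t $ 2)) (fps_X * (fps_d a (t $ 2) + \<psi> (t $ 2) * c (t $ 2)))
               (c (t $ 2)) (fps_const (deriv l (t $ 2)) * a (t $ 2) + fps_X * fps_d c (t $ 2)))
     (normal_form \<phi>') (normal_form \<phi>)" (is "formal_iso_over ?h ?T _ _")
proof (rule iso_on_imp_formal_iso_over[OF iso_onI R])
  let ?B = "ball (0::complex) R"
  define b d where "b = (\<lambda>x. fps_X * (fps_d a x + \<psi> x * c x))"
    and "d = (\<lambda>x. fps_const (deriv l x) * a x + fps_X * fps_d c x)"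
  have p: "hol_fps ?B (\<lambda>x. fps_const (deriv l x))"
    by (intro hol_fps_fps_const holomorphic_deriv l open_ball)
  have b: "hol_fps ?B b" and d: "hol_fps ?B d"
    unfolding b_def d_def by (intro hol_fps_intros a c \<psi> p open_ball)+
  have T: "?T t $ 1 $ 1 = a (t $ 2)" "?T t $ 1 $ 2 = b (t $ 2)" "?T t $ 2 $ 1 = c (t $ 2)" "?T t $ 2 $ 2 = d (t $ 2)" for t
    by (simp_all add: b_def d_def)
  note fo = a(1)[THEN formal_on_hol_fps] b[THEN formal_on_hol_fps] c[THEN formal_on_hol_fps] d[THEN formal_on_hol_fps]
  show "formal_on (bidisc R) (\<lambda>t. ?T t $ j $ k)" for j k
    using exhaust_2[of j] exhaust_2[of k] fo by (auto simp only: T)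
  fix t :: "complex^2" assume t: "t \<in> bidisc R"
  define x where "x = t $ 2"
  have x: "x \<in> ?B" using t by (auto simp: x_def bidisc_def)
  have "fps_nth (a x * d x - b x * c x) 0 = fps_nth (a x) 0 ^ 2 * deriv l x"
    by (simp add: b_def d_def power2_eq_square)
  then show "fps_nth (?T t $ 1 $ 1 * ?T t $ 2 $ 2 - ?T t $ 1 $ 2 * ?T t $ 2 $ 1) 0 \<noteq> 0"
    unfolding T x_def[symmetric] using a(2)[OF x] l(2)[OF x] by simp
  have db: "fps_d b x = fps_X * (fps_d (fps_d a) x + (fps_d \<psi> x * c x + \<psi> x * fps_d c x))"
  proof -
    have "hol_fps ?B (\<lambda>x. fps_d a x + \<psi> x * c x)" by (intro hol_fps_intros a c \<psi> open_ball)
    from fps_d_cmult[OF this open_ball x, of fps_X] show ?thesis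
      unfolding b_def
      by (simp add: fps_d_add[OF hol_fps_d[OF a(1) open_ball] hol_fps_mult[OF \<psi>(1) c] open_ball x]
          fps_d_mult[OF \<psi>(1) c open_ball x])
  qed
  have dd: "fps_d d x = (fps_const (deriv (deriv l) x) * a x + fps_const (deriv l x) * fps_d a x) + fps_X * fps_d (fps_d c) x"
  proof -
    have "hol_fps ?B (\<lambda>x. fps_X * fps_d c x)" by (intro hol_fps_intros c open_ball)
    from fps_d_add[OF hol_fps_mult[OF p a(1)] this open_ball x] show ?thesis
      unfolding d_def
      by (simp add: fps_d_mult[OF p a(1) open_ball x] fps_d_cmult[OF hol_fps_d[OF c open_ball] open_ball x] fps_d_fps_const)
  qed
  have P: "fps_partial i (\<lambda>t. ?T t $ j $ k) t = (if i = 1 then 0 else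
      if j = 1 then if k = 1 then fps_d a x else fps_d b x else if k = 1 then fps_d c x else fps_d d x)" for i j k
    using exhaust_2[of j] exhaust_2[of k]
    by (auto simp: T x_def fps_partial_hol_fps[OF a(1) t] fps_partial_hol_fps[OF b t]
        fps_partial_hol_fps[OF c t] fps_partial_hol_fps[OF d t] simp del: mat2_nth)
  \<comment> \<open>Direction 1 is trivial because both first matrices are the identity. In
    direction 2 the entries 11 and 21 hold by the choice of b and d, entry 12 is z times
    \<open>I\<close>, and entry 22 is z times \<open>II\<close>.\<close>
  have e12: "fps_X * fps_d b x + \<psi> x * fps_X * d x - a x * (fps_X * \<phi>' x) = 0"
  proof -
    have "fps_X * fps_d b x + \<psi> x * fps_X * d x - a x * (fps_X * \<phi>' x) =
       fps_X * (fps_X * (fps_d (fps_d a) x + fps_d \<psi> x * c x + 2 * \<psi> x * fps_d c x) -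
        (\<phi>' x - fps_const (deriv l x) * \<psi> x) * a x)"
      unfolding db by (simp add: d_def algebra_simps)
    then show ?thesis by (simp add: I[OF x])
  qed
  have e22: "fps_X * fps_d d x + fps_const (deriv l x) * b x - c x * (fps_X * \<phi>' x) = 0"
  proof -
    have "fps_X * fps_d d x + fps_const (deriv l x) * b x - c x * (fps_X * \<phi>' x) =
       fps_X * (2 * fps_const (deriv l x) * fps_d a x + fps_const (deriv (deriv l) x) * a x + fps_X * fps_d (fps_d c) x -
        (\<phi>' x - fps_const (deriv l x) * \<psi> x) * c x)"
      unfolding dd by (simp add: b_def algebra_simps)
    then show ?thesis by (simp add: II[OF x])
  qed
  have e11: "fps_X * fps_d a x + \<psi> x * fps_X * c x - b x = 0"
    and e21: "fps_X * fps_d c x + fps_const (deriv l x) * a x - d x = 0"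
    by (simp_all add: b_def d_def algebra_simps)
  have \<psi>': "fps_const (deriv l x) * (fps_X * \<phi> (l x)) = \<psi> x * fps_X"
    by (simp add: \<psi>(2)[OF x] mult_ac)
  fix i j k
  show "fps_X * fps_partial i (\<lambda>t. ?T t $ j $ k) t +
        (\<Sum>m\<in>UNIV. \<Sum>n\<in>UNIV. fps_const (partial_deriv i (\<lambda>s. ?h s $ m) t) * normal_form \<phi> m (?h t) $ j $ n * ?T t $ n $ k) -
        (\<Sum>n\<in>UNIV. ?T t $ j $ n * normal_form \<phi>' i t $ n $ k) = 0"
  proof (cases "i = 1")
    case True
    show ?thesis unfolding P partial_deriv_snd_map[OF l(1) t] True normal_form_eq
      using exhaust_2[of j] exhaust_2[of k] by (auto simp: sum_2 C1_def mat_def)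
  next
    case False
    then have i: "i = 2" using exhaust_2[of i] by auto
    have ne: "(2::2) \<noteq> 1" by simp
    show ?thesis unfolding P partial_deriv_snd_map[OF l(1) t] i normal_form_eq sum_2 pt_nth x_def[symmetric]
      using exhaust_2[of j] exhaust_2[of k] e11 e12 e21 e22
      by (elim disjE; simp only: T[of t, folded x_def] ne if_True if_False x_def[symmetric] mat2_nth[of 0 _ 1 0] \<psi>' simp_thms
          fps_const_0_eq_0 mult_zero_left mult_zero_right add_0_left add_0_right mult_1_right mult_1_left refl)
  qed
qed

text \<open>Local injectivity of l, from its nonzero derivative at 0, lifts to the cylinders over a
  disc and over its image. The inverse g is exported as well, because a transformed normal form must
  be written in the new coordinate.\<close>

lemma biholomorphic_snd_map:
  assumes R: "R > 0" and l: "l holomorphic_on ball 0 R" "l 0 = 0" "deriv l 0 \<noteq> 0"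
  obtains r g where "r > 0" "r \<le> R" "g holomorphic_on l ` ball 0 r" "open (l ` ball 0 r)"
    "\<And>x. x \<in> ball 0 r \<Longrightarrow> g (l x) = x" "biholomorphic_germ (\<lambda>t. pt (t $ 1) (l (t $ 2)))"
proof -
  have "0 \<in> ball (0::complex) R" using R by simp
  then obtain r0 where r0: "r0 > 0" "inj_on l (ball 0 r0)"
    by (rule has_complex_derivative_locally_injective[OF l(1) _ open_ball l(3)]) (rule that)
  define r where "r = min r0 R"
  have r: "r > 0" "r \<le> R" using r0 R by (simp_all add: r_def)
  have inj: "inj_on l (ball 0 r)" by (rule inj_on_subset[OF r0(2)]) (auto simp: r_def)
  have lr: "l holomorphic_on ball 0 r" by (rule holomorphic_on_subset[OF l(1)]) (use r in auto)
  obtain g where g: "g holomorphic_on l ` ball 0 r" "\<And>x. x \<in> ball 0 r \<Longrightarrow> g (l x) = x"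
    by (rule holomorphic_has_inverse[OF lr open_ball inj]) (rule that)
  have op: "open (l ` ball 0 r)" by (rule open_mapping_thm3[OF lr open_ball inj])
  let ?U = "{t :: complex^2. t $ 2 \<in> ball 0 r}" and ?V = "{t :: complex^2. t $ 2 \<in> l ` ball 0 r}"
  let ?h = "\<lambda>t :: complex^2. pt (t $ 1) (l (t $ 2))" and ?k = "\<lambda>t :: complex^2. pt (t $ 1) (g (t $ 2))"
  have o: "open {t :: complex^2. t $ 2 \<in> S}" if "open S" for S
  proof -
    have "continuous_on UNIV (\<lambda>t :: complex^2. t $ 2)" by (intro continuous_intros)
    from open_vimage[OF that this] show ?thesis by (simp add: vimage_def)
  qed
  note oU = o[OF open_ball] and oV = o[OF op]
  have hh: "mv_holomorphic_on (\<lambda>t. ?h t $ j) ?U" for j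
  proof -
    have "mv_holomorphic_on (\<lambda>t. l (t $ 2)) ?U"
      by (rule mv_holomorphic_on_compose[OF mv_holomorphic_on_nth lr open_ball]) auto
    then show ?thesis using exhaust_2[of j] by (auto simp: mv_holomorphic_on_nth)
  qed
  have kk: "mv_holomorphic_on (\<lambda>t. ?k t $ j) ?V" for j
  proof -
    have "mv_holomorphic_on (\<lambda>t. g (t $ 2)) ?V"
      by (rule mv_holomorphic_on_compose[OF mv_holomorphic_on_nth g(1) op]) auto
    then show ?thesis using exhaust_2[of j] by (auto simp: mv_holomorphic_on_nth)
  qed
  have cont: "continuous_on S f" if "\<And>j. mv_holomorphic_on (\<lambda>t. f t $ j) S" for f :: "complex^2 \<Rightarrow> complex^2" and S
  proof -
    have "continuous_on S (\<lambda>t. \<chi> j. f t $ j)"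
      using mv_holomorphic_on_imp_continuous_on[OF that] by (intro continuous_on_vec_lambda) 
    then show ?thesis by simp
  qed
  have lin: "l x \<in> l ` ball 0 r" if "norm x < r" for x using that by auto
  have hom: "homeomorphism ?U ?V ?h ?k"
    unfolding homeomorphism_def
  proof (intro conjI)
    show "continuous_on ?U ?h" "continuous_on ?V ?k" by (rule cont[OF hh] cont[OF kk])+
    show "\<forall>t\<in>?U. ?k (?h t) = t" "\<forall>t\<in>?V. ?h (?k t) = t"
      by (auto simp: g(2) vec_eq_iff forall_2)
    have "t \<in> ?h ` ?U" if "t \<in> ?V" for t
      by (rule image_eqI[of _ _ "?k t"]) (use that in \<open>auto simp: g(2) vec_eq_iff forall_2\<close>)
    then show "?h ` ?U = ?V" by auto
    have "t \<in> ?k ` ?V" if "t \<in> ?U" for t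
      by (rule image_eqI[of _ _ "?h t"]) (use that in \<open>auto simp: g(2) vec_eq_iff forall_2\<close>)
    then show "?k ` ?V = ?U" by (auto simp: g(2))
  qed
  have "?h 0 = 0" by (simp add: vec_eq_iff forall_2 l(2))
  then have "biholomorphic_germ ?h"
    unfolding biholomorphic_germ_def
  proof (rule conjI, rule_tac exI[of _ ?U], rule_tac exI[of _ ?V], rule_tac exI[of _ ?k], intro conjI allI)
    show "0 \<in> ?U" using r by simp
  qed (use oU[of 0 r] oV hom hh kk in blast)+
  with g(2) show ?thesis by (rule that[OF r g(1) op])
qed

text \<open>The isomorphism equations with c = 0 and a = u free of z. \<open>II\<close> becomes
  \<open>2 l' u' + l'' u = 0\<close>, solved by \<open>l' = u\<^sup>-\<^sup>2\<close>.
  \<open>I\<close> becomes \<open>(l')\<^sup>2 Q = \<phi> - z u'' / u\<close>, which gives the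
  formula for Q as the new series pulled back along l. The correction \<open>u'' / u\<close> is
  minus half the Schwarzian derivative of l.\<close>

lemma normal_form_coordinate_change:
  assumes R: "R > 0" and u: "u holomorphic_on ball 0 R" "\<And>x. x \<in> ball 0 R \<Longrightarrow> u x \<noteq> 0"
    and l: "\<And>x. x \<in> ball 0 R \<Longrightarrow> (l has_field_derivative inverse (u x ^ 2)) (at x)" "l 0 = 0"
    and \<phi>: "hol_fps (ball 0 R) \<phi>"
  defines "Q \<equiv> \<lambda>x. fps_const (u x ^ 4) * (\<phi> x - fps_X * fps_const (deriv (deriv u) x / u x))"
  obtains r g h T where "r > 0" "\<And>y. y \<in> ball 0 r \<Longrightarrow> g y \<in> ball 0 R" "\<And>y. y \<in> ball 0 r \<Longrightarrow> l (g y) = y"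
    "hol_fps (ball 0 r) (\<lambda>y. Q (g y))" "biholomorphic_germ h" "hol_map h"
    "formal_iso_over h T (normal_form \<phi>) (normal_form (\<lambda>y. Q (g y)))"
proof -
  have lh: "l holomorphic_on ball 0 R" by (rule holomorphic_onI_DERIV[OF l(1)])
  have dl: "deriv l x = inverse (u x ^ 2)" if "x \<in> ball 0 R" for x
    by (rule DERIV_imp_deriv[OF l(1)[OF that]])
  have "deriv l 0 \<noteq> 0" using dl[of 0] u(2)[of 0] R by simp
  then obtain r g where r: "r > 0" "r \<le> R" and g: "g holomorphic_on l ` ball 0 r" and op: "open (l ` ball 0 r)"
    and gl: "\<And>x. x \<in> ball 0 r \<Longrightarrow> g (l x) = x" and bih: "biholomorphic_germ (\<lambda>t. pt (t $ 1) (l (t $ 2)))"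
    by (rule biholomorphic_snd_map[OF R lh l(2)]) (rule that)
  have "0 \<in> l ` ball 0 r" using l(2) r by force
  then obtain s where s: "s > 0" "ball 0 s \<subseteq> l ` ball 0 r" using op openE by blast
  have gs: "g y \<in> ball 0 r \<and> l (g y) = y" if "y \<in> ball 0 s" for y
    using s(2) that gl by (auto simp: subset_iff image_iff)
  have Q: "hol_fps (ball 0 R) Q"
    unfolding Q_def by (intro hol_fps_intros \<phi> holomorphic_intros holomorphic_deriv u open_ball)
  have Qg: "hol_fps (ball 0 s) (\<lambda>y. Q (g y))"
    by (rule hol_fps_compose[OF Q holomorphic_on_subset[OF g s(2)]]) (use gs r in force)
  have sub: "x \<in> ball 0 R" if "x \<in> ball 0 r" for x using that r by auto
  have uR: "u holomorphic_on ball 0 r" by (rule holomorphic_on_subset[OF u(1)]) (use r in auto)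
  have iso: "formal_iso_over (\<lambda>t. pt (t $ 1) (l (t $ 2)))
     (\<lambda>t. mat2 (fps_const (u (t $ 2))) (fps_X * (fps_d (\<lambda>x. fps_const (u x)) (t $ 2) + fps_const (inverse (u (t $ 2) ^ 2)) * Q (t $ 2) * 0))
               0 (fps_const (deriv l (t $ 2)) * fps_const (u (t $ 2)) + fps_X * fps_d (\<lambda>x. 0) (t $ 2)))
     (normal_form \<phi>) (normal_form (\<lambda>y. Q (g y)))"
  proof (rule normal_form_iso[OF r(1), where a = "\<lambda>x. fps_const (u x)" and c = "\<lambda>x. 0"
        and \<psi> = "\<lambda>x. fps_const (inverse (u x ^ 2)) * Q x"])
    show "l holomorphic_on ball 0 r" by (rule holomorphic_on_subset[OF lh]) (use r in auto)
    show "hol_fps (ball 0 r) (\<lambda>x. fps_const (u x))" by (intro hol_fps_intros uR)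
    have "hol_fps (ball 0 R) (\<lambda>x. fps_const (inverse (u x ^ 2)) * Q x)"
      by (intro hol_fps_intros holomorphic_intros u Q) (use u in auto)
    then show "hol_fps (ball 0 r) (\<lambda>x. fps_const (inverse (u x ^ 2)) * Q x)"
      by (rule hol_fps_subset) (use r in auto)
    fix x :: complex assume x: "x \<in> ball 0 r"
    note x' = sub[OF x]
    have nz: "u x \<noteq> 0" using u(2)[OF x'] .
    show "deriv l x \<noteq> 0" "fps_nth (fps_const (u x)) 0 \<noteq> 0" using dl[OF x'] nz by auto
    show "fps_const (inverse (u x ^ 2)) * Q x = fps_const (deriv l x) * Q (g (l x))"
      by (simp add: dl[OF x'] gl[OF x])
    have "fps_const (deriv l x) * (fps_const (inverse (u x ^ 2)) * Q x) =
        fps_const (inverse (u x ^ 2) * inverse (u x ^ 2) * u x ^ 4) * (\<phi> x - fps_X * fps_const (deriv (deriv u) x / u x))"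
      by (simp add: dl[OF x'] Q_def mult.assoc[symmetric])
    also have "inverse (u x ^ 2) * inverse (u x ^ 2) * u x ^ 4 = 1"
      using nz by (simp add: field_simps)
    finally have e: "\<phi> x - fps_const (deriv l x) * (fps_const (inverse (u x ^ 2)) * Q x) =
        fps_X * fps_const (deriv (deriv u) x / u x)" by simp
    have d: "fps_d (\<lambda>x. fps_const (u x)) = (\<lambda>x. fps_const (deriv u x))"
      by (rule ext) (rule fps_d_fps_const)
    show "(\<phi> x - fps_const (deriv l x) * (fps_const (inverse (u x ^ 2)) * Q x)) * fps_const (u x) =
       fps_X * (fps_d (fps_d (\<lambda>x. fps_const (u x))) x + fps_d (\<lambda>x. fps_const (inverse (u x ^ 2)) * Q x) x * 0
         + 2 * (fps_const (inverse (u x ^ 2)) * Q x) * fps_d (\<lambda>x. 0) x)"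
      unfolding e d by (simp add: fps_d_fps_const mult.assoc nz)
    have "(deriv l has_field_derivative - 2 * deriv u x * inverse (u x ^ 3)) (at x)"
    proof (rule has_field_derivative_transform_within_open[OF _ open_ball x'])
      have "(u has_field_derivative deriv u x) (at x)" using u(1) x' by (intro holomorphic_derivI) auto
      then show "((\<lambda>x. inverse (u x ^ 2)) has_field_derivative - 2 * deriv u x * inverse (u x ^ 3)) (at x)"
        using nz by (auto intro!: derivative_eq_intros simp: field_simps power2_eq_square power3_eq_cube)
    qed (simp add: dl)
    then have ddl: "deriv (deriv l) x = - 2 * deriv u x * inverse (u x ^ 3)" by (rule DERIV_imp_deriv)
    have "2 * inverse (u x ^ 2) * deriv u x + - 2 * deriv u x * inverse (u x ^ 3) * u x = 0"
      using nz by (simp add: field_simps power2_eq_square power3_eq_cube)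
    from arg_cong[OF this, of fps_const] have
      "fps_const 2 * fps_const (inverse (u x ^ 2)) * fps_const (deriv u x) +
         fps_const (- 2 * deriv u x * inverse (u x ^ 3)) * fps_const (u x) = 0"
      by (simp only: fps_const_mult fps_const_add fps_const_0_eq_0)
    moreover have z: "fps_d (\<lambda>x. 0) = (\<lambda>x. 0)" by (rule ext) (rule fps_d_const)
    moreover have "fps_const 2 = (2 :: complex fps)" by (simp add: numeral_fps_const)
    ultimately show "(\<phi> x - fps_const (deriv l x) * (fps_const (inverse (u x ^ 2)) * Q x)) * 0 =
       2 * fps_const (deriv l x) * fps_d (\<lambda>x. fps_const (u x)) x + fps_const (deriv (deriv l) x) * fps_const (u x)
         + fps_X * fps_d (fps_d (\<lambda>x. 0)) x"
      unfolding ddl dl[OF x'] z fps_d_fps_const fps_d_const by (simp only: mult_zero_right add_0_right)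
  qed auto
  have "g y \<in> ball 0 R" if "y \<in> ball 0 s" for y using sub conjunct1[OF gs[OF that]] .
  from that[OF s(1) this conjunct2[OF gs] Qg bih hol_map_snd_map[OF lh R l(2)] iso] show ?thesis .
qed

text \<open>The classical removal of the first-order term from a scalar second-order equation. An
  upper triangular gauge with diagonal f and corner \<open>- z f'\<close> clears the diagonal when
  \<open>2 z f' = y f\<close>; since y is divisible by z, this is a regular equation for f. The
  price is the term \<open>z f'' / f\<close> in \<phi>.\<close>

lemma companion_to_normal_form:
  assumes R: "R > 0" and x: "hol_fps (ball 0 R) x" "\<And>s. s \<in> ball 0 R \<Longrightarrow> fps_nth (x s) 0 = 0"
    and y: "hol_fps (ball 0 R) y" "\<And>s. s \<in> ball 0 R \<Longrightarrow> fps_nth (y s) 0 = 0"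
  obtains \<phi> T where "hol_fps (ball 0 R) \<phi>" "formal_iso_over (\<lambda>t. t) T (companion y x) (normal_form \<phi>)"
proof -
  let ?B = "ball (0::complex) R"
  have "hol_fps ?B (\<lambda>s. fps_const (1/2) * fps_shift 1 (y s))" by (intro hol_fps_intros y)
  then obtain f where f: "hol_fps ?B f" "\<And>s. s \<in> ?B \<Longrightarrow> fps_nth (f s) 0 \<noteq> 0"
    "\<And>s. s \<in> ?B \<Longrightarrow> fps_d f s = fps_const (1/2) * fps_shift 1 (y s) * f s"
    by (rule linear_ode_fps) (rule that)
  define \<phi> where "\<phi> s = fps_shift 1 (x s) + fps_X * fps_d (fps_d f) s * inverse (f s)" for s
  have \<phi>: "hol_fps ?B \<phi>"
    unfolding \<phi>_def[abs_def] by (intro hol_fps_intros x f open_ball)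
  have xs: "x s = fps_X * fps_shift 1 (x s)" and ys: "y s = fps_X * fps_shift 1 (y s)" if "s \<in> ?B" for s
    using fps_eq_const_plus_shift[of "x s"] fps_eq_const_plus_shift[of "y s"] x(2)[OF that] y(2)[OF that] by simp_all
  have e1: "2 * (fps_X * fps_d f s) = f s * y s" if "s \<in> ?B" for s
  proof -
    have "2 * (fps_const (1/2)) = (1 :: complex fps)"
      by (simp add: numeral_fps_const)
    then have "2 * (fps_X * fps_d f s) = fps_X * fps_shift 1 (y s) * f s"
      unfolding f(3)[OF that] by (metis (no_types, opaque_lifting) mult.assoc mult.left_commute mult_1)
    then show ?thesis using ys[OF that] by (metis mult.commute)
  qed
  have e2: "fps_X * \<phi> s * f s = f s * x s + fps_X * (fps_X * fps_d (fps_d f) s)" if "s \<in> ?B" for s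
  proof -
    have "fps_X * \<phi> s * f s = (fps_X * fps_shift 1 (x s)) * f s + fps_X * (fps_X * fps_d (fps_d f) s) * (inverse (f s) * f s)"
      by (simp add: \<phi>_def algebra_simps)
    then show ?thesis using xs[OF that] inverse_mult_eq_1[OF f(2)[OF that]] by (metis mult.commute mult_1_right)
  qed
  define e where "e s = fps_X * - fps_d f s" for s
  let ?T = "\<lambda>t. mat2 (f (t $ 2)) (e (t $ 2)) 0 (f (t $ 2))"
  have df: "hol_fps ?B e" unfolding e_def by (intro hol_fps_intros f open_ball)
  have "formal_iso_over (\<lambda>t. t) ?T (companion y x) (normal_form \<phi>)"
  proof (rule iso_on_imp_formal_iso_over[OF iso_onI R])
    show "formal_on (bidisc R) (\<lambda>t. ?T t $ j $ k)" for j k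
      using exhaust_2[of j] exhaust_2[of k] f(1)[THEN formal_on_hol_fps] df[THEN formal_on_hol_fps] by auto
    fix t :: "complex^2" assume t: "t \<in> bidisc R"
    define s where "s = t $ 2"
    have s: "s \<in> ?B" using t by (auto simp: s_def bidisc_def)
    show "fps_nth (?T t $ 1 $ 1 * ?T t $ 2 $ 2 - ?T t $ 1 $ 2 * ?T t $ 2 $ 1) 0 \<noteq> 0"
      using f(2)[OF s] by (simp add: s_def)
    have "hol_fps ?B (\<lambda>s. - fps_d f s)" by (intro hol_fps_intros f open_ball)
    from fps_d_cmult[OF this open_ball s] have
      "fps_d (\<lambda>s. fps_X * - fps_d f s) s = fps_X * fps_d (\<lambda>s. - fps_d f s) s" .
    also have "fps_d (\<lambda>s. - fps_d f s) s = - fps_d (fps_d f) s"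
      using fps_d_cmult[OF hol_fps_d[OF f(1) open_ball] open_ball s, of "-1"] by simp
    finally have dd: "fps_d e s = fps_X * - fps_d (fps_d f) s" by (simp only: e_def[abs_def])
    have P: "fps_partial i (\<lambda>t. ?T t $ j $ k) t = (if i = 1 then 0 else
        if j = k then fps_d f s else if j = 1 then fps_X * - fps_d (fps_d f) s else 0)" for i j k
      using exhaust_2[of j] exhaust_2[of k] dd
      by (auto simp: s_def fps_partial_hol_fps[OF f(1) t] fps_partial_hol_fps[OF df t])
    note e' = e1[OF s] e2[OF s]
    fix i j k
    show "fps_X * fps_partial i (\<lambda>t. ?T t $ j $ k) t +
        (\<Sum>m\<in>UNIV. \<Sum>n\<in>UNIV. fps_const (partial_deriv i (\<lambda>s. s $ m) t) * normal_form \<phi> m t $ j $ n * ?T t $ n $ k) -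
        (\<Sum>n\<in>UNIV. ?T t $ j $ n * companion y x i t $ n $ k) = 0"
    proof (cases "i = 1")
      case True
      show ?thesis unfolding P True normal_form_eq partial_deriv_nth companion_def
        using exhaust_2[of j] exhaust_2[of k] by (auto simp: sum_2 C1_def mat_def)
    next
      case False
      then have i: "i = 2" using exhaust_2[of i] by auto
      show ?thesis unfolding P i normal_form_eq partial_deriv_nth companion_def s_def[symmetric]
        using exhaust_2[of j] exhaust_2[of k] e' by (auto simp: sum_2 e_def algebra_simps)
    qed
  qed
  with \<phi> show ?thesis by (rule that)
qed

text \<open>The solution holomorphic at \<open>0\<close> is the integral of \<open>\<tau>\<^sup>m\<^sup>-\<^sup>1 g(\<tau>\<^sup>2 x)\<close> over the unit
  interval: integrate the derivative of \<open>\<tau>\<^sup>m g(\<tau>\<^sup>2 x)\<close>.\<close>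

lemma euler_ode:
  assumes g: "g holomorphic_on ball 0 R" and m: "m > 0"
  obtains c where "c holomorphic_on ball 0 R"
    "\<And>x. x \<in> ball 0 R \<Longrightarrow> 2 * x * deriv c x + of_nat m * c x = g x"
proof -
  let ?B = "ball (0::complex) R"
  have sx: "of_real s ^ 2 * x \<in> ?B" if "x \<in> ?B" "s \<in> cbox 0 (1::real)" for s :: real and x :: complex
  proof -
    have "s ^ 2 \<le> 1" using that by (simp add: power_le_one)
    then have "norm (of_real s ^ 2 * x) \<le> norm x"
      by (simp add: norm_mult norm_power mult_left_le_one_le)
    with that show ?thesis by simp
  qed
  have contg: "continuous_on ?B g" "continuous_on ?B (deriv g)"
    using g by (auto intro!: holomorphic_on_imp_continuous_on holomorphic_deriv)
  define f where "f x s = of_real s ^ (m - 1) * g (of_real s ^ 2 * x)" for x :: complex and s :: real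
  define f' where "f' x s = of_real s ^ (m - 1) * (deriv g (of_real s ^ 2 * x) * of_real s ^ 2)" for x :: complex and s :: real
  define c where "c x = integral (cbox 0 1) (f x)" for x
  have cp: "continuous_on (?B \<times> cbox 0 (1::real)) (\<lambda>p. G (of_real (snd p) ^ 2 * fst p))" if "continuous_on ?B G" for G :: "complex \<Rightarrow> complex"
    by (rule continuous_on_compose2[OF that]) (use sx in \<open>auto intro!: continuous_intros\<close>)
  have c1: "continuous_on (cbox 0 (1::real)) (\<lambda>s. G (of_real s ^ 2 * x))" if "continuous_on ?B G" "x \<in> ?B" for G :: "complex \<Rightarrow> complex" and x
    by (rule continuous_on_compose2[OF that(1)]) (use sx[OF that(2)] in \<open>auto intro!: continuous_intros\<close>)
  have cf': "continuous_on (?B \<times> cbox 0 1) (\<lambda>(x, s). f' x s)"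
    unfolding f'_def split_def by (intro continuous_intros cp contg)
  have fi: "f x integrable_on cbox 0 1" and fi': "f' x integrable_on cbox 0 1" if "x \<in> ?B" for x
    unfolding f_def f'_def by (intro integrable_continuous continuous_intros c1 contg that)+
  have gd: "(g has_field_derivative deriv g x) (at x)" if "x \<in> ?B" for x
    using g that by (intro holomorphic_derivI) auto
  have D: "(c has_field_derivative integral (cbox 0 1) (f' x)) (at x)" if x: "x \<in> ?B" for x
  proof -
    have "(c has_field_derivative integral (cbox 0 1) (f' x)) (at x within ?B)"
      unfolding c_def
    proof (rule leibniz_rule_field_derivative[OF _ fi cf' x convex_ball])
      fix x s assume xs: "x \<in> ?B" "s \<in> cbox 0 (1::real)"
      have "((\<lambda>x. of_real s ^ 2 * x) has_field_derivative of_real s ^ 2) (at x)"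
        by (auto intro!: derivative_eq_intros)
      from DERIV_chain2[OF gd[OF sx[OF xs]] this] show "((\<lambda>x. f x s) has_field_derivative f' x s) (at x within ?B)"
        unfolding f_def f'_def by (rule DERIV_cmult[THEN has_field_derivative_at_within])
    qed
    then show ?thesis using x by (simp add: at_within_open[of x ?B])
  qed
  show ?thesis
  proof (rule that)
    show "c holomorphic_on ?B" by (rule holomorphic_onI_DERIV[OF D])
    fix x assume x: "x \<in> ?B"
    have "((\<lambda>s. of_nat m * f x s + 2 * x * f' x s) has_integral
        (of_real 1 ^ m * g (of_real 1 ^ 2 * x) - of_real 0 ^ m * g (of_real 0 ^ 2 * x))) {0..1}"
    proof (rule fundamental_theorem_of_calculus)
      fix s :: real assume s: "s \<in> {0..1}"
      have g2: "(g has_field_derivative deriv g (of_real s ^ 2 * x)) (at (of_real s ^ 2 * x))"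
        using s by (intro gd sx x) auto
      have sm: "of_real s ^ m = of_real s * of_real s ^ (m - 1)" for s :: real
        using m by (cases m) auto
      have "((\<lambda>w. w ^ m * g (w ^ 2 * x)) has_field_derivative
         (of_nat m * f x s + 2 * x * f' x s)) (at (of_real s))"
      proof -
        have "((\<lambda>w. w ^ 2 * x) has_field_derivative 2 * of_real s * x) (at (of_real s))"
          by (auto intro!: derivative_eq_intros)
        from DERIV_chain2[OF g2 this] have a: "((\<lambda>w. g (w ^ 2 * x)) has_field_derivative
            deriv g (of_real s ^ 2 * x) * (2 * of_real s * x)) (at (of_real s))" .
        have b: "((\<lambda>w. w ^ m) has_field_derivative of_nat m * of_real s ^ (m - 1)) (at (of_real s :: complex))"
          by (auto intro!: derivative_eq_intros)
        from DERIV_mult'[OF b a] show ?thesis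
          by (rule DERIV_cong) (simp add: f_def f'_def sm power2_eq_square algebra_simps)
      qed
      then show "((\<lambda>s. of_real s ^ m * g (of_real s ^ 2 * x)) has_vector_derivative of_nat m * f x s + 2 * x * f' x s) (at s within {0..1})"
        by (rule has_vector_derivative_real_field)
    qed simp
    then have "integral (cbox 0 1) (\<lambda>s. of_nat m * f x s + 2 * x * f' x s) = g x"
      using m by (simp add: integral_unique)
    moreover have "integral (cbox 0 1) (\<lambda>s. of_nat m * f x s + 2 * x * f' x s) = of_nat m * c x + 2 * x * integral (cbox 0 1) (f' x)"
      unfolding c_def
      by (subst integral_add) (use fi[OF x] fi'[OF x] in \<open>auto intro!: integrable_on_mult_right\<close>)
    ultimately show "2 * x * deriv c x + of_nat m * c x = g x"
      by (simp add: DERIV_imp_deriv[OF D[OF x]] add.commute)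
  qed
qed

text \<open>Induction on m: q minus its value at 0 is divided by x, and the removable singularity
  keeps the remainder holomorphic on the whole disc. The bound on p is stated by coefficients and
  not by degree, so that m = 0 forces p = 0.\<close>

lemma taylor_remainder:
  assumes g: "g holomorphic_on ball 0 R" and R: "R > 0"
  obtains p q where "\<And>i. i \<ge> m \<Longrightarrow> coeff p i = 0" "q holomorphic_on ball 0 R"
    "\<And>x. x \<in> ball 0 R \<Longrightarrow> g x = poly p x + x ^ m * q x"
proof -
  have "\<exists>p q. (\<forall>i\<ge>m. coeff p i = 0) \<and> q holomorphic_on ball 0 R \<and> (\<forall>x\<in>ball 0 R. g x = poly p x + x ^ m * q x)"
  proof (induction m)
    case 0
    show ?case by (rule exI[of _ 0], rule exI[of _ g]) (use g in auto)
  next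
    case (Suc m)
    then obtain p q where p: "\<forall>i\<ge>m. coeff p i = 0" and q: "q holomorphic_on ball 0 R"
      and pq: "\<forall>x\<in>ball 0 R. g x = poly p x + x ^ m * q x" by blast
    define q1 where "q1 x = (if x = 0 then deriv q 0 else (q x - q 0) / (x - 0))" for x
    have "q1 holomorphic_on ball 0 R" unfolding q1_def by (rule pole_lemma[OF q]) (use R in simp)
    moreover have "\<forall>x\<in>ball 0 R. g x = poly (p + monom (q 0) m) x + x ^ Suc m * q1 x"
    proof
      fix x :: complex assume "x \<in> ball 0 R"
      then have "g x = poly p x + x ^ m * q x" using pq by blast
      also have "q x = q 0 + x * q1 x" by (simp add: q1_def)
      finally show "g x = poly (p + monom (q 0) m) x + x ^ Suc m * q1 x"
        by (simp add: poly_monom algebra_simps)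
    qed
    moreover have "\<forall>i\<ge>Suc m. coeff (p + monom (q 0) m) i = 0" using p by auto
    ultimately show ?case by blast
  qed
  then show ?thesis using that by blast
qed

text \<open>For positive r the left operator is \<open>x\<^sup>r\<^sup>-\<^sup>1\<close> times an
  Euler operator. So the Taylor polynomial of g below that power goes into p and the rest is an
  Euler equation. For r = 0 the equation is 2 c' = g. Both r = 0 and r = 1 leave p = 0, which is why
  forms (a) and (b) carry no parameters.\<close>

lemma normalizing_ode:
  assumes g: "g holomorphic_on ball 0 R" and R: "R > 0"
  obtains c p where "c holomorphic_on ball 0 R" "degree p \<le> r - 2" "r \<le> 1 \<Longrightarrow> p = 0"
    "\<And>x. x \<in> ball 0 R \<Longrightarrow> of_nat r * x ^ (r - 1) * c x + 2 * x ^ r * deriv c x + poly p x = g x"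
proof (cases "r = 0")
  case True
  have "(\<lambda>x. g x / 2) holomorphic_on ball 0 R" by (intro holomorphic_intros g) auto
  then obtain c where c: "c holomorphic_on ball 0 R" "\<And>x. x \<in> ball 0 R \<Longrightarrow> (c has_field_derivative g x / 2) (at x)"
    by (rule hol_primitive) (rule that)
  show ?thesis by (rule that[of c 0]) (use c True DERIV_imp_deriv[OF c(2)] in \<open>auto simp: mult.commute\<close>)
next
  case False
  obtain p q where p: "\<And>i. i \<ge> r - 1 \<Longrightarrow> coeff p i = 0" and q: "q holomorphic_on ball 0 R"
    and pq: "\<And>x. x \<in> ball 0 R \<Longrightarrow> g x = poly p x + x ^ (r - 1) * q x"
    by (rule taylor_remainder[OF g R, of "r - 1"]) (rule that)
  obtain c where c: "c holomorphic_on ball 0 R"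
    "\<And>x. x \<in> ball 0 R \<Longrightarrow> 2 * x * deriv c x + of_nat r * c x = q x"
    by (rule euler_ode[OF q, of r]) (use False in auto)
  show ?thesis
  proof (rule that[of c p])
    show "degree p \<le> r - 2" by (rule degree_le) (use p in auto)
    show "p = 0" if "r \<le> 1" using p that by (auto simp: poly_eq_iff)
    fix x :: complex assume x: "x \<in> ball 0 R"
    have "x ^ r = x ^ (r - 1) * x" using False by (cases r) auto
    then show "of_nat r * x ^ (r - 1) * c x + 2 * x ^ r * deriv c x + poly p x = g x"
      by (simp add: pq[OF x] c(2)[OF x, symmetric] algebra_simps)
  qed (rule c)
qed

lemma holomorphic_nonzero_ball:
  assumes g: "g holomorphic_on ball 0 R" and R: "R > 0" and "g 0 \<noteq> 0"
  obtains \<rho> where "0 < \<rho>" "\<rho> \<le> R" "\<And>x. x \<in> ball 0 \<rho> \<Longrightarrow> g x \<noteq> 0"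
proof -
  have "open (g -` (- {0}) \<inter> ball 0 R)"
    using continuous_on_open_vimage[OF open_ball, THEN iffD1, OF holomorphic_on_imp_continuous_on[OF g]] by blast
  moreover have "0 \<in> g -` (- {0}) \<inter> ball 0 R" using assms by auto
  ultimately obtain e where e: "e > 0" "ball 0 e \<subseteq> g -` (- {0}) \<inter> ball 0 R" using openE by blast
  show ?thesis by (rule that[of "min e R"]) (use e R in auto)
qed

lemma holomorphic_order_cases:
  assumes g: "g holomorphic_on ball 0 R" and R: "R > 0"
  obtains (zero) "\<And>x. x \<in> ball 0 R \<Longrightarrow> g x = 0"
  | (order) n u \<rho> where "0 < \<rho>" "\<rho> \<le> R" "u holomorphic_on ball 0 \<rho>"
      "\<And>x. x \<in> ball 0 \<rho> \<Longrightarrow> u x \<noteq> 0" "\<And>x. x \<in> ball 0 \<rho> \<Longrightarrow> g x = x ^ n * u x"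
proof -
  have 0: "0 \<in> ball (0::complex) R" using R by simp
  consider "\<And>x. x \<in> ball 0 R \<Longrightarrow> g x = 0" | "g 0 \<noteq> 0" | "g 0 = 0" "\<not> g constant_on ball 0 R"
    using 0 unfolding constant_on_def by metis
  then show ?thesis
  proof cases
    case 1
    then show ?thesis by (rule zero)
  next
    case 2
    obtain \<rho> where \<rho>: "0 < \<rho>" "\<rho> \<le> R" "\<And>x. x \<in> ball 0 \<rho> \<Longrightarrow> g x \<noteq> 0"
      by (rule holomorphic_nonzero_ball[OF g R 2]) (rule that)
    have sub: "ball 0 \<rho> \<subseteq> ball (0::complex) R" using \<rho> by auto
    show ?thesis by (rule order[OF \<rho>(1,2) holomorphic_on_subset[OF g sub] \<rho>(3), of 0]) auto
  next
    case 3
    obtain u \<rho> n where u: "0 < n" "0 < \<rho>" "ball (0::complex) \<rho> \<subseteq> ball 0 R" "u holomorphic_on ball 0 \<rho>"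
      "\<And>w. w \<in> ball 0 \<rho> \<Longrightarrow> g w = (w - 0) ^ n * u w" "\<And>w. w \<in> ball 0 \<rho> \<Longrightarrow> u w \<noteq> 0"
      by (rule holomorphic_factor_zero_nonconstant[OF g open_ball connected_ball 0 3(1) 3(2)]) (rule that)
    have sub: "ball 0 (min \<rho> R) \<subseteq> ball (0::complex) \<rho>" by auto
    show ?thesis
      by (rule order[of "min \<rho> R" u n]) (use u R holomorphic_on_subset[OF u(4) sub] in auto)
  qed
qed

lemma holomorphic_nonvanishing_exp:
  assumes "u holomorphic_on ball 0 R" "\<And>x. x \<in> ball 0 R \<Longrightarrow> u x \<noteq> 0"
  obtains L where "L holomorphic_on ball 0 R" "\<And>x. x \<in> ball (0::complex) R \<Longrightarrow> u x = exp (L x)"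
  by (rule contractible_imp_holomorphic_log[OF assms(1) convex_imp_contractible[OF convex_ball] assms(2)])
     (assumption, rule that)

text \<open>The coordinate \<open>l\<close> solves \<open>l'\<^sup>2 l\<^sup>r = x\<^sup>r u\<close>. Write \<open>s = (r+2)/2\<close>; then \<open>l\<^sup>s\<close> must be a
  primitive of \<open>s x\<^sup>r\<^sup>/\<^sup>2 \<surd>u\<close>, hence of the form \<open>x\<^sup>s w\<close>, where \<open>w\<close> solves an Euler equation.\<close>

lemma power_normalizing_coordinate:
  assumes u: "u holomorphic_on ball 0 R" "\<And>x. x \<in> ball 0 R \<Longrightarrow> u x \<noteq> 0" and R: "R > 0"
  obtains \<rho> v l where "0 < \<rho>" "\<rho> \<le> R" "v holomorphic_on ball 0 \<rho>" "\<And>x. v x \<noteq> 0"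
    "\<And>x. x \<in> ball 0 \<rho> \<Longrightarrow> (l has_field_derivative inverse (v x ^ 2)) (at x)" "l 0 = 0"
    "\<And>x. x \<in> ball 0 \<rho> \<Longrightarrow> v x ^ 4 * (x ^ r * u x) = l x ^ r"
proof -
  obtain U where U: "U holomorphic_on ball 0 R" "\<And>x. x \<in> ball 0 R \<Longrightarrow> u x = exp (U x)"
    by (rule holomorphic_nonvanishing_exp[OF u]) (assumption, rule that)
  \<comment> \<open>With \<open>s = (r + 2) / 2\<close>, inserting
    \<open>l\<^sup>s = x\<^sup>s w\<close> into \<open>l' l\<^sup>r\<^sup>/\<^sup>2 =
    x\<^sup>r\<^sup>/\<^sup>2 \<surd>u\<close> gives
    \<open>2 x w' + (r + 2) w = (r + 2) \<surd>u\<close>. The root is taken through the logarithm U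
    of u.\<close>
  define q where "q x = of_nat (r + 2) * exp (U x / 2)" for x
  have "q holomorphic_on ball 0 R" unfolding q_def by (intro holomorphic_intros U) auto
  then obtain w where w: "w holomorphic_on ball 0 R"
    "\<And>x. x \<in> ball 0 R \<Longrightarrow> 2 * x * deriv w x + of_nat (r + 2) * w x = q x"
    by (rule euler_ode[of _ _ "r + 2"]) (simp, rule that)
  have "of_nat (r + 2) * w 0 = of_nat (r + 2) * exp (U 0 / 2)"
    using w(2)[of 0] R unfolding q_def by simp
  then have w0: "w 0 \<noteq> 0" by (metis exp_not_eq_zero mult_eq_0_iff of_nat_eq_0_iff add_is_0 zero_neq_numeral)
  obtain \<rho> where \<rho>: "0 < \<rho>" "\<rho> \<le> R" "\<And>x. x \<in> ball 0 \<rho> \<Longrightarrow> w x \<noteq> 0"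
    by (rule holomorphic_nonzero_ball[OF w(1) R w0]) (rule that)
  have sub: "x \<in> ball 0 R" if "x \<in> ball 0 \<rho>" for x :: complex using that \<rho> by auto
  have wr: "w holomorphic_on ball 0 \<rho>" and Ur: "U holomorphic_on ball 0 \<rho>"
    using sub by (auto intro!: holomorphic_on_subset[OF w(1)] holomorphic_on_subset[OF U(1)])
  obtain L where L: "L holomorphic_on ball 0 \<rho>" "\<And>x. x \<in> ball 0 \<rho> \<Longrightarrow> w x = exp (L x)"
    by (rule holomorphic_nonvanishing_exp[OF wr \<rho>(3)]) (assumption, rule that)
  \<comment> \<open>The exponent 1/s, so that W is the s-th root of w and l = x W; again a logarithm
    L makes it single-valued.\<close>
  define k where "k = (2 / of_nat (r + 2) :: complex)"
  define W where "W x = exp (k * L x)" for x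
  \<comment> \<open>The inverse square root of l'. By the Euler equation
    \<open>1 + x k L' = exp (U/2 - L)\<close>, hence l' is the exponential of k L + U/2 - L and its
    root needs no choice of branch.\<close>
  define v where "v x = exp (- (k * L x + U x / 2 - L x) / 2)" for x
  have v2: "inverse (v x ^ 2) = exp (k * L x + U x / 2 - L x)" for x
    by (simp add: v_def power2_eq_square flip: exp_add exp_minus)
  have ne: "complex_of_nat r + 2 \<noteq> 0" using of_nat_eq_0_iff[of "r + 2", where 'a = complex] by (simp add: add.commute)
  have kr: "k * of_nat r = 2 - 2 * k"
    unfolding k_def using ne by (simp add: field_simps)
  show ?thesis
  proof (rule that[OF \<rho>(1,2), of v "\<lambda>x. x * W x"])
    show "v holomorphic_on ball 0 \<rho>" unfolding v_def by (intro holomorphic_intros L Ur) auto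
    show "v x \<noteq> 0" for x by (simp add: v_def)
    fix x :: complex assume x: "x \<in> ball 0 \<rho>"
    have dL: "(L has_field_derivative deriv L x) (at x)" using L(1) x by (intro holomorphic_derivI) auto
    have "deriv w x = deriv (\<lambda>x. exp (L x)) x"
      by (rule deriv_cong_ev) (use x L(2) in \<open>auto simp: eventually_nhds intro!: exI[of _ "ball 0 \<rho>"]\<close>)
    also have "\<dots> = exp (L x) * deriv L x"
      by (rule DERIV_imp_deriv) (auto intro!: derivative_eq_intros dL)
    finally have dw: "deriv w x = exp (L x) * deriv L x" .
    have ee: "exp (L x) * exp (U x / 2 - L x) = exp (U x / 2)" by (simp flip: exp_add)
    have "exp (L x) * (2 * x * deriv L x + of_nat (r + 2)) = of_nat (r + 2) * (exp (L x) * exp (U x / 2 - L x))"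
      unfolding ee using w(2)[OF sub[OF x]] L(2)[OF x] dw by (simp add: q_def algebra_simps)
    then have "exp (L x) * (2 * x * deriv L x + of_nat (r + 2)) = exp (L x) * (of_nat (r + 2) * exp (U x / 2 - L x))"
      by (simp only: mult.left_commute)
    then have "2 * x * deriv L x + of_nat (r + 2) = of_nat (r + 2) * exp (U x / 2 - L x)" by simp
    then have e: "1 + x * (k * deriv L x) = exp (U x / 2 - L x)"
      unfolding k_def using ne by (simp add: field_simps)
    have "((\<lambda>x. x * W x) has_field_derivative W x * (1 + x * (k * deriv L x))) (at x)"
      unfolding W_def by (auto intro!: derivative_eq_intros dL simp: algebra_simps)
    also have "W x * (1 + x * (k * deriv L x)) = inverse (v x ^ 2)"
      unfolding e v2 by (simp add: W_def flip: exp_add) (simp add: algebra_simps)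
    finally show "((\<lambda>x. x * W x) has_field_derivative inverse (v x ^ 2)) (at x)" .
    have "v x ^ 4 * u x = exp (4 * (- (k * L x + U x / 2 - L x) / 2) + U x)"
      using U(2)[OF sub[OF x]] by (simp add: v_def exp_add flip: exp_of_nat_mult)
    also have "4 * (- (k * L x + U x / 2 - L x) / 2) + U x = (2 - 2 * k) * L x"
      by (simp add: field_simps)
    also have "(2 - 2 * k) * L x = of_nat r * (k * L x)"
      unfolding kr[symmetric] by (simp only: mult_ac)
    also have "exp (of_nat r * (k * L x)) = W x ^ r" by (simp add: W_def exp_of_nat_mult)
    finally show "v x ^ 4 * (x ^ r * u x) = (x * W x) ^ r"
      by (simp add: power_mult_distrib mult_ac)
  qed simp
qed

section \<open>Gauge normalization for a fixed leading term\<close>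

lemma fps_numeral_mult_nth: "fps_nth (numeral k * f) n = numeral k * fps_nth (f :: complex fps) n"
  by (simp add: numeral_fps_const)

lemma formal_iso_over_gauge:
  assumes R: "R > 0" and a: "hol_fps (ball 0 R) a" "\<And>x. x \<in> ball 0 R \<Longrightarrow> fps_nth (a x) 0 \<noteq> 0"
    and c: "hol_fps (ball 0 R) c" and \<phi>: "hol_fps (ball 0 R) \<phi>"
    and I: "\<And>x. x \<in> ball 0 R \<Longrightarrow> (\<phi>' x - \<phi> x) * a x =
       fps_X * (fps_d (fps_d a) x + fps_d \<phi> x * c x + 2 * \<phi> x * fps_d c x)"
    and II: "\<And>x. x \<in> ball 0 R \<Longrightarrow> (\<phi>' x - \<phi> x) * c x = 2 * fps_d a x + fps_X * fps_d (fps_d c) x"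
  obtains T where "formal_iso_over (\<lambda>t. t) T (normal_form \<phi>') (normal_form \<phi>)"
proof -
  have d: "deriv (\<lambda>x. x) = (\<lambda>x::complex. 1)" by (rule ext) simp
  note * = normal_form_iso[of R "\<lambda>x. x" a c \<phi> \<phi> \<phi>', OF R _ _ a c \<phi>]
  show ?thesis
    by (rule that, rule *[unfolded pt_eta]) (use I II in \<open>simp_all add: d\<close>)
qed

text \<open>At order \<open>n\<close> equation \<open>II\<close> of \<open>normal_form_iso\<close> gives the \<open>n\<close>-th coefficient of \<open>a\<close>; equation \<open>I\<close> at
  order \<open>n + 1\<close> is an Euler equation for the \<open>n\<close>-th coefficient of \<open>c\<close>, solvable after \<open>f (n + 1)\<close> has
  absorbed the Taylor polynomial of degree \<open>r - 2\<close>.\<close>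

lemma normal_form_gauge:
  assumes R: "R > 0" and \<phi>: "hol_fps (ball 0 R) \<phi>" "\<And>x. x \<in> ball 0 R \<Longrightarrow> fps_nth (\<phi> x) 0 = x ^ r"
  obtains f T where "\<And>k. degree (f k) \<le> r - 2" "\<And>k. r \<le> 1 \<Longrightarrow> f k = 0"
    "formal_iso_over (\<lambda>t. t) T (normal_form \<phi>)
      (normal_form (\<lambda>x. fps_const (x ^ r) + Abs_fps (\<lambda>k. if k \<ge> 1 then poly (f k) x else 0)))"
proof -
  let ?B = "ball (0::complex) R"
  \<comment> \<open>The sequence s stores at n the triple of the n-th coefficients of a and c and
    the polynomial f (n + 1). Hence F, the coefficients of the new normal form, reads its value at j
    + 1 from s j.\<close>
  define F :: "(nat \<Rightarrow> (complex \<Rightarrow> complex) \<times> (complex \<Rightarrow> complex) \<times> complex poly) \<Rightarrow> nat \<Rightarrow> complex \<Rightarrow> complex"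
    where "F s k x = (case k of 0 \<Rightarrow> x ^ r | Suc j \<Rightarrow> poly (snd (snd (s j))) x)" for s k x
  define a where "a s k = fst (s k)" for s :: "nat \<Rightarrow> (complex \<Rightarrow> complex) \<times> (complex \<Rightarrow> complex) \<times> complex poly" and k
  define c where "c s k = fst (snd (s k))" for s :: "nat \<Rightarrow> (complex \<Rightarrow> complex) \<times> (complex \<Rightarrow> complex) \<times> complex poly" and k
  define \<Delta> where "\<Delta> s k x = fps_nth (\<phi> x) k - F s k x" for s k x
  \<comment> \<open>The two equations are \<open>II\<close> at order n and \<open>I\<close> at order
    n + 1. The sums against \<Delta> start at 1 because old and new normal form agree at order
    0.\<close>
  define Q where "Q s n \<longleftrightarrow> a s n holomorphic_on ?B \<and> c s n holomorphic_on ?B \<and>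
     degree (snd (snd (s n))) \<le> r - 2 \<and> (r \<le> 1 \<longrightarrow> snd (snd (s n)) = 0) \<and> (n = 0 \<longrightarrow> a s n = (\<lambda>x. 1)) \<and>
     (\<forall>x\<in>?B. (\<Sum>j=1..n. \<Delta> s j x * c s (n - j) x) = 2 * deriv (a s n) x + (if n = 0 then 0 else deriv (deriv (c s (n - 1))) x)) \<and>
     (\<forall>x\<in>?B. (\<Sum>j=1..Suc n. \<Delta> s j x * a s (Suc n - j) x) = deriv (deriv (a s n)) x +
        (\<Sum>j=0..n. deriv (F s j) x * c s (n - j) x + 2 * F s j x * deriv (c s (n - j)) x))" for s n
  have Fcong: "F s k = F s' k" if "\<And>i. i < k \<Longrightarrow> s i = s' i" for s s' k
    using that by (cases k) (auto simp: F_def)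
  have Qcong: "Q s n = Q s' n" if eq: "\<And>k. k \<le> n \<Longrightarrow> s k = s' k" for s s' n
  proof -
    have a: "a s k = a s' k" and c: "c s k = c s' k" if "k \<le> n" for k using eq[OF that] by (auto simp: a_def c_def)
    have F: "F s k = F s' k" if "k \<le> Suc n" for k by (rule Fcong) (use eq that in auto)
    have D: "\<Delta> s k = \<Delta> s' k" if "k \<le> Suc n" for k using F[OF that] by (auto simp: \<Delta>_def fun_eq_iff)
    have a': "a s (Suc n - j) = a s' (Suc n - j)" if "Suc 0 \<le> j" for j by (rule a) (use that in arith)
    show ?thesis unfolding Q_def by (simp add: a a' c F D eq cong: sum.cong_simp)
  qed
  \<comment> \<open>Q s n also inspects s n itself. The update isolates that value as the candidate
    y, as the choice principle requires; with y = s n it has no effect.\<close>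
  have "\<exists>s. \<forall>n. Q (s(n := s n)) n"
  proof (rule recursive_choice)
    show "Q (s(n := y)) n = Q (s'(n := y)) n" if "\<And>k. k < n \<Longrightarrow> s k = s' k" for s s' n y
      by (rule Qcong) (use that in auto)
    show "\<exists>y. Q (s(n := y)) n" if IH': "\<And>k. k < n \<Longrightarrow> Q (s(k := s k)) k" for s n
    proof -
      have IH: "Q s k" if "k < n" for k using IH'[OF that] by simp
      have ah: "a s k holomorphic_on ?B" and ch: "c s k holomorphic_on ?B" if "k < n" for k
        using IH[OF that] by (auto simp: Q_def)
      have Fh: "F s k holomorphic_on ?B" for k
        unfolding F_def by (cases k) (auto intro!: holomorphic_intros)
      have Dh: "\<Delta> s k holomorphic_on ?B" for k
        unfolding \<Delta>_def by (intro holomorphic_intros Fh hol_fpsD[OF \<phi>(1)])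
      \<comment> \<open>At positive n equation \<open>II\<close> prescribes the derivative of the
        coefficient. At n = 0 it says that the coefficient is constant, and the value 1 makes the
        gauge invertible at z = 0.\<close>
      obtain an where an: "an holomorphic_on ?B" "n = 0 \<Longrightarrow> an = (\<lambda>x. 1)"
        "\<And>x. x \<in> ?B \<Longrightarrow> (\<Sum>j=1..n. \<Delta> s j x * c s (n - j) x) = 2 * deriv an x + (if n = 0 then 0 else deriv (deriv (c s (n - 1))) x)"
      proof (cases "n = 0")
        case True
        then show thesis by (intro that[of "\<lambda>x. 1"]) auto
      next
        case False
        have "(\<lambda>x. ((\<Sum>j=1..n. \<Delta> s j x * c s (n - j) x) - deriv (deriv (c s (n - 1))) x) / 2) holomorphic_on ?B"
          by (intro holomorphic_intros holomorphic_deriv Dh ch open_ball) (use False in auto)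
        then obtain g where g: "g holomorphic_on ?B" "\<And>x. x \<in> ?B \<Longrightarrow> (g has_field_derivative
             ((\<Sum>j=1..n. \<Delta> s j x * c s (n - j) x) - deriv (deriv (c s (n - 1))) x) / 2) (at x)"
          by (rule hol_primitive) (rule that)
        show thesis
          by (rule that[OF g(1)]) (use False DERIV_imp_deriv[OF g(2)] in \<open>auto simp: field_simps\<close>)
      qed
      define a' where "a' k = (if k = n then an else a s k)" for k
      have a'h: "a' k holomorphic_on ?B" if "k \<le> n" for k using an ah that by (auto simp: a'_def)
      have a'0: "a' 0 x = 1" for x
        using an(2) IH[of 0] by (cases "n = 0") (auto simp: a'_def Q_def)
      \<comment> \<open>Everything in \<open>I\<close> at order n + 1 that is already known. The new
        coefficient of c enters only through the leading term \<open>x\<^sup>r\<close>, as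
        \<open>r x\<^sup>r\<^sup>-\<^sup>1 c + 2 x\<^sup>r c'\<close>, and f (n + 1) enters with
        factor 1 because a has leading coefficient 1.\<close>
      define G where "G x = fps_nth (\<phi> x) (Suc n) + (\<Sum>j=1..n. \<Delta> s j x * a' (Suc n - j) x) - deriv (deriv an) x -
         (\<Sum>j=1..n. deriv (F s j) x * c s (n - j) x + 2 * F s j x * deriv (c s (n - j)) x)" for x
      have Gh: "G holomorphic_on ?B"
        unfolding G_def by (intro holomorphic_intros holomorphic_deriv Dh Fh ch a'h an hol_fpsD[OF \<phi>(1)] open_ball) auto
      obtain cn p where cp: "cn holomorphic_on ?B" "degree p \<le> r - 2" "r \<le> 1 \<Longrightarrow> p = 0"
        "\<And>x. x \<in> ?B \<Longrightarrow> of_nat r * x ^ (r - 1) * cn x + 2 * x ^ r * deriv cn x + poly p x = G x"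
        by (rule normalizing_ode[OF Gh R, where r = r]) (rule that)
      define s' where "s' = s(n := (an, cn, p))"
      have a: "a s' k = a' k" if "k \<le> n" for k using that by (auto simp: a_def a'_def s'_def)
      have ck: "c s' k = c s k" if "k < n" for k using that by (auto simp: c_def s'_def)
      have cn: "c s' n = cn" by (simp add: c_def s'_def)
      have F: "F s' k = F s k" if "k \<le> n" for k by (rule Fcong) (use that in \<open>auto simp: s'_def\<close>)
      have FSuc: "F s' (Suc n) x = poly p x" for x by (simp add: F_def s'_def)
      have D: "\<Delta> s' k = \<Delta> s k" if "k \<le> n" for k using F[OF that] by (auto simp: \<Delta>_def fun_eq_iff)
      have F0: "F s 0 = (\<lambda>x. x ^ r)" by (auto simp: F_def)
      have dF0: "deriv (F s 0) x = of_nat r * x ^ (r - 1)" for x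
        unfolding F0 by (rule DERIV_imp_deriv) (auto intro!: derivative_eq_intros)
      have "Q s' n"
        unfolding Q_def
      proof (intro conjI ballI impI)
        show "a s' n holomorphic_on ?B" using a[of n] a'h[of n] by simp
        show "c s' n holomorphic_on ?B" using cn cp by simp
        show "degree (snd (snd (s' n))) \<le> r - 2" "r \<le> 1 \<Longrightarrow> snd (snd (s' n)) = 0" using cp by (auto simp: s'_def)
        show "a s' n = (\<lambda>x. 1)" if "n = 0" using an(2)[OF that] by (simp add: a_def s'_def)
        fix x assume x: "x \<in> ?B"
        have "(\<Sum>j=1..n. \<Delta> s' j x * c s' (n - j) x) = (\<Sum>j=1..n. \<Delta> s j x * c s (n - j) x)"
          by (rule sum.cong) (auto simp: D ck)
        then show "(\<Sum>j=1..n. \<Delta> s' j x * c s' (n - j) x) =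
           2 * deriv (a s' n) x + (if n = 0 then 0 else deriv (deriv (c s' (n - 1))) x)"
          using an(3)[OF x] a[of n] ck[of "n - 1"] by (auto simp: a'_def)
        have "(\<Sum>j=1..Suc n. \<Delta> s' j x * a s' (Suc n - j) x) =
            (\<Sum>j=1..n. \<Delta> s' j x * a s' (Suc n - j) x) + \<Delta> s' (Suc n) x * a s' 0 x" by simp
        also have "(\<Sum>j=1..n. \<Delta> s' j x * a s' (Suc n - j) x) = (\<Sum>j=1..n. \<Delta> s j x * a' (Suc n - j) x)"
          by (rule sum.cong) (auto simp: D a)
        also have "\<Delta> s' (Suc n) x * a s' 0 x = fps_nth (\<phi> x) (Suc n) - poly p x"
          using a[of 0] a'0[of x] by (simp add: \<Delta>_def FSuc)
        also have "(\<Sum>j=1..n. \<Delta> s j x * a' (Suc n - j) x) + (fps_nth (\<phi> x) (Suc n) - poly p x) =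
           deriv (deriv an) x + ((of_nat r * x ^ (r - 1) * cn x + 2 * x ^ r * deriv cn x) +
           (\<Sum>j=1..n. deriv (F s j) x * c s (n - j) x + 2 * F s j x * deriv (c s (n - j)) x))"
          using cp(4)[OF x] by (simp add: G_def algebra_simps)
        also have "deriv (deriv an) x = deriv (deriv (a s' n)) x" using a[of n] by (simp add: a'_def)
        also have "of_nat r * x ^ (r - 1) * cn x + 2 * x ^ r * deriv cn x =
           deriv (F s' 0) x * c s' (n - 0) x + 2 * F s' 0 x * deriv (c s' (n - 0)) x"
          by (simp add: F dF0 cn) (simp add: F0)
        also have "(\<Sum>j=1..n. deriv (F s j) x * c s (n - j) x + 2 * F s j x * deriv (c s (n - j)) x) =
           (\<Sum>j=1..n. deriv (F s' j) x * c s' (n - j) x + 2 * F s' j x * deriv (c s' (n - j)) x)"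
          by (rule sum.cong) (auto simp: F ck)
        also have "deriv (F s' 0) x * c s' (n - 0) x + 2 * F s' 0 x * deriv (c s' (n - 0)) x + \<dots> =
           (\<Sum>j=0..n. deriv (F s' j) x * c s' (n - j) x + 2 * F s' j x * deriv (c s' (n - j)) x)"
          by (simp add: sum.atLeast_Suc_atMost)
        finally show "(\<Sum>j=1..Suc n. \<Delta> s' j x * a s' (Suc n - j) x) = deriv (deriv (a s' n)) x +
           (\<Sum>j=0..n. deriv (F s' j) x * c s' (n - j) x + 2 * F s' j x * deriv (c s' (n - j)) x)" .
      qed
      then show ?thesis unfolding s'_def by blast
    qed
  qed
  then obtain s where "\<And>n. Q (s(n := s n)) n" by blast
  then have Q: "Q s n" for n by simp
  define f where "f k = snd (snd (s (k - 1)))" for k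
  define \<phi>1 where "\<phi>1 x = fps_const (x ^ r) + Abs_fps (\<lambda>k. if k \<ge> 1 then poly (f k) x else 0)" for x
  have \<phi>1: "fps_nth (\<phi>1 x) k = F s k x" for x k
    by (cases k) (auto simp: \<phi>1_def F_def f_def)
  let ?a = "\<lambda>x. Abs_fps (\<lambda>n. a s n x)" and ?c = "\<lambda>x. Abs_fps (\<lambda>n. c s n x)"
  have ha: "hol_fps ?B ?a" and hc: "hol_fps ?B ?c" using Q by (auto simp: hol_fps_def Q_def)
  have "F s k holomorphic_on ?B" for k
    unfolding F_def by (cases k) (auto intro!: holomorphic_intros)
  then have h\<phi>1: "hol_fps ?B \<phi>1" unfolding hol_fps_def \<phi>1 by blast
  have D0: "\<Delta> s 0 x = 0" if "x \<in> ?B" for x using \<phi>(2)[OF that] by (simp add: \<Delta>_def F_def)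
  have D: "fps_nth (\<phi> x - \<phi>1 x) k = \<Delta> s k x" for x k by (simp add: \<Delta>_def \<phi>1)
  have dd: "fps_nth (fps_d (fps_d ?a) x) n = deriv (deriv (a s n)) x"
     "fps_nth (fps_d (fps_d ?c) x) n = deriv (deriv (c s n)) x"
     "fps_nth (fps_d ?a x) n = deriv (a s n) x" "fps_nth (fps_d ?c x) n = deriv (c s n) x"
     "fps_nth (fps_d \<phi>1 x) n = deriv (F s n) x" for x n
    by (simp_all add: \<phi>1)
  obtain T where "formal_iso_over (\<lambda>t. t) T (normal_form \<phi>) (normal_form \<phi>1)"
  proof (rule formal_iso_over_gauge[OF R ha _ hc h\<phi>1])
    show "fps_nth (Abs_fps (\<lambda>n. a s n x)) 0 \<noteq> 0" for x using Q[of 0] by (simp add: Q_def)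
    fix x assume x: "x \<in> ?B"
    show "(\<phi> x - \<phi>1 x) * ?a x = fps_X * (fps_d (fps_d ?a) x + fps_d \<phi>1 x * ?c x + 2 * \<phi>1 x * fps_d ?c x)"
    proof (rule fps_ext)
      fix n
      show "fps_nth ((\<phi> x - \<phi>1 x) * ?a x) n =
        fps_nth (fps_X * (fps_d (fps_d ?a) x + fps_d \<phi>1 x * ?c x + 2 * \<phi>1 x * fps_d ?c x)) n"
      proof (cases n)
        case 0
        then show ?thesis using D0[OF x] D[of x 0] by simp
      next
        case (Suc m)
        have "fps_nth ((\<phi> x - \<phi>1 x) * ?a x) n = (\<Sum>j=0..Suc m. \<Delta> s j x * a s (Suc m - j) x)"
          unfolding fps_mult_nth D Suc by simp
        also have "\<dots> = (\<Sum>j=1..Suc m. \<Delta> s j x * a s (Suc m - j) x)"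
          by (subst sum.atLeast_Suc_atMost) (auto simp: D0[OF x])
        also have "\<dots> = deriv (deriv (a s m)) x +
          (\<Sum>j=0..m. deriv (F s j) x * c s (m - j) x + 2 * F s j x * deriv (c s (m - j)) x)"
          using Q[of m] x unfolding Q_def by blast
        also have "\<dots> = fps_nth (fps_d (fps_d ?a) x + fps_d \<phi>1 x * ?c x + 2 * (\<phi>1 x * fps_d ?c x)) m"
          by (simp only: fps_add_nth fps_mult_nth[of "fps_d \<phi>1 x"] fps_mult_nth[of "\<phi>1 x"] fps_numeral_mult_nth dd \<phi>1
              fps_nth_Abs_fps sum.distrib sum_distrib_left mult.assoc add.assoc)
        finally show ?thesis unfolding Suc by (simp add: mult.assoc)
      qed
    qed
    show "(\<phi> x - \<phi>1 x) * ?c x = 2 * fps_d ?a x + fps_X * fps_d (fps_d ?c) x"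
    proof (rule fps_ext)
      fix n
      have "fps_nth ((\<phi> x - \<phi>1 x) * ?c x) n = (\<Sum>j=0..n. \<Delta> s j x * c s (n - j) x)"
        unfolding fps_mult_nth D by simp
      also have "\<dots> = (\<Sum>j=1..n. \<Delta> s j x * c s (n - j) x)"
        by (subst sum.atLeast_Suc_atMost) (auto simp: D0[OF x])
      also have "\<dots> = 2 * deriv (a s n) x + (if n = 0 then 0 else deriv (deriv (c s (n - 1))) x)"
        using Q[of n] x unfolding Q_def by blast
      also have "\<dots> = fps_nth (2 * fps_d ?a x + fps_X * fps_d (fps_d ?c) x) n"
        by (cases n) (simp_all add: fps_numeral_mult_nth)
      finally show "fps_nth ((\<phi> x - \<phi>1 x) * ?c x) n = fps_nth (2 * fps_d ?a x + fps_X * fps_d (fps_d ?c) x) n" .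
    qed
  qed (rule that)
  then show ?thesis
    by (intro that[of f T]) (use Q in \<open>auto simp: f_def Q_def \<phi>1_def[abs_def]\<close>)
qed

lemma second_primitive:
  assumes "f holomorphic_on ball 0 R"
  obtains g where "g holomorphic_on ball 0 R" "\<And>x. x \<in> ball 0 R \<Longrightarrow> deriv (deriv g) x = f x"
proof -
  obtain h where h: "h holomorphic_on ball 0 R" "\<And>x. x \<in> ball 0 R \<Longrightarrow> (h has_field_derivative f x) (at x)"
    by (rule hol_primitive[OF assms]) (rule that)
  obtain g where g: "g holomorphic_on ball 0 R" "\<And>x. x \<in> ball 0 R \<Longrightarrow> (g has_field_derivative h x) (at x)"
    by (rule hol_primitive[OF h(1)]) (rule that)
  have "deriv (deriv g) x = f x" if x: "x \<in> ball 0 R" for x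
  proof -
    have "deriv (deriv g) x = deriv h x"
      using x DERIV_imp_deriv[OF g(2)]
      by (intro deriv_cong_ev) (auto simp: eventually_nhds intro!: exI[of _ "ball 0 R"])
    then show ?thesis using DERIV_imp_deriv[OF h(2)[OF x]] by simp
  qed
  with g(1) show ?thesis by (rule that)
qed

text \<open>The factor z makes the right-hand side at each positive order depend on lower orders
  only, so two primitives suffice and no disc shrinks. The order 0 solution is prescribed from
  outside.\<close>

lemma second_order_ode_fps:
  assumes g: "hol_fps (ball 0 R) g" and h: "hol_fps (ball 0 R) h"
    and u0: "u0 holomorphic_on ball 0 R" "\<And>x. x \<in> ball 0 R \<Longrightarrow> deriv (deriv u0) x = fps_nth (h x) 0"
  obtains u where "hol_fps (ball 0 R) u" "\<And>x. fps_nth (u x) 0 = u0 x"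
    "\<And>x. x \<in> ball 0 R \<Longrightarrow> fps_d (fps_d u) x = fps_X * (u x * g x) + h x"
proof -
  define P where "P s n u \<longleftrightarrow> u holomorphic_on ball 0 R \<and> (n = 0 \<longrightarrow> u = u0) \<and>
     (\<forall>m. n = Suc m \<longrightarrow> (\<forall>x\<in>ball 0 R. deriv (deriv u) x =
        (\<Sum>i<n. s i x * fps_nth (g x) (m - i)) + fps_nth (h x) n))"
    for s :: "nat \<Rightarrow> complex \<Rightarrow> complex" and n :: nat and u
  have "\<exists>s. \<forall>n. P s n (s n)"
  proof (rule recursive_choice)
    show "P s n u = P s' n u" if "\<And>k. k < n \<Longrightarrow> s k = s' k" for s s' n u
      using that by (simp add: P_def)
    show "\<exists>u. P s n u" if IH: "\<And>k. k < n \<Longrightarrow> P s k (s k)" for s n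
    proof (cases n)
      case 0
      then show ?thesis using u0 by (auto simp: P_def)
    next
      case (Suc m)
      have "(\<lambda>x. (\<Sum>i<n. s i x * fps_nth (g x) (m - i)) + fps_nth (h x) n) holomorphic_on ball 0 R"
        by (intro holomorphic_intros hol_fpsD[OF g] hol_fpsD[OF h]) (use IH in \<open>auto simp: P_def\<close>)
      then obtain u where "u holomorphic_on ball 0 R" "\<And>x. x \<in> ball 0 R \<Longrightarrow> deriv (deriv u) x =
          (\<Sum>i<n. s i x * fps_nth (g x) (m - i)) + fps_nth (h x) n"
        by (rule second_primitive) (rule that)
      then show ?thesis using Suc unfolding P_def by (intro exI[of _ u]) simp
    qed
  qed
  then obtain s where s: "\<And>n. P s n (s n)" by blast
  show ?thesis
  proof (rule that[of "\<lambda>x. Abs_fps (\<lambda>n. s n x)"])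
    show "hol_fps (ball 0 R) (\<lambda>x. Abs_fps (\<lambda>n. s n x))"
      using s by (auto simp: hol_fps_def P_def)
    show "fps_nth (Abs_fps (\<lambda>n. s n x)) 0 = u0 x" for x
      using s[of 0] by (simp add: P_def)
    show "fps_d (fps_d (\<lambda>x. Abs_fps (\<lambda>n. s n x))) x = fps_X * (Abs_fps (\<lambda>n. s n x) * g x) + h x"
      if x: "x \<in> ball 0 R" for x
    proof (rule fps_ext)
      fix n
      show "fps_nth (fps_d (fps_d (\<lambda>x. Abs_fps (\<lambda>n. s n x))) x) n =
        fps_nth (fps_X * (Abs_fps (\<lambda>n. s n x) * g x) + h x) n"
      proof (cases n)
        case 0
        then show ?thesis using s[of 0] u0(2)[OF x] by (simp add: P_def)
      next
        case (Suc m)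
        have "deriv (deriv (s n)) x = (\<Sum>i<n. s i x * fps_nth (g x) (m - i)) + fps_nth (h x) n"
          using s[of n] x Suc unfolding P_def by blast
        then show ?thesis using Suc
          by (simp add: fps_mult_nth[of "Abs_fps (\<lambda>n. s n x)"] atLeast0AtMost lessThan_Suc_atMost)
      qed
    qed
  qed
qed

text \<open>Write \<phi> as \<open>z\<^sup>2 g\<close>. With target 0, equation \<open>I\<close>
  becomes \<open>a'' = z g a\<close>. Starting a with the constant 1 makes a' divisible by z, say
  \<open>2 a' = - z h\<close>, and after cancelling z equation \<open>II\<close> becomes
  \<open>c'' = z g c + h\<close>.\<close>

lemma normal_form_gauge_zero:
  assumes R: "R > 0" and \<phi>: "hol_fps (ball 0 R) \<phi>"
    and 0: "\<And>x. x \<in> ball 0 R \<Longrightarrow> fps_nth (\<phi> x) 0 = 0" and 1: "\<And>x. x \<in> ball 0 R \<Longrightarrow> fps_nth (\<phi> x) 1 = 0"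
  obtains T where "formal_iso_over (\<lambda>t. t) T (normal_form \<phi>) (normal_form (\<lambda>x. 0))"
proof -
  let ?B = "ball (0::complex) R"
  have g: "hol_fps ?B (\<lambda>x. fps_shift 2 (\<phi> x))" by (intro hol_fps_intros \<phi>)
  have \<phi>g: "\<phi> x = fps_X * (fps_X * fps_shift 2 (\<phi> x))" if x: "x \<in> ?B" for x
  proof (rule fps_ext)
    fix n
    consider "n = 0" | "n = 1" | m where "n = Suc (Suc m)" by (metis One_nat_def not0_implies_Suc)
    then show "fps_nth (\<phi> x) n = fps_nth (fps_X * (fps_X * fps_shift 2 (\<phi> x))) n"
      using 0[OF x] 1[OF x] by cases auto
  qed
  have 2: "deriv (deriv (\<lambda>x. 1)) x = fps_nth (0 :: complex fps) 0" for x :: complex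
  proof -
    have "deriv (\<lambda>x. 1 :: complex) = (\<lambda>x. 0)" by (rule ext) simp
    then show ?thesis by simp
  qed
  obtain a where a: "hol_fps ?B a" "\<And>x. fps_nth (a x) 0 = 1"
    "\<And>x. x \<in> ?B \<Longrightarrow> fps_d (fps_d a) x = fps_X * (a x * fps_shift 2 (\<phi> x)) + 0"
    by (rule second_order_ode_fps[OF g hol_fps_const[of _ 0] holomorphic_on_const 2]) (rule that)
  define h where "h x = - 2 * fps_shift 1 (fps_d a x)" for x
  have h: "hol_fps ?B h" unfolding h_def[abs_def] by (intro hol_fps_intros a open_ball)
  have ha: "2 * fps_d a x = - (fps_X * h x)" for x
  proof -
    have "fps_d a x = fps_X * fps_shift 1 (fps_d a x)"
      using fps_eq_const_plus_shift[of "fps_d a x"] a(2) by simp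
    then have "2 * fps_d a x = 2 * (fps_X * fps_shift 1 (fps_d a x))" by simp
    then show ?thesis by (simp add: h_def)
  qed
  obtain u0 where u0: "u0 holomorphic_on ?B" "\<And>x. x \<in> ?B \<Longrightarrow> deriv (deriv u0) x = fps_nth (h x) 0"
    by (rule second_primitive[OF hol_fpsD[OF h, of 0]]) (rule that)
  obtain c where c: "hol_fps ?B c" "\<And>x. x \<in> ?B \<Longrightarrow> fps_d (fps_d c) x = fps_X * (c x * fps_shift 2 (\<phi> x)) + h x"
    by (rule second_order_ode_fps[OF g h u0]) (assumption, rule that)
  show ?thesis
  proof (rule formal_iso_over_gauge[OF R a(1) _ c(1) hol_fps_const[of _ 0]])
    show "fps_nth (a x) 0 \<noteq> 0" for x using a(2) by simp
    fix x assume x: "x \<in> ?B"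
    have "\<phi> x * a x = fps_X * (fps_X * (a x * fps_shift 2 (\<phi> x)))" by (subst \<phi>g[OF x]) (simp add: mult_ac)
    then show "(\<phi> x - 0) * a x = fps_X * (fps_d (fps_d a) x + fps_d (\<lambda>x. 0) x * c x + 2 * 0 * fps_d c x)"
      by (simp add: a(3)[OF x])
    have "\<phi> x * c x = fps_X * (fps_X * (c x * fps_shift 2 (\<phi> x)))" by (subst \<phi>g[OF x]) (simp add: mult_ac)
    then show "(\<phi> x - 0) * c x = 2 * fps_d a x + fps_X * fps_d (fps_d c) x"
      by (simp add: ha c(2)[OF x] algebra_simps)
  qed (rule that)
qed

text \<open>On a disc of small radius \<open>\<rho>\<close> the recursion for the Taylor coefficients gives \<open>\<bar>b\<^sub>n\<bar> \<rho>\<^sup>n \<le> 1\<close>.\<close>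

lemma second_order_ode:
  assumes g: "g holomorphic_on ball 0 R" and R: "R > 0"
  obtains \<rho> v where "0 < \<rho>" "\<rho> \<le> R" "v holomorphic_on ball 0 \<rho>" "\<And>x. x \<in> ball 0 \<rho> \<Longrightarrow> v x \<noteq> 0"
    "\<And>x. x \<in> ball 0 \<rho> \<Longrightarrow> deriv (deriv v) x = g x * v x"
proof -
  define G where "G = fps_expansion g 0"
  have "g holomorphic_on eball 0 (ereal R)" using g by simp
  note G = conv_radius_fps_expansion[OF this] eval_fps_expansion'[OF this]
  have rad: "ereal R \<le> fps_conv_radius G" using G(1) by (simp add: G_def)
  have "ereal (norm (of_real (R / 2) :: complex)) < ereal R" using R by simp
  also note rad
  finally have "summable (\<lambda>n. fps_nth G n * of_real (R / 2) ^ n)" by (rule summable_fps)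
  then have "bounded (range (\<lambda>n. fps_nth G n * of_real (R / 2) ^ n))" by (rule summable_imp_bounded)
  then obtain K0 where "\<And>n. norm (fps_nth G n * of_real (R / 2) ^ n) \<le> K0" unfolding bounded_iff by auto
  then obtain K where K: "K \<ge> 0" "\<And>n. norm (fps_nth G n) * (R / 2) ^ n \<le> K"
    using R norm_ge_zero order_trans by (metis (no_types, lifting) norm_mult norm_power norm_of_real abs_of_pos half_gt_zero)
  \<comment> \<open>K bounds the Taylor coefficients of g scaled by powers of R/2. The choice gives
    \<rho> \<le> 1 and \<rho> K \<le> 1, hence \<open>\<rho>\<^sup>2 K \<le> 1\<close>, which is
    what the induction consumes.\<close>
  define \<rho> where "\<rho> = min (R / 2) (1 / (K + 1))"
  have \<rho>: "\<rho> > 0" "\<rho> \<le> R / 2" "\<rho> \<le> 1 / (K + 1)" using R K by (auto simp: \<rho>_def)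
  have "1 / (K + 1) \<le> 1" "1 / (K + 1) * K \<le> 1" using K(1) by (auto simp: field_simps)
  then have \<rho>1: "\<rho> \<le> 1" and "\<rho> * K \<le> 1"
    using \<rho> K(1) mult_right_mono[of \<rho> "1 / (K + 1)" K] by linarith+
  then have \<rho>K: "\<rho> ^ 2 * K \<le> 1"
    using \<rho>(1) mult_le_one[of \<rho> "\<rho> * K"] K(1) by (simp add: power2_eq_square mult.assoc)
  have GK: "norm (fps_nth G n) * \<rho> ^ n \<le> K" for n
    using K(2)[of n] mult_left_mono[OF power_mono[OF \<rho>(2), of n], of "norm (fps_nth G n)"] \<rho>(1)
    by (meson order_trans norm_ge_zero less_imp_le)
  \<comment> \<open>The recursion for the coefficients of a power series solution of
    \<open>v'' = g v\<close> with v(0) = 1 and v'(0) = 0; the value 1 later keeps v away from zero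
    near the origin.\<close>
  define P where "P s n y \<longleftrightarrow> (n = 0 \<longrightarrow> y = 1) \<and> (n = 1 \<longrightarrow> y = 0) \<and>
    (\<forall>m. n = m + 2 \<longrightarrow> of_nat (m + 2) * of_nat (m + 1) * y = (\<Sum>i\<le>m. s i * fps_nth G (m - i)))"
    for s :: "nat \<Rightarrow> complex" and n and y
  have "\<exists>b. \<forall>n. P b n (b n)"
  proof (rule recursive_choice)
    show "P s n y = P s' n y" if "\<And>k. k < n \<Longrightarrow> s k = s' k" for s s' n y
      using that by (simp add: P_def)
    show "\<exists>y. P s n y" for s n
    proof -
      consider "n = 0" | "n = 1" | m where "n = m + 2"
        by (metis One_nat_def not0_implies_Suc add_2_eq_Suc')
      then show ?thesis
      proof cases
        case (3 m)
        have "of_nat (m + 2) * of_nat (m + 1) \<noteq> (0::complex)"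
          by (simp only: of_nat_eq_0_iff mult_eq_0_iff) simp
        then show ?thesis using 3 unfolding P_def
          by (intro exI[of _ "(\<Sum>i\<le>m. s i * fps_nth G (m - i)) / (of_nat (m + 2) * of_nat (m + 1))"]) auto
      qed (auto simp: P_def)
    qed
  qed
  then obtain b where b: "\<And>n. P b n (b n)" by blast
  have b0: "b 0 = 1" "b 1 = 0" using b[of 0] b[of 1] by (auto simp: P_def)
  have brec: "of_nat (m + 2) * of_nat (m + 1) * b (m + 2) = (\<Sum>i\<le>m. b i * fps_nth G (m - i))" for m
    using b[of "m + 2"] by (simp add: P_def)
  have bnd: "norm (b n) * \<rho> ^ n \<le> 1" for n
  proof (induction n rule: less_induct)
    case (less n)
    consider "n = 0" | "n = 1" | m where "n = m + 2"
      by (metis One_nat_def not0_implies_Suc add_2_eq_Suc')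
    then show ?case
    proof cases
      case (3 m)
      \<comment> \<open>In the recursion \<open>\<rho>\<^sup>n\<close> is split as
        \<open>\<rho>\<^sup>2 \<rho>\<^sup>i \<rho>\<^sup>m\<^sup>-\<^sup>i\<close>. Each of the m +
        1 summands is then at most \<open>\<rho>\<^sup>2 K \<le> 1\<close>, and the factor (m + 2)(m
        + 1) on the left more than compensates their number.\<close>
      have "real (m + 2) * real (m + 1) * norm (b n) * \<rho> ^ n = norm (\<Sum>i\<le>m. b i * fps_nth G (m - i)) * \<rho> ^ n"
        unfolding brec[symmetric] 3 by (simp only: norm_mult norm_of_nat)
      also have "\<dots> \<le> (\<Sum>i\<le>m. norm (b i * fps_nth G (m - i))) * \<rho> ^ n"
        using \<rho>(1) by (intro mult_right_mono norm_sum) auto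
      also have "\<dots> = (\<Sum>i\<le>m. \<rho> ^ 2 * ((norm (b i) * \<rho> ^ i) * (norm (fps_nth G (m - i)) * \<rho> ^ (m - i))))"
        unfolding sum_distrib_right
      proof (intro sum.cong refl)
        fix i assume "i \<in> {..m}"
        then have "\<rho> ^ n = \<rho> ^ 2 * (\<rho> ^ i * \<rho> ^ (m - i))"
          using 3 by (simp flip: power_add) 
        then show "norm (b i * fps_nth G (m - i)) * \<rho> ^ n =
            \<rho> ^ 2 * ((norm (b i) * \<rho> ^ i) * (norm (fps_nth G (m - i)) * \<rho> ^ (m - i)))"
          by (simp add: norm_mult mult_ac)
      qed
      also have "\<dots> \<le> (\<Sum>i\<le>m. 1)"
      proof (intro sum_mono)
        fix i assume "i \<in> {..m}"
        then have "norm (b i) * \<rho> ^ i \<le> 1" using less 3 by auto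
        then have "(norm (b i) * \<rho> ^ i) * (norm (fps_nth G (m - i)) * \<rho> ^ (m - i)) \<le> 1 * K"
          using GK[of "m - i"] \<rho>(1) K(1) by (intro mult_mono) auto
        then have "\<rho> ^ 2 * ((norm (b i) * \<rho> ^ i) * (norm (fps_nth G (m - i)) * \<rho> ^ (m - i))) \<le> \<rho> ^ 2 * K"
          by (intro mult_left_mono) auto
        with \<rho>K show "\<rho> ^ 2 * ((norm (b i) * \<rho> ^ i) * (norm (fps_nth G (m - i)) * \<rho> ^ (m - i))) \<le> 1" by linarith
      qed
      also have "\<dots> = real (m + 1)" by simp
      finally have "real (m + 1) * (real (m + 2) * (norm (b n) * \<rho> ^ n)) \<le> real (m + 1) * 1" by (simp add: mult_ac)
      then have "real (m + 2) * (norm (b n) * \<rho> ^ n) \<le> 1" by (rule mult_left_le_imp_le) simp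
      moreover have "1 * (norm (b n) * \<rho> ^ n) \<le> real (m + 2) * (norm (b n) * \<rho> ^ n)"
        using \<rho>(1) by (intro mult_right_mono) auto
      ultimately show ?thesis by linarith
    qed (use b0 in auto)
  qed
  define B where "B = Abs_fps b"
  have radB: "fps_conv_radius B \<ge> ereal \<rho>"
    unfolding fps_conv_radius_def
  proof (rule conv_radius_geI_ex)
    fix r' :: real assume r': "r' > 0" "ereal r' < ereal \<rho>"
    have "summable (\<lambda>n. fps_nth B n * of_real r' ^ n)"
    proof (rule summable_comparison_test'[of "\<lambda>n. (r' / \<rho>) ^ n" 0])
      show "summable (\<lambda>n. (r' / \<rho>) ^ n)" using r' by (intro summable_geometric) auto
      fix n
      have "norm (fps_nth B n * of_real r' ^ n) = (norm (b n) * \<rho> ^ n) * (r' / \<rho>) ^ n"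
        using r' \<rho>(1) by (simp add: B_def norm_mult norm_power power_divide)
      also have "\<dots> \<le> 1 * (r' / \<rho>) ^ n" using r' \<rho>(1) by (intro mult_right_mono bnd) auto
      finally show "norm (fps_nth B n * of_real r' ^ n) \<le> (r' / \<rho>) ^ n" by simp
    qed
    then show "\<exists>z::complex. norm z = r' \<and> summable (\<lambda>n. fps_nth B n * z ^ n)"
      using r' by (intro exI[of _ "of_real r'"]) auto
  qed
  have BG: "fps_deriv (fps_deriv B) = B * G"
  proof (rule fps_ext)
    fix m
    have "fps_nth (fps_deriv (fps_deriv B)) m = of_nat (m + 2) * of_nat (m + 1) * b (m + 2)"
      by (simp add: B_def mult_ac)
    then show "fps_nth (fps_deriv (fps_deriv B)) m = fps_nth (B * G) m"
      by (simp only: brec) (simp add: B_def fps_mult_nth atLeast0AtMost)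
  qed
  have lt: "ereal (norm x) < fps_conv_radius B" if "x \<in> ball 0 \<rho>" for x :: complex
    using that radB less_le_trans[of "ereal (norm x)" "ereal \<rho>"] by simp
  have lt': "ereal (norm x) < fps_conv_radius (fps_deriv B)" if "x \<in> ball 0 \<rho>" for x :: complex
    using lt[OF that] fps_conv_radius_deriv[of B] less_le_trans by blast
  have ltR: "ereal (norm x) < ereal R" if "x \<in> ball 0 \<rho>" for x :: complex
    using that \<rho> R by simp
  define v where "v = eval_fps B"
  have v: "v holomorphic_on ball 0 \<rho>"
    by (rule holomorphic_onI_DERIV) (auto simp: v_def intro!: has_field_derivative_eval_fps lt)
  have dv: "deriv v x = eval_fps (fps_deriv B) x" if "x \<in> ball 0 \<rho>" for x
    unfolding v_def by (rule eval_fps_deriv[symmetric, OF lt[OF that]])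
  have ddv: "deriv (deriv v) x = g x * v x" if x: "x \<in> ball 0 \<rho>" for x
  proof -
    have "deriv (deriv v) x = deriv (eval_fps (fps_deriv B)) x"
      by (rule deriv_cong_ev) (use x dv in \<open>auto simp: eventually_nhds intro!: exI[of _ "ball 0 \<rho>"]\<close>)
    also have "\<dots> = eval_fps (fps_deriv (fps_deriv B)) x"
      by (rule eval_fps_deriv[symmetric, OF lt'[OF x]])
    also have "\<dots> = eval_fps B x * eval_fps G x"
      unfolding BG by (rule eval_fps_mult[OF lt[OF x]]) (use ltR[OF x] rad less_le_trans in blast)
    also have "eval_fps G x = g x"
      using G(2)[OF ltR[OF x]] by (simp add: G_def)
    finally show ?thesis by (simp add: v_def mult.commute)
  qed
  have "v 0 \<noteq> 0" by (simp add: v_def eval_fps_at_0 B_def b0)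
  then obtain \<sigma> where \<sigma>: "0 < \<sigma>" "\<sigma> \<le> \<rho>" "\<And>x. x \<in> ball 0 \<sigma> \<Longrightarrow> v x \<noteq> 0"
    by (rule holomorphic_nonzero_ball[OF v \<rho>(1)]) (rule that)
  have sub: "ball 0 \<sigma> \<subseteq> ball (0::complex) \<rho>" using \<sigma> by auto
  show ?thesis
    by (rule that[OF \<sigma>(1) _ holomorphic_on_subset[OF v sub] \<sigma>(3) ddv]) (use \<sigma> \<rho> R sub in auto)
qed

section \<open>Existence\<close>

lemma normal_form_nth_formal:
  assumes "hol_fps (ball 0 R) \<phi>"
  shows "formal_on (bidisc R) (\<lambda>t. normal_form \<phi> i t $ j $ k)"
proof -
  have "hol_fps (ball 0 R) (\<lambda>x. fps_X * \<phi> x)" by (intro hol_fps_intros assms)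
  from formal_on_hol_fps[OF this] show ?thesis
    unfolding normal_form_eq using exhaust_2[of i] exhaust_2[of j] exhaust_2[of k] by auto
qed

lemma normal_form_flat:
  assumes \<phi>: "hol_fps (ball 0 R) \<phi>" and R: "R > 0"
  shows "flat (normal_form \<phi>)"
  unfolding flat_def
proof (rule eventually_nhds_bidiscI[OF R])
  fix t assume t: "t \<in> bidisc R"
  have h: "hol_fps (ball 0 R) (\<lambda>x. fps_X * \<phi> x)" by (intro hol_fps_intros \<phi>)
  have "partial_mat 1 (normal_form \<phi> 2) t $ j $ k = 0" for j k
    using exhaust_2[of j] exhaust_2[of k] fps_partial_hol_fps[OF h t, of 1]
    by (auto simp: partial_mat_nth normal_form_eq)
  moreover have "partial_mat 2 (normal_form \<phi> 1) t $ j $ k = 0" for j k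
    by (simp add: partial_mat_nth normal_form_eq)
  moreover have "normal_form \<phi> 1 t ** normal_form \<phi> 2 t - normal_form \<phi> 2 t ** normal_form \<phi> 1 t = 0"
    by (simp add: normal_form_eq C1_def)
  ultimately show "smat fps_X (partial_mat 1 (normal_form \<phi> 2) t) - smat fps_X (partial_mat 2 (normal_form \<phi> 1) t) +
     (normal_form \<phi> 1 t ** normal_form \<phi> 2 t - normal_form \<phi> 2 t ** normal_form \<phi> 1 t) = 0"
    by (simp add: vec_eq_iff)
qed

text \<open>Every matrix entry of forms (a), (b), (c) is of this shape. In the witness function the
  components 1 and 3 are z and \<open>t\<^sub>2\<close>.\<close>

lemma convergent_series_linear:
  "convergent_series (\<lambda>t. fps_const \<alpha> + fps_X * fps_const (\<beta> + \<gamma> * t $ 2))"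
  unfolding convergent_series_def
proof (intro conjI exI[of _ UNIV] exI[of _ "\<lambda>w. \<alpha> + w $ 1 * (\<beta> + \<gamma> * w $ 3)"])
  show "formal_series (\<lambda>t. fps_const \<alpha> + fps_X * fps_const (\<beta> + \<gamma> * t $ 2))"
    by (rule formal_seriesI[of 1], simp)
       (intro formal_intros formal_on_fps_const mv_holomorphic_intros)
  show "mv_holomorphic_on (\<lambda>w::complex^3. \<alpha> + w $ 1 * (\<beta> + \<gamma> * w $ 3)) UNIV"
    unfolding mv_holomorphic_on_def
  proof (intro ballI exI conjI allI)
    fix w :: "complex^3"
    have d: "((\<lambda>w. w $ i) has_derivative (\<lambda>v. v $ i)) (at w)" for i
      by (intro bounded_linear_imp_has_derivative bounded_linear_vec_nth)
    show "((\<lambda>w. \<alpha> + w $ 1 * (\<beta> + \<gamma> * w $ 3)) has_derivative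
        (\<lambda>v. w $ 1 * (\<gamma> * v $ 3) + v $ 1 * (\<beta> + \<gamma> * w $ 3))) (at w)"
      by (rule derivative_eq_intros d refl | simp)+
    show "w $ 1 * (\<gamma> * (c *s v) $ 3) + (c *s v) $ 1 * (\<beta> + \<gamma> * w $ 3) =
        c * (w $ 1 * (\<gamma> * v $ 3) + v $ 1 * (\<beta> + \<gamma> * w $ 3))" for c v
      by (simp add: algebra_simps)
  qed
  show "\<forall>z (t :: complex^2). vector [z, t $ 1, t $ 2] \<in> (UNIV :: (complex^3) set) \<longrightarrow>
     (\<lambda>n. fps_nth (fps_const \<alpha> + fps_X * fps_const (\<beta> + \<gamma> * t $ 2)) n * z ^ n) sums
       (\<alpha> + (vector [z, t $ 1, t $ 2] :: complex^3) $ 1 * (\<beta> + \<gamma> * (vector [z, t $ 1, t $ 2] :: complex^3) $ 3))"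
  proof (intro allI impI)
    fix z :: complex and t :: "complex^2"
    let ?f = "\<lambda>n. fps_nth (fps_const \<alpha> + fps_X * fps_const (\<beta> + \<gamma> * t $ 2)) n * z ^ n"
    have "?f n = 0" if "n \<notin> {0, 1}" for n
      using that by (cases n) auto
    then have "?f sums (\<Sum>n\<in>{0, 1}. ?f n)" by (intro sums_finite) auto
    then show "?f sums (\<alpha> + (vector [z, t $ 1, t $ 2] :: complex^3) $ 1 * (\<beta> + \<gamma> * (vector [z, t $ 1, t $ 2] :: complex^3) $ 3))"
      by (simp add: mult_ac)
  qed
qed simp_all

lemma T_structure_linear_normal_form:
  "T_structure (normal_form (\<lambda>x. fps_const (\<beta> + \<gamma> * x)))"
  unfolding T_structure_def
proof (intro conjI allI)
  have h: "hol_fps (ball 0 1) (\<lambda>x. fps_const (\<beta> + \<gamma> * x))"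
    by (intro hol_fps_fps_const holomorphic_intros)
  show "flat (normal_form (\<lambda>x. fps_const (\<beta> + \<gamma> * x)))"
    by (rule normal_form_flat[OF h]) simp
  fix i j k
  show "convergent_series (\<lambda>t. normal_form (\<lambda>x. fps_const (\<beta> + \<gamma> * x)) i t $ j $ k)"
    using exhaust_2[of i] exhaust_2[of j] exhaust_2[of k]
      convergent_series_linear[of 0 0 0] convergent_series_linear[of 1 0 0] convergent_series_linear[of 0 \<beta> \<gamma>]
    by (auto simp: normal_form_eq C1_def mat_def)
qed

lemma T_structure_forms_abc: "B \<in> forms_abc \<Longrightarrow> T_structure B"
  using T_structure_linear_normal_form[of 1 0] T_structure_linear_normal_form[of 0 1]
    T_structure_linear_normal_form[of 0 0]
  by (auto simp: forms_abc_def form_a_def form_b_def form_c_def)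

lemma hol_fps_form_d:
  "hol_fps S (\<lambda>x. fps_const (x ^ r) + Abs_fps (\<lambda>k. if k \<ge> 1 then poly (f k) x else 0))"
proof -
  have "(\<lambda>x. if 1 \<le> n then poly (f n) x else 0) holomorphic_on S" for n
    by (cases "1 \<le> n") (auto intro!: holomorphic_intros)
  then have "hol_fps S (\<lambda>x. Abs_fps (\<lambda>k. if k \<ge> 1 then poly (f k) x else 0))"
    by (simp add: hol_fps_def)
  then show ?thesis by (intro hol_fps_add hol_fps_fps_const holomorphic_intros)
qed

lemma formal_T_structure_forms_d: "B \<in> forms_d \<Longrightarrow> formal_T_structure B"
  unfolding forms_d_def form_d_def formal_T_structure_def
  using formal_seriesI[OF zero_less_one normal_form_nth_formal[OF hol_fps_form_d]]
    normal_form_flat[OF hol_fps_form_d zero_less_one] by auto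

lemma normal_form_gauge_to_list:
  assumes R: "R > 0" and \<phi>: "hol_fps (ball 0 R) \<phi>" "\<And>x. x \<in> ball 0 R \<Longrightarrow> fps_nth (\<phi> x) 0 = x ^ r"
  obtains B T where "B \<in> forms_abc \<union> forms_d" "formal_iso_over (\<lambda>t. t) T (normal_form \<phi>) B"
proof -
  obtain f T where f: "\<And>k. degree (f k) \<le> r - 2" "\<And>k. r \<le> 1 \<Longrightarrow> f k = 0"
    and T: "formal_iso_over (\<lambda>t. t) T (normal_form \<phi>)
      (normal_form (\<lambda>x. fps_const (x ^ r) + Abs_fps (\<lambda>k. if k \<ge> 1 then poly (f k) x else 0)))"
    by (rule normal_form_gauge[OF R \<phi>]) (assumption, rule that)
  have z: "Abs_fps (\<lambda>k. if k \<ge> 1 then poly (f k) x else 0) = 0" if "r \<le> 1" for x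
    using f(2)[OF that] by (simp add: fps_eq_iff)
  consider "r = 0" | "r = 1" | "r \<ge> 2" by linarith
  then show ?thesis
  proof cases
    case 1
    with T z show ?thesis by (intro that[of form_a T]) (auto simp: forms_abc_def form_a_def)
  next
    case 2
    with T z show ?thesis by (intro that[of form_b T]) (auto simp: forms_abc_def form_b_def)
  next
    case 3
    then have "form_d r f \<in> forms_d" using f(1) by (auto simp: forms_d_def d_data_def)
    with T show ?thesis by (intro that[of "form_d r f" T]) (auto simp: form_d_def)
  qed
qed

text \<open>The split is on the vanishing order of \<phi>(0). For finite order n the normalizing
  coordinate turns the leading term into \<open>x\<^sup>n\<close>, and a gauge does the rest. If
  \<phi>(0) vanishes identically, the coordinate built from a solution of
  \<open>v'' = \<phi>(1) v\<close> cancels the coefficient of z, and the gauge to 0 gives form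
  (c).\<close>

lemma normal_form_to_list:
  assumes R: "R > 0" and \<phi>: "hol_fps (ball 0 R) \<phi>"
  obtains B h T where "B \<in> forms_abc \<union> forms_d" "biholomorphic_germ h" "hol_map h" "formal_iso_over h T (normal_form \<phi>) B"
proof (rule holomorphic_order_cases[OF hol_fpsD[OF \<phi>, of 0] R])
  assume zero: "\<And>x. x \<in> ball 0 R \<Longrightarrow> fps_nth (\<phi> x) 0 = 0"
  obtain \<rho> v where \<rho>: "0 < \<rho>" "\<rho> \<le> R" and v: "v holomorphic_on ball 0 \<rho>" "\<And>x. x \<in> ball 0 \<rho> \<Longrightarrow> v x \<noteq> 0"
    "\<And>x. x \<in> ball 0 \<rho> \<Longrightarrow> deriv (deriv v) x = fps_nth (\<phi> x) 1 * v x"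
    by (rule second_order_ode[OF hol_fpsD[OF \<phi>, of 1] R]) (rule that)
  have sub: "x \<in> ball 0 R" if "x \<in> ball 0 \<rho>" for x :: complex using that \<rho> by auto
  have "(\<lambda>x. inverse (v x ^ 2)) holomorphic_on ball 0 \<rho>"
    using v by (intro holomorphic_intros) auto
  then obtain l where l: "\<And>x. x \<in> ball 0 \<rho> \<Longrightarrow> (l has_field_derivative inverse (v x ^ 2)) (at x)" "l 0 = 0"
    by (rule hol_primitive) (rule that)
  have \<phi>': "hol_fps (ball 0 \<rho>) \<phi>" by (rule hol_fps_subset[OF \<phi>]) (use \<rho> in auto)
  let ?Q = "\<lambda>x. fps_const (v x ^ 4) * (\<phi> x - fps_X * fps_const (deriv (deriv v) x / v x))"
  obtain s g h T where s: "s > 0" and g: "\<And>y. y \<in> ball 0 s \<Longrightarrow> g y \<in> ball 0 \<rho>" "\<And>y. y \<in> ball 0 s \<Longrightarrow> l (g y) = y"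
    and Q: "hol_fps (ball 0 s) (\<lambda>y. ?Q (g y))" and h: "biholomorphic_germ h" "hol_map h"
    and T: "formal_iso_over h T (normal_form \<phi>) (normal_form (\<lambda>y. ?Q (g y)))"
    by (rule normal_form_coordinate_change[OF \<rho>(1) v(1,2) l \<phi>']) (assumption, assumption, rule that)
  have "fps_nth (?Q (g y)) 0 = 0" "fps_nth (?Q (g y)) 1 = 0" if y: "y \<in> ball 0 s" for y
  proof -
    note gy = g(1)[OF y]
    show "fps_nth (?Q (g y)) 0 = 0" using zero[OF sub[OF gy]] by simp
    have "deriv (deriv v) (g y) / v (g y) = fps_nth (\<phi> (g y)) 1" using v(2,3)[OF gy] by simp
    then show "fps_nth (?Q (g y)) 1 = 0" by simp
  qed
  from normal_form_gauge_zero[OF s Q this] obtain T' where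
    T': "formal_iso_over (\<lambda>t. t) T' (normal_form (\<lambda>y. ?Q (g y))) (normal_form (\<lambda>x. 0))" by blast
  from formal_iso_over_compose[OF T T' h(2) hol_map_id] show thesis
    by (intro that[of form_c h]) (auto simp: h forms_abc_def form_c_def)
next
  fix n u R'
  assume R': "0 < R'" "R' \<le> R" and u: "u holomorphic_on ball 0 R'" "\<And>x. x \<in> ball 0 R' \<Longrightarrow> u x \<noteq> 0"
    and \<phi>u: "\<And>x. x \<in> ball 0 R' \<Longrightarrow> fps_nth (\<phi> x) 0 = x ^ n * u x"
  obtain \<rho> v l where \<rho>: "0 < \<rho>" "\<rho> \<le> R'" and v: "v holomorphic_on ball 0 \<rho>" "\<And>x. v x \<noteq> 0"
    and l: "\<And>x. x \<in> ball 0 \<rho> \<Longrightarrow> (l has_field_derivative inverse (v x ^ 2)) (at x)" "l 0 = 0"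
    "\<And>x. x \<in> ball 0 \<rho> \<Longrightarrow> v x ^ 4 * (x ^ n * u x) = l x ^ n"
    by (rule power_normalizing_coordinate[OF u R'(1), where r = n]) (assumption, rule that)
  have sub: "x \<in> ball 0 R'" if "x \<in> ball 0 \<rho>" for x :: complex using that \<rho> by auto
  have \<phi>': "hol_fps (ball 0 \<rho>) \<phi>" by (rule hol_fps_subset[OF \<phi>]) (use \<rho> R' in auto)
  let ?Q = "\<lambda>x. fps_const (v x ^ 4) * (\<phi> x - fps_X * fps_const (deriv (deriv v) x / v x))"
  obtain s g h T where s: "s > 0" and g: "\<And>y. y \<in> ball 0 s \<Longrightarrow> g y \<in> ball 0 \<rho>" "\<And>y. y \<in> ball 0 s \<Longrightarrow> l (g y) = y"
    and Q: "hol_fps (ball 0 s) (\<lambda>y. ?Q (g y))" and h: "biholomorphic_germ h" "hol_map h"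
    and T: "formal_iso_over h T (normal_form \<phi>) (normal_form (\<lambda>y. ?Q (g y)))"
    by (rule normal_form_coordinate_change[OF \<rho>(1) v(1) v(2) l(1,2) \<phi>']) (assumption, rule that)
  have "fps_nth (?Q (g y)) 0 = y ^ n" if y: "y \<in> ball 0 s" for y
    using l(3)[OF g(1)[OF y]] g(2)[OF y] \<phi>u[OF sub[OF g(1)[OF y]]] by simp
  from normal_form_gauge_to_list[OF s Q this] obtain B T' where B: "B \<in> forms_abc \<union> forms_d"
    and T': "formal_iso_over (\<lambda>t. t) T' (normal_form (\<lambda>y. ?Q (g y))) B" by blast
  from formal_iso_over_compose[OF T T' h(2) hol_map_id] show thesis
    by (intro that[OF B h]) auto
qed

lemma formally_isomorphic_to_list:
  assumes "formal_T_structure A" "over_N2 A"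
  obtains B where "B \<in> forms_abc \<union> forms_d" "formally_isomorphic A B"
proof -
  obtain R x y T1 where R: "R > 0" and xy: "hol_fps (ball 0 R) x" "hol_fps (ball 0 R) y"
    "\<And>s. s \<in> ball 0 R \<Longrightarrow> fps_nth (x s) 0 = 0" "\<And>s. s \<in> ball 0 R \<Longrightarrow> fps_nth (y s) 0 = 0"
    and T1: "formal_iso_over (\<lambda>t. t) T1 A (companion y x)"
    by (rule gauge_to_companion[OF assms]) (rule that)
  obtain \<phi> T2 where \<phi>: "hol_fps (ball 0 R) \<phi>" and T2: "formal_iso_over (\<lambda>t. t) T2 (companion y x) (normal_form \<phi>)"
    by (rule companion_to_normal_form[OF R xy(1,3,2,4)]) (assumption, assumption, rule that)
  obtain B h T3 where B: "B \<in> forms_abc \<union> forms_d" and h: "biholomorphic_germ h" "hol_map h"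
    and T3: "formal_iso_over h T3 (normal_form \<phi>) B"
    by (rule normal_form_to_list[OF R \<phi>]) (rule that)
  note T12 = formal_iso_over_compose[OF T1 T2 hol_map_id hol_map_id]
  from formal_iso_over_compose[OF T12 T3 hol_map_id h(2)] have "formally_isomorphic A B"
    unfolding formally_isomorphic_def using h(1) by blast
  with B show ?thesis by (rule that)
qed

section \<open>Uniqueness\<close>

lemma biholomorphic_germ_holomorphic:
  assumes "biholomorphic_germ h"
  shows "h 0 = 0" "\<forall>\<^sub>F r in at_right 0. \<forall>j. mv_holomorphic_on (\<lambda>t. h t $ j) (bidisc r)"
proof -
  show "h 0 = 0" using assms by (simp add: biholomorphic_germ_def)
  obtain U where U: "open U" "0 \<in> U" "\<And>j. mv_holomorphic_on (\<lambda>t. h t $ j) U"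
    using assms unfolding biholomorphic_germ_def by (elim conjE exE) (rule that, auto)
  obtain r where r: "r > 0" "bidisc r \<subseteq> U" using open_contains_bidisc[OF U(1,2)] by blast
  show "\<forall>\<^sub>F r in at_right 0. \<forall>j. mv_holomorphic_on (\<lambda>t. h t $ j) (bidisc r)"
  proof (rule eventually_at_rightI[OF _ r(1)], intro allI)
    fix s j assume "s \<in> {0<..<r}"
    then have "bidisc s \<subseteq> U" using r(2) bidisc_mono[of s r] by auto
    then show "mv_holomorphic_on (\<lambda>t. h t $ j) (bidisc s)" by (rule mv_holomorphic_on_subset[OF U(3)])
  qed
qed

text \<open>Order 0 in \<open>z\<close> forces \<open>\<partial>\<^sub>2 h\<^sup>1 = 0\<close>, because \<open>q + p C\<^sub>2\<close> is conjugate to the nilpotent \<open>C\<^sub>2\<close>.\<close>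

lemma normal_form_iso_reduce:
  assumes h: "biholomorphic_germ h" and T: "formal_iso_over h T (normal_form \<phi>') (normal_form \<phi>)"
    and \<phi>: "hol_fps UNIV \<phi>"
  obtains R l \<psi> a c where "R > 0" "l = (\<lambda>x. h (pt 0 x) $ 2)" "l holomorphic_on ball 0 R" "l 0 = 0"
    "\<And>x. x \<in> ball 0 R \<Longrightarrow> deriv l x \<noteq> 0"
    "hol_fps (ball 0 R) a" "\<And>x. x \<in> ball 0 R \<Longrightarrow> fps_nth (a x) 0 \<noteq> 0" "hol_fps (ball 0 R) c"
    "\<psi> = (\<lambda>x. fps_const (deriv l x) * \<phi> (l x))" "hol_fps (ball 0 R) \<psi>"
    "\<And>x. x \<in> ball 0 R \<Longrightarrow> (\<phi>' x - fps_const (deriv l x) * \<psi> x) * a x =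
       fps_X * (fps_d (fps_d a) x + fps_d \<psi> x * c x + 2 * \<psi> x * fps_d c x)"
    "\<And>x. x \<in> ball 0 R \<Longrightarrow> (\<phi>' x - fps_const (deriv l x) * \<psi> x) * c x =
       2 * fps_const (deriv l x) * fps_d a x + fps_const (deriv (deriv l) x) * a x + fps_X * fps_d (fps_d c) x"
proof -
  have "\<forall>\<^sub>F r in at_right 0. iso_on r h T (normal_form \<phi>') (normal_form \<phi>) \<and> (\<forall>j. mv_holomorphic_on (\<lambda>t. h t $ j) (bidisc r))"
    using T biholomorphic_germ_holomorphic(2)[OF h] unfolding formal_iso_over_iff by (rule eventually_conj)
  then obtain R where R: "R > 0" and R': "iso_on R h T (normal_form \<phi>') (normal_form \<phi>) \<and> (\<forall>j. mv_holomorphic_on (\<lambda>t. h t $ j) (bidisc R))"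
    by (rule eventually_at_right_0_obtain)
  let ?B = "ball (0::complex) R"
  have hh: "mv_holomorphic_on (\<lambda>t. h t $ j) (bidisc R)" for j using R' by blast
  have fT: "formal_on (bidisc R) (\<lambda>t. T t $ j $ k)" for j k using R' by (simp add: iso_on_def)
  have pt: "pt 0 x \<in> bidisc R" if "x \<in> ?B" for x using that R by (auto simp: bidisc_def)
  \<comment> \<open>The equation in direction 2 is restricted to the line
    \<open>t\<^sub>1 = 0\<close>, where it is an ordinary differential equation along
    \<open>t\<^sub>2\<close>.\<close>
  define a b c d where "a x = T (pt 0 x) $ 1 $ 1" and "b x = T (pt 0 x) $ 1 $ 2"
    and "c x = T (pt 0 x) $ 2 $ 1" and "d x = T (pt 0 x) $ 2 $ 2" for x
  have ha: "hol_fps ?B a" and hb: "hol_fps ?B b" and hc: "hol_fps ?B c" and hd: "hol_fps ?B d"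
    unfolding a_def[abs_def] b_def[abs_def] c_def[abs_def] d_def[abs_def] by (rule formal_on_restrict[OF fT R])+
  define l where "l x = h (pt 0 x) $ 2" for x
  have hl: "l holomorphic_on ?B"
    unfolding l_def[abs_def] using mv_holomorphic_imp_sep_hol[OF hh[of 2]] R by (auto simp: sep_hol_def)
  have l0: "l 0 = 0"
  proof -
    have "pt 0 0 = 0" by (simp add: vec_eq_iff forall_2)
    then show ?thesis using biholomorphic_germ_holomorphic(1)[OF h] by (simp add: l_def)
  qed
  define q where "q x = partial_deriv 2 (\<lambda>s. h s $ 1) (pt 0 x)" for x
  have p: "partial_deriv 2 (\<lambda>s. h s $ 2) (pt 0 x) = deriv l x" if "x \<in> ?B" for x
    using partial_deriv_pt(2)[OF hh pt[OF that]] by (simp add: l_def[abs_def])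
  define \<psi> where "\<psi> x = fps_const (deriv l x) * \<phi> (l x)" for x
  have h\<psi>: "hol_fps ?B \<psi>"
    unfolding \<psi>_def[abs_def]
    by (intro hol_fps_intros holomorphic_deriv hl open_ball hol_fps_compose[OF \<phi>]) auto
  have E: "fps_X * fps_d a x + fps_const (q x) * a x + fps_X * (\<psi> x * c x) - b x = 0"
    "fps_X * fps_d b x + fps_const (q x) * b x + fps_X * (\<psi> x * d x) - fps_X * (a x * \<phi>' x) = 0"
    "fps_X * fps_d c x + fps_const (q x) * c x + fps_const (deriv l x) * a x - d x = 0"
    "fps_X * fps_d d x + fps_const (q x) * d x + fps_const (deriv l x) * b x - fps_X * (c x * \<phi>' x) = 0"
    if x: "x \<in> ?B" for x
  proof -
    have "fps_X * fps_partial 2 (\<lambda>t. T t $ j $ k) (pt 0 x) +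
        (\<Sum>m\<in>UNIV. \<Sum>n\<in>UNIV. fps_const (partial_deriv 2 (\<lambda>s. h s $ m) (pt 0 x)) * normal_form \<phi> m (h (pt 0 x)) $ j $ n * T (pt 0 x) $ n $ k) -
        (\<Sum>n\<in>UNIV. T (pt 0 x) $ j $ n * normal_form \<phi>' 2 (pt 0 x) $ n $ k) = 0" for j k
      using R' pt[OF x] unfolding iso_on_def by blast
    note e = this[unfolded fps_partial_2_restrict[OF fT x]]
    show "fps_X * fps_d a x + fps_const (q x) * a x + fps_X * (\<psi> x * c x) - b x = 0"
      using e[of 1 1] by (simp add: a_def[abs_def] b_def c_def q_def \<psi>_def sum_2 normal_form_eq C1_def mat_def p[OF x] l_def mult_ac add_ac)
    show "fps_X * fps_d b x + fps_const (q x) * b x + fps_X * (\<psi> x * d x) - fps_X * (a x * \<phi>' x) = 0"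
      using e[of 1 2] by (simp add: a_def b_def[abs_def] d_def q_def \<psi>_def sum_2 normal_form_eq C1_def mat_def p[OF x] l_def mult_ac add_ac)
    show "fps_X * fps_d c x + fps_const (q x) * c x + fps_const (deriv l x) * a x - d x = 0"
      using e[of 2 1] by (simp add: a_def c_def[abs_def] d_def q_def sum_2 normal_form_eq C1_def mat_def p[OF x] add_ac)
    show "fps_X * fps_d d x + fps_const (q x) * d x + fps_const (deriv l x) * b x - fps_X * (c x * \<phi>' x) = 0"
      using e[of 2 2] by (simp add: b_def c_def d_def[abs_def] q_def sum_2 normal_form_eq C1_def mat_def p[OF x] mult_ac add_ac)
  qed
  \<comment> \<open>At z = 0 the entries 11 and 12 read q a = b and q b = 0. A nonzero q would make
    the first row of T vanish. Once q = 0, the leading determinant is \<open>(l') a\<^sup>2\<close>,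
    so both factors are nonzero.\<close>
  have nz: "q x = 0 \<and> deriv l x \<noteq> 0 \<and> fps_nth (a x) 0 \<noteq> 0" if x: "x \<in> ?B" for x
  proof -
    let ?a = "fps_nth (a x) 0" and ?b = "fps_nth (b x) 0" and ?c = "fps_nth (c x) 0" and ?d = "fps_nth (d x) 0"
    have det: "?a * ?d - ?b * ?c \<noteq> 0"
      using R' pt[OF x] unfolding iso_on_def by (simp add: a_def b_def c_def d_def)
    have e: "q x * ?a = ?b" "q x * ?b = 0" "q x * ?c + deriv l x * ?a = ?d"
      using arg_cong[OF E(1)[OF x], of "\<lambda>f. fps_nth f 0"] arg_cong[OF E(2)[OF x], of "\<lambda>f. fps_nth f 0"]
        arg_cong[OF E(3)[OF x], of "\<lambda>f. fps_nth f 0"] by simp_all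
    have "q x = 0"
    proof (rule ccontr)
      assume "q x \<noteq> 0"
      with e have "?b = 0" "?a = 0" by auto
      with det show False by simp
    qed
    with e have "?b = 0" "?d = deriv l x * ?a" by auto
    with det \<open>q x = 0\<close> show ?thesis by auto
  qed
  have be: "b x = fps_X * (fps_d a x + \<psi> x * c x)" and de: "d x = fps_const (deriv l x) * a x + fps_X * fps_d c x" if x: "x \<in> ?B" for x
    using E(1)[OF x] E(3)[OF x] nz[OF x] by (simp_all add: algebra_simps)
  have hp: "hol_fps ?B (\<lambda>x. fps_const (deriv l x))"
    by (intro hol_fps_fps_const holomorphic_deriv hl open_ball)
  show ?thesis
  proof (rule that[of R l a c \<psi>, OF R])
    show "l = (\<lambda>x. h (pt 0 x) $ 2)" "\<psi> = (\<lambda>x. fps_const (deriv l x) * \<phi> (l x))"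
      by (simp_all add: fun_eq_iff l_def \<psi>_def)
    fix x assume x: "x \<in> ?B"
    show "deriv l x \<noteq> 0" "fps_nth (a x) 0 \<noteq> 0" using nz[OF x] by auto
    have "fps_d b x = fps_d (\<lambda>x. fps_X * (fps_d a x + \<psi> x * c x)) x"
      by (rule fps_d_cong[OF open_ball x be])
    also have "\<dots> = fps_X * fps_d (\<lambda>x. fps_d a x + \<psi> x * c x) x"
      by (rule fps_d_cmult[OF _ open_ball x]) (intro hol_fps_intros ha hc h\<psi> open_ball)
    also have "fps_d (\<lambda>x. fps_d a x + \<psi> x * c x) x = fps_d (fps_d a) x + (fps_d \<psi> x * c x + \<psi> x * fps_d c x)"
      by (simp only: fps_d_add[OF hol_fps_d[OF ha open_ball] hol_fps_mult[OF h\<psi> hc] open_ball x]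
          fps_d_mult[OF h\<psi> hc open_ball x])
    finally have db: "fps_d b x = fps_X * (fps_d (fps_d a) x + (fps_d \<psi> x * c x + \<psi> x * fps_d c x))" .
    have "fps_d d x = fps_d (\<lambda>x. fps_const (deriv l x) * a x + fps_X * fps_d c x) x"
      by (rule fps_d_cong[OF open_ball x de])
    also have "\<dots> = fps_d (\<lambda>x. fps_const (deriv l x) * a x) x + fps_d (\<lambda>x. fps_X * fps_d c x) x"
      by (rule fps_d_add[OF _ _ open_ball x]) (intro hol_fps_intros hp ha hc open_ball)+
    finally have dd: "fps_d d x = (fps_const (deriv (deriv l) x) * a x + fps_const (deriv l x) * fps_d a x) + fps_X * fps_d (fps_d c) x"
      by (simp only: fps_d_mult[OF hp ha open_ball x] fps_d_cmult[OF hol_fps_d[OF hc open_ball] open_ball x] fps_d_fps_const)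
    have q: "q x = 0" using nz[OF x] by blast
    have "fps_X * (fps_X * (fps_d (fps_d a) x + fps_d \<psi> x * c x + 2 * \<psi> x * fps_d c x) - (\<phi>' x - fps_const (deriv l x) * \<psi> x) * a x) = 0"
      using E(2)[OF x] unfolding db q de[OF x] by (simp add: algebra_simps)
    then show "(\<phi>' x - fps_const (deriv l x) * \<psi> x) * a x =
       fps_X * (fps_d (fps_d a) x + fps_d \<psi> x * c x + 2 * \<psi> x * fps_d c x)" by simp
    have "fps_X * (2 * fps_const (deriv l x) * fps_d a x + fps_const (deriv (deriv l) x) * a x + fps_X * fps_d (fps_d c) x
        - (\<phi>' x - fps_const (deriv l x) * \<psi> x) * c x) = 0"
      using E(4)[OF x] unfolding dd q be[OF x] by (simp add: algebra_simps)
    then show "(\<phi>' x - fps_const (deriv l x) * \<psi> x) * c x =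
       2 * fps_const (deriv l x) * fps_d a x + fps_const (deriv (deriv l) x) * a x + fps_X * fps_d (fps_d c) x" by simp
  qed (rule hl l0 ha hc h\<psi>)+
qed

section \<open>Rigidity: coordinate and parameters are forced by the isomorphism equations\<close>

lemma continuous_eq_at_0:
  fixes f g :: "complex \<Rightarrow> complex"
  assumes "continuous_on (ball 0 R) f" "continuous_on (ball 0 R) g" and x: "x \<in> ball 0 R"
    and eq: "\<And>x. x \<in> ball 0 R \<Longrightarrow> x \<noteq> 0 \<Longrightarrow> f x = g x"
  shows "f x = g x"
proof (cases "x = 0")
  case True
  have c: "(f \<longlongrightarrow> f 0) (at 0)" "(g \<longlongrightarrow> g 0) (at 0)"
    using assms(1,2) x True by (auto simp: continuous_on_eq_continuous_at isCont_def)
  have "\<forall>\<^sub>F y in at 0. f y = g y"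
    using eq x True eventually_at_ball'[of R 0 UNIV] by (auto elim!: eventually_mono)
  then have "(g \<longlongrightarrow> f 0) (at 0)" using c(1) by (rule Lim_transform_eventually[rotated])
  with c(2) True show ?thesis using tendsto_unique[of "at (0::complex)"] by auto
qed (use eq x in blast)

text \<open>The point 0 is a singular point with indicial expression n A(0) + B(0). If g had order
  n, cancelling \<open>x\<^sup>n\<close> and letting x tend to 0 would leave this expression times a
  nonzero number.\<close>

lemma regular_singular_kernel:
  assumes R: "R > 0" and g: "g holomorphic_on ball 0 R"
    and A: "continuous_on (ball 0 R) A" and B: "continuous_on (ball 0 R) B"
    and eq: "\<And>x. x \<in> ball 0 R \<Longrightarrow> x * deriv g x * A x + g x * B x = 0"
    and nz: "\<And>n. of_nat n * A 0 + B 0 \<noteq> 0" and x: "x \<in> ball 0 R"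
  shows "g x = 0"
proof (rule holomorphic_order_cases[OF g R])
  show ?thesis if "\<And>x. x \<in> ball 0 R \<Longrightarrow> g x = 0" using that x by blast
  fix n u \<rho>
  assume \<rho>: "0 < \<rho>" "\<rho> \<le> R" and u: "u holomorphic_on ball 0 \<rho>" "\<And>x. x \<in> ball 0 \<rho> \<Longrightarrow> u x \<noteq> 0"
    and gu: "\<And>x. x \<in> ball 0 \<rho> \<Longrightarrow> g x = x ^ n * u x"
  let ?f = "\<lambda>x. (of_nat n * u x + x * deriv u x) * A x + u x * B x"
  have sub: "ball 0 \<rho> \<subseteq> ball (0::complex) R" using \<rho> by auto
  have "?f 0 = 0"
  proof (rule continuous_eq_at_0[of \<rho> ?f "\<lambda>x. 0" 0])
    show "continuous_on (ball 0 \<rho>) ?f"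
      by (intro continuous_intros holomorphic_on_imp_continuous_on holomorphic_deriv u open_ball
          continuous_on_subset[OF A sub] continuous_on_subset[OF B sub])
    show "0 \<in> ball (0::complex) \<rho>" using \<rho> by simp
    fix x :: complex assume x: "x \<in> ball 0 \<rho>" "x \<noteq> 0"
    have du: "(u has_field_derivative deriv u x) (at x)" using u(1) x by (intro holomorphic_derivI) auto
    have "deriv g x = deriv (\<lambda>x. x ^ n * u x) x"
      by (rule deriv_cong_ev) (use x gu in \<open>auto simp: eventually_nhds intro!: exI[of _ "ball 0 \<rho>"]\<close>)
    also have "\<dots> = of_nat n * x ^ (n - 1) * u x + x ^ n * deriv u x"
      by (rule DERIV_imp_deriv) (auto intro!: derivative_eq_intros du)
    finally have dg: "x * deriv g x = x ^ n * (of_nat n * u x + x * deriv u x)"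
      by (cases n) (auto simp: algebra_simps)
    have "x ^ n * ?f x = x * deriv g x * A x + g x * B x" unfolding dg gu[OF x(1)] by (simp add: algebra_simps)
    also have "\<dots> = 0" using eq x(1) sub by blast
    finally show "?f x = 0" using x(2) by simp
  qed auto
  then have "u 0 * (of_nat n * A 0 + B 0) = 0" by (simp add: algebra_simps)
  then show ?thesis using nz[of n] u(2)[of 0] \<rho> by simp
qed

text \<open>One factor x at a time is split off; continuity of the quotient carries the identity
  across the origin after each cancellation.\<close>

lemma poly_eq_zero_of_order:
  fixes P :: "complex poly"
  assumes R: "R > 0" and "\<And>x. x \<in> ball 0 R \<Longrightarrow> poly P x = x ^ m * g x" "continuous_on (ball 0 R) g" "degree P < m"
  shows "P = 0"
proof (rule ccontr)
  assume "P \<noteq> 0"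
  have "\<exists>P'. P = monom 1 m * P'" using assms(2,3)
  proof (induction m arbitrary: P)
    case 0
    then show ?case by (intro exI[of _ P]) (simp add: monom_0)
  next
    case (Suc m)
    have "0 \<in> ball (0::complex) R" using R by simp
    from Suc.prems(1)[OF this] have "poly P 0 = 0" by simp
    then obtain P1 where P1: "P = pCons 0 P1" by (cases P) auto
    have "poly P1 x = x ^ m * g x" if x: "x \<in> ball 0 R" for x
    proof (rule continuous_eq_at_0[OF _ _ x])
      show "continuous_on (ball 0 R) (poly P1)" by (intro continuous_intros)
      show "continuous_on (ball 0 R) (\<lambda>x. x ^ m * g x)" by (intro continuous_intros Suc.prems)
      fix x :: complex assume "x \<in> ball 0 R" "x \<noteq> 0"
      then show "poly P1 x = x ^ m * g x" using Suc.prems(1)[of x] by (simp add: P1)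
    qed
    from Suc.IH[OF this Suc.prems(2)] obtain P' where "P1 = monom 1 m * P'" by blast
    then show ?case by (intro exI[of _ P']) (simp add: P1 monom_Suc)
  qed
  then obtain P' where P': "P = monom 1 m * P'" by blast
  with \<open>P \<noteq> 0\<close> have "degree P = m + degree P'" by (auto simp: degree_mult_eq degree_monom_eq)
  with assms(4) show False by simp
qed

lemma power_order_unique:
  assumes R: "R > 0" and u: "continuous_on (ball 0 R) u" "u 0 \<noteq> (0::complex)"
    and eq: "\<And>x. x \<in> ball 0 R \<Longrightarrow> x ^ m = x ^ n * u x"
  shows "m = n"
proof (rule ccontr)
  assume "m \<noteq> n"
  have 0: "0 \<in> ball (0::complex) R" using R by simp
  consider k where "m = n + Suc k" | k where "n = m + Suc k" using \<open>m \<noteq> n\<close> by (metis less_imp_Suc_add linorder_neqE_nat add_Suc_right)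
  then show False
  proof cases
    case (1 k)
    have "0 ^ Suc k = u 0"
      by (rule continuous_eq_at_0[of R "\<lambda>x. x ^ Suc k" u 0])
         (use eq 0 u 1 in \<open>auto simp: power_add intro!: continuous_intros\<close>)
    with u show False by simp
  next
    case (2 k)
    have "0 ^ Suc k * u 0 = 1"
      by (rule continuous_eq_at_0[of R "\<lambda>x. x ^ Suc k * u x" "\<lambda>x. 1" 0])
         (use eq 0 u 2 in \<open>auto simp: power_add mult.assoc intro!: continuous_intros\<close>)
    then show False by simp
  qed
qed

lemma holomorphic_divide_x:
  assumes l: "l holomorphic_on ball 0 R" "l 0 = 0" and R: "R > 0"
  obtains k where "k holomorphic_on ball 0 R" "\<And>x. l x = x * k x" "k 0 = deriv l 0"
proof -
  define k where "k x = (if x = 0 then deriv l 0 else (l x - l 0) / (x - 0))" for x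
  show ?thesis
  proof (rule that[of k])
    show "k holomorphic_on ball 0 R" unfolding k_def by (rule pole_lemma[OF l(1)]) (use R in simp)
  qed (auto simp: k_def l(2))
qed

text \<open>Put l = x k. The equation becomes \<open>(k + x k')\<^sup>2 k\<^sup>r = 1\<close>, and
  differentiating it gives a first-order equation for k' that is singular at 0. Its indicial
  expression is \<open>(2n + 4 + r) k(0)\<close>, never zero, so k' = 0. The value at x = 0 then
  says that k(0) is a root of unity of order dividing r + 2.\<close>

lemma power_coordinate_linear:
  assumes R: "R > 0" and l: "l holomorphic_on ball 0 R" "l 0 = 0" "deriv l 0 \<noteq> 0" and r: "r > 0"
    and eq: "\<And>x. x \<in> ball 0 R \<Longrightarrow> deriv l x ^ 2 * l x ^ r = x ^ r"
  obtains \<kappa> where "\<kappa> ^ (r + 2) = 1" "\<And>x. x \<in> ball 0 R \<Longrightarrow> l x = \<kappa> * x"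
proof -
  let ?B = "ball (0::complex) R"
  obtain k where k: "k holomorphic_on ?B" "\<And>x. l x = x * k x" "k 0 = deriv l 0"
    by (rule holomorphic_divide_x[OF l(1,2) R]) (rule that)
  have dk: "(k has_field_derivative deriv k x) (at x)" if "x \<in> ?B" for x
    using k(1) that by (intro holomorphic_derivI) auto
  have ddk: "(deriv k has_field_derivative deriv (deriv k) x) (at x)" if "x \<in> ?B" for x
    using k(1) that by (intro holomorphic_derivI[of _ ?B] holomorphic_deriv) auto
  have dl: "deriv l x = k x + x * deriv k x" if "x \<in> ?B" for x
  proof -
    have "deriv l x = deriv (\<lambda>x. x * k x) x" using k(2) by (intro arg_cong[of _ _ "\<lambda>f. deriv f x"] ext)
    also have "\<dots> = k x + x * deriv k x"
      by (rule DERIV_imp_deriv) (auto intro!: derivative_eq_intros dk[OF that])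
    finally show ?thesis .
  qed
  define w where "w x = (k x + x * deriv k x) ^ 2 * k x ^ r" for x
  have w1: "w x = 1" if x: "x \<in> ?B" for x
  proof (rule continuous_eq_at_0[OF _ continuous_on_const x])
    show "continuous_on ?B w" unfolding w_def
      by (intro continuous_intros holomorphic_on_imp_continuous_on holomorphic_deriv k open_ball)
    fix x :: complex assume x: "x \<in> ?B" "x \<noteq> 0"
    have "x ^ r * w x = x ^ r * 1"
      using eq[OF x(1)] unfolding dl[OF x(1)] k(2) w_def by (simp add: power_mult_distrib mult_ac)
    then show "w x = 1" using x(2) by simp
  qed
  have nz: "k x \<noteq> 0" "k x + x * deriv k x \<noteq> 0" if "x \<in> ?B" for x
    using w1[OF that] r by (auto simp: w_def power_0_left)
  obtain m where m: "r = Suc m" using r by (cases r) auto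
  have dk0: "deriv k x = 0" if x: "x \<in> ?B" for x
  proof (rule regular_singular_kernel[OF R _ _ _ _ _ x, where g = "deriv k" and A = "\<lambda>x. 2 * k x"
        and B = "\<lambda>x. (4 + of_nat r) * k x + of_nat r * x * deriv k x"])
    show "deriv k holomorphic_on ?B" by (intro holomorphic_deriv k open_ball)
    show "continuous_on ?B (\<lambda>x. 2 * k x)"
      "continuous_on ?B (\<lambda>x. (4 + of_nat r) * k x + of_nat r * x * deriv k x)"
      by (intro continuous_intros holomorphic_on_imp_continuous_on holomorphic_deriv k open_ball)+
    fix x assume x: "x \<in> ?B"
    have "(w has_field_derivative
        2 * (k x + x * deriv k x) * (2 * deriv k x + x * deriv (deriv k) x) * k x ^ r +
        (k x + x * deriv k x) ^ 2 * (of_nat r * k x ^ m * deriv k x)) (at x)"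
    proof -
      have dp: "((\<lambda>x. k x ^ r) has_field_derivative of_nat r * k x ^ m * deriv k x) (at x)"
        by (rule DERIV_cong[OF DERIV_power[OF dk[OF x]]]) (simp add: m mult_ac)
      have dv: "((\<lambda>x. k x + x * deriv k x) has_field_derivative 2 * deriv k x + x * deriv (deriv k) x) (at x)"
        by (auto intro!: derivative_eq_intros dk[OF x] ddk[OF x])
      show ?thesis unfolding w_def[abs_def]
        by (rule DERIV_cong[OF DERIV_mult'[OF DERIV_power[OF dv, of 2] dp]]) (simp add: algebra_simps)
    qed
    moreover have "(w has_field_derivative 0) (at x)"
      by (rule has_field_derivative_transform_within_open[OF DERIV_const[of 1] open_ball x]) (simp add: w1)
    ultimately have "2 * (k x + x * deriv k x) * (2 * deriv k x + x * deriv (deriv k) x) * k x ^ r +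
        (k x + x * deriv k x) ^ 2 * (of_nat r * k x ^ m * deriv k x) = 0"
      by (rule DERIV_unique)
    then have "(k x + x * deriv k x) * k x ^ m *
        (2 * (2 * deriv k x + x * deriv (deriv k) x) * k x + (k x + x * deriv k x) * of_nat r * deriv k x) = 0"
      by (simp add: m power2_eq_square algebra_simps)
    then have "2 * (2 * deriv k x + x * deriv (deriv k) x) * k x + (k x + x * deriv k x) * of_nat r * deriv k x = 0"
      using nz[OF x] by simp
    then show "x * deriv (deriv k) x * (2 * k x) + deriv k x * ((4 + of_nat r) * k x + of_nat r * x * deriv k x) = 0"
      by (simp add: algebra_simps)
  next
    show "of_nat n * (2 * k 0) + ((4 + of_nat r) * k 0 + of_nat r * 0 * deriv k 0) \<noteq> 0" for n
    proof -
      have "of_nat (2 * n + 4 + r) \<noteq> (0::complex)" by (simp only: of_nat_eq_0_iff)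
      then have "of_nat (2 * n + 4 + r) * k 0 \<noteq> 0" using k(3) l(3) by simp
      then show ?thesis by (simp add: algebra_simps)
    qed
  qed
  have 0: "0 \<in> ?B" using R by simp
  have kc: "k x = k 0" if x: "x \<in> ?B" for x
  proof (rule has_field_derivative_zero_constant[of ?B k, THEN exE])
    show "(k has_field_derivative 0) (at x within ?B)" if "x \<in> ?B" for x
      using dk[OF that] dk0[OF that] by (auto intro: has_field_derivative_at_within)
    show "k x = k 0" if "\<forall>x\<in>?B. k x = c" for c using that x 0 by simp
  qed simp
  have "k 0 ^ (r + 2) = 1" using w1[OF 0] by (simp add: w_def power_add power2_eq_square mult_ac)
  then show ?thesis by (rule that) (use k(2) kc in \<open>simp add: mult.commute\<close>)
qed

text \<open>Given the lower orders, \<open>II\<close> makes the n-th coefficient of a constant, and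
  \<open>I\<close> at order n + 1 equates P (n + 1) times a constant with
  \<open>x\<^sup>r\<^sup>-\<^sup>1\<close> times a multiple of \<open>r c + 2 x c'\<close>. The left
  side has degree at most r - 2, so both sides vanish; since r + 2n is never 0, so does the
  coefficient of c.\<close>

lemma formal_iso_lower_order_polys:
  assumes R: "R > 0" and \<kappa>: "\<kappa> \<noteq> (0::complex)" and r: "r \<ge> 2"
    and a: "hol_fps (ball 0 R) a" "\<And>x. x \<in> ball 0 R \<Longrightarrow> fps_nth (a x) 0 \<noteq> 0" and c: "hol_fps (ball 0 R) c"
    and \<psi>: "hol_fps (ball 0 R) \<psi>" "\<And>x. x \<in> ball 0 R \<Longrightarrow> fps_nth (\<psi> x) 0 = \<kappa> ^ (r + 1) * x ^ r"
    and P: "\<And>k. degree (P k) \<le> r - 2" "\<And>x. x \<in> ball 0 R \<Longrightarrow> fps_nth (\<Delta> x) 0 = 0"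
      "\<And>x k. x \<in> ball 0 R \<Longrightarrow> k \<ge> 1 \<Longrightarrow> fps_nth (\<Delta> x) k = poly (P k) x"
    and I: "\<And>x. x \<in> ball 0 R \<Longrightarrow> \<Delta> x * a x = fps_X * (fps_d (fps_d a) x + fps_d \<psi> x * c x + 2 * \<psi> x * fps_d c x)"
    and II: "\<And>x. x \<in> ball 0 R \<Longrightarrow> \<Delta> x * c x = 2 * fps_const \<kappa> * fps_d a x + fps_X * fps_d (fps_d c) x"
    and k: "k \<ge> 1"
  shows "P k = 0"
proof -
  let ?B = "ball (0::complex) R"
  let ?a = "\<lambda>n x. fps_nth (a x) n" and ?c = "\<lambda>n x. fps_nth (c x) n"
  have ch: "?c n holomorphic_on ?B" for n by (rule hol_fpsD[OF c])
  have II': "(\<Sum>j=0..n. fps_nth (\<Delta> x) j * ?c (n - j) x) =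
      2 * (\<kappa> * deriv (?a n) x) + (if n = 0 then 0 else deriv (deriv (?c (n - 1))) x)" if "x \<in> ?B" for n x
  proof -
    have "fps_nth (\<Delta> x * c x) n = fps_nth (2 * (fps_const \<kappa> * fps_d a x) + fps_X * fps_d (fps_d c) x) n"
      using II[OF that] by (simp add: mult.assoc)
    then show ?thesis by (cases n) (simp_all add: fps_mult_nth[of "\<Delta> x"] fps_numeral_mult_nth)
  qed
  have I': "(\<Sum>j=0..Suc n. fps_nth (\<Delta> x) j * ?a (Suc n - j) x) = deriv (deriv (?a n)) x +
      (\<Sum>j=0..n. deriv (\<lambda>x. fps_nth (\<psi> x) j) x * ?c (n - j) x) + 2 * (\<Sum>j=0..n. fps_nth (\<psi> x) j * deriv (?c (n - j)) x)"
    if "x \<in> ?B" for n x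
  proof -
    have "fps_nth (\<Delta> x * a x) (Suc n) = fps_nth (fps_d (fps_d a) x + fps_d \<psi> x * c x + 2 * (\<psi> x * fps_d c x)) n"
      unfolding I[OF that] by (simp add: mult.assoc)
    then show ?thesis
      by (simp only: fps_mult_nth[of "\<Delta> x"] fps_add_nth fps_numeral_mult_nth fps_mult_nth[of "fps_d \<psi> x"]
          fps_mult_nth[of "\<psi> x"] fps_d_nth)
  qed
  have zero_deriv: "deriv f x = 0" if "\<And>x. x \<in> ?B \<Longrightarrow> f x = 0" "x \<in> ?B" for f :: "complex \<Rightarrow> complex" and x
  proof -
    have "deriv f x = deriv (\<lambda>x. 0) x"
      by (rule deriv_cong_ev) (use that in \<open>auto simp: eventually_nhds intro!: exI[of _ ?B]\<close>)
    then show ?thesis by simp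
  qed
  have da0: "deriv (?a 0) x = 0" if "x \<in> ?B" for x
    using II'[OF that, of 0] P(2)[OF that] \<kappa> by simp
  have 0: "0 \<in> ?B" using R by simp
  have a0: "?a 0 x = ?a 0 0" if x: "x \<in> ?B" for x
  proof (rule has_field_derivative_zero_constant[of ?B "?a 0", THEN exE])
    fix x assume x: "x \<in> ?B"
    have "(?a 0 has_field_derivative deriv (?a 0) x) (at x)" using hol_fpsD[OF a(1)] x by (intro holomorphic_derivI[of _ ?B]) auto
    then show "(?a 0 has_field_derivative 0) (at x within ?B)" unfolding da0[OF x] by (rule has_field_derivative_at_within)
  next
    show "?a 0 x = ?a 0 0" if "\<forall>x\<in>?B. ?a 0 x = C" for C using that x 0 by simp
  qed simp
  \<comment> \<open>The statement on c lags one order behind, because its n-th coefficient first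
    meets the leading term in \<open>I\<close> at order n + 1, together with P (n + 1).\<close>
  have "(\<forall>j\<le>n. \<forall>x\<in>?B. fps_nth (\<Delta> x) j = 0) \<and> (\<forall>j<n. \<forall>x\<in>?B. ?c j x = 0) \<and> (\<forall>j. 1 \<le> j \<and> j \<le> n \<longrightarrow> P j = 0)" for n
  proof (induction n)
    case 0
    show ?case using P(2) by auto
  next
    case (Suc n)
    then have D: "\<And>j x. j \<le> n \<Longrightarrow> x \<in> ?B \<Longrightarrow> fps_nth (\<Delta> x) j = 0" and C: "\<And>j x. j < n \<Longrightarrow> x \<in> ?B \<Longrightarrow> ?c j x = 0"
      and Pj: "\<And>j. 1 \<le> j \<Longrightarrow> j \<le> n \<Longrightarrow> P j = 0" by blast+
    have dC: "deriv (?c j) x = 0" if "j < n" "x \<in> ?B" for j x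
      by (rule zero_deriv) (use C that in auto)
    have da: "deriv (?a n) x = 0" if x: "x \<in> ?B" for x
    proof -
      have "(if n = 0 then 0 else deriv (deriv (?c (n - 1))) x) = 0"
        using zero_deriv[of "deriv (?c (n - 1))" x] dC[of "n - 1"] x by auto
      moreover have "(\<Sum>j=0..n. fps_nth (\<Delta> x) j * ?c (n - j) x) = 0" by (rule sum.neutral) (use D x in auto)
      ultimately show ?thesis using II'[OF x, of n] \<kappa> by simp
    qed
    have dda: "deriv (deriv (?a n)) x = 0" if "x \<in> ?B" for x using zero_deriv[OF da that] .
    define g where "g x = of_nat r * ?c n x + 2 * x * deriv (?c n) x" for x
    have eq: "poly (P (Suc n)) x * ?a 0 0 = x ^ (r - 1) * (\<kappa> ^ (r + 1) * g x)" if x: "x \<in> ?B" for x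
    proof -
      have "(\<Sum>j=0..Suc n. fps_nth (\<Delta> x) j * ?a (Suc n - j) x) = fps_nth (\<Delta> x) (Suc n) * ?a 0 x"
        using D x by (simp add: sum.neutral)
      moreover have "(\<Sum>j=0..n. deriv (\<lambda>x. fps_nth (\<psi> x) j) x * ?c (n - j) x) = deriv (\<lambda>x. fps_nth (\<psi> x) 0) x * ?c n x"
        by (subst sum.atLeast_Suc_atMost) (use C x in \<open>auto intro!: sum.neutral\<close>)
      moreover have "(\<Sum>j=0..n. fps_nth (\<psi> x) j * deriv (?c (n - j)) x) = fps_nth (\<psi> x) 0 * deriv (?c n) x"
        by (subst sum.atLeast_Suc_atMost) (use dC x in \<open>auto intro!: sum.neutral\<close>)
      ultimately have "fps_nth (\<Delta> x) (Suc n) * ?a 0 x = deriv (\<lambda>x. fps_nth (\<psi> x) 0) x * ?c n x + 2 * (fps_nth (\<psi> x) 0 * deriv (?c n) x)"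
        using I'[OF x, of n] dda[OF x] by simp
      moreover have "deriv (\<lambda>x. fps_nth (\<psi> x) 0) x = \<kappa> ^ (r + 1) * (of_nat r * x ^ (r - 1))"
      proof -
        have "deriv (\<lambda>x. fps_nth (\<psi> x) 0) x = deriv (\<lambda>x. \<kappa> ^ (r + 1) * x ^ r) x"
          by (rule deriv_cong_ev) (use x \<psi>(2) in \<open>auto simp: eventually_nhds intro!: exI[of _ ?B]\<close>)
        also have "\<dots> = \<kappa> ^ (r + 1) * (of_nat r * x ^ (r - 1))"
          by (rule DERIV_imp_deriv) (auto intro!: derivative_eq_intros)
        finally show ?thesis .
      qed
      moreover have "x ^ r = x ^ (r - 1) * x" using r by (cases r) auto
      ultimately show ?thesis using P(3)[OF x, of "Suc n"] a0[OF x] \<psi>(2)[OF x] by (simp add: g_def algebra_simps)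
    qed
    have gc: "continuous_on ?B g" unfolding g_def
      by (intro continuous_intros holomorphic_on_imp_continuous_on holomorphic_deriv ch open_ball)
    have a00: "?a 0 0 \<noteq> 0" using a(2)[OF 0] .
    have PS: "P (Suc n) = 0"
    proof (rule poly_eq_zero_of_order[OF R, where m = "r - 1" and g = "\<lambda>x. \<kappa> ^ (r + 1) * g x / ?a 0 0"])
      show "poly (P (Suc n)) x = x ^ (r - 1) * (\<kappa> ^ (r + 1) * g x / ?a 0 0)" if "x \<in> ?B" for x
        using eq[OF that] a00 by (simp add: field_simps)
      show "continuous_on ?B (\<lambda>x. \<kappa> ^ (r + 1) * g x / ?a 0 0)" by (intro continuous_intros gc) (use a00 in auto)
      show "degree (P (Suc n)) < r - 1" using P(1)[of "Suc n"] r by linarith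
    qed
    have g0: "g x = 0" if x: "x \<in> ?B" for x
      by (rule continuous_eq_at_0[OF gc continuous_on_const x]) (use eq PS \<kappa> in auto)
    have C0: "?c n x = 0" if x: "x \<in> ?B" for x
    proof (rule regular_singular_kernel[OF R ch _ _ _ _ x, where A = "\<lambda>x. 2" and B = "\<lambda>x. of_nat r"])
      show "x * deriv (?c n) x * 2 + ?c n x * of_nat r = 0" if "x \<in> ?B" for x
        using g0[OF that] by (simp add: g_def algebra_simps)
      show "of_nat n * 2 + of_nat r \<noteq> (0::complex)" for n
      proof -
        have "of_nat (n * 2 + r) \<noteq> (0::complex)" using r by (simp only: of_nat_eq_0_iff)
        then show ?thesis by simp
      qed
    qed (intro continuous_intros)+
    have "fps_nth (\<Delta> x) (Suc n) = 0" if "x \<in> ?B" for x using P(3)[OF that, of "Suc n"] PS by simp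
    then show ?case using D C C0 Pj PS by (auto simp: le_Suc_eq less_Suc_eq)
  qed
  then show ?thesis using k by blast
qed

lemma form_d_series_nth:
  "fps_nth (fps_const (x ^ r) + Abs_fps (\<lambda>k. if k \<ge> 1 then poly (f k) x else 0)) k =
     (if k = 0 then x ^ r else poly (f k) x)"
  by (cases k) auto

text \<open>The leading order forces l to be multiplication by \<kappa>, and then the difference of
  the two parameter families is a family of polynomials of too low degree to be absorbed. The last
  conclusion ties \<kappa> to h, so that a gauge isomorphism, where h is the identity, yields
  \<kappa> = 1.\<close>

lemma form_d_iso_imp:
  assumes d: "d_data r f" "d_data r f'" and h: "biholomorphic_germ h"
    and T: "formal_iso_over h T (form_d r f) (form_d r f')"
  obtains \<kappa> where "\<kappa> ^ (r + 2) = 1" "\<And>k x. k \<ge> 1 \<Longrightarrow> poly (f k) x = \<kappa> ^ 2 * poly (f' k) (\<kappa> * x)"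
    "\<forall>\<^sub>F x in at_right 0. h (pt 0 (of_real x)) $ 2 = \<kappa> * of_real x"
proof -
  let ?\<phi> = "\<lambda>f x. fps_const (x ^ r) + Abs_fps (\<lambda>k. if k \<ge> 1 then poly (f k) x else 0)"
  have r: "r \<ge> 2" using d by (simp add: d_data_def)
  obtain R l \<psi> a c where R: "R > 0" and lh: "l = (\<lambda>x. h (pt 0 x) $ 2)" and l: "l holomorphic_on ball 0 R" "l 0 = 0"
    "\<And>x. x \<in> ball 0 R \<Longrightarrow> deriv l x \<noteq> 0"
    and a: "hol_fps (ball 0 R) a" "\<And>x. x \<in> ball 0 R \<Longrightarrow> fps_nth (a x) 0 \<noteq> 0" and c: "hol_fps (ball 0 R) c"
    and \<psi>: "\<psi> = (\<lambda>x. fps_const (deriv l x) * ?\<phi> f' (l x))" "hol_fps (ball 0 R) \<psi>"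
    and I: "\<And>x. x \<in> ball 0 R \<Longrightarrow> (?\<phi> f x - fps_const (deriv l x) * \<psi> x) * a x =
       fps_X * (fps_d (fps_d a) x + fps_d \<psi> x * c x + 2 * \<psi> x * fps_d c x)"
    and II: "\<And>x. x \<in> ball 0 R \<Longrightarrow> (?\<phi> f x - fps_const (deriv l x) * \<psi> x) * c x =
       2 * fps_const (deriv l x) * fps_d a x + fps_const (deriv (deriv l) x) * a x + fps_X * fps_d (fps_d c) x"
    by (rule normal_form_iso_reduce[OF h T[unfolded form_d_def] hol_fps_form_d]) (rule that)
  let ?B = "ball (0::complex) R"
  have "deriv l x ^ 2 * l x ^ r = x ^ r" if x: "x \<in> ?B" for x
  proof -
    have "(x ^ r - deriv l x * (deriv l x * l x ^ r)) * fps_nth (a x) 0 = 0"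
      using arg_cong[OF I[OF x], of "\<lambda>f. fps_nth f 0"] by (simp add: \<psi>(1))
    then show ?thesis using a(2)[OF x] by (simp add: power2_eq_square mult.assoc)
  qed
  then obtain \<kappa> where \<kappa>: "\<kappa> ^ (r + 2) = 1" "\<And>x. x \<in> ?B \<Longrightarrow> l x = \<kappa> * x"
    using power_coordinate_linear[OF R l(1,2) l(3), of r] R r by (metis centre_in_ball less_le_trans pos2)
  have \<kappa>0: "\<kappa> \<noteq> 0" using \<kappa>(1) by (auto simp: power_0_left)
  have dl: "deriv l x = \<kappa>" if x: "x \<in> ?B" for x
  proof -
    have "deriv l x = deriv (\<lambda>x. \<kappa> * x) x"
      by (rule deriv_cong_ev) (use x \<kappa>(2) in \<open>auto simp: eventually_nhds intro!: exI[of _ ?B]\<close>)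
    then show ?thesis by simp
  qed
  have ddl: "deriv (deriv l) x = 0" if x: "x \<in> ?B" for x
  proof -
    have "deriv (deriv l) x = deriv (\<lambda>x. \<kappa>) x"
      by (rule deriv_cong_ev) (use x dl in \<open>auto simp: eventually_nhds intro!: exI[of _ ?B]\<close>)
    then show ?thesis by simp
  qed
  \<comment> \<open>The difference between f and the pullback of f' under
    \<open>x \<mapsto> \<kappa> x\<close>, weighted with
    \<open>(l')\<^sup>2 = \<kappa>\<^sup>2\<close>. The value 0 at k = 0 makes the degree bound hold
    for every k, since \<open>d_data\<close> bounds degrees from k = 1 on.\<close>
  define P where "P k = (if k \<ge> 1 then f k - smult (\<kappa> ^ 2) (pcompose (f' k) [:0, \<kappa>:]) else 0)" for k
  define \<Delta> where "\<Delta> x = ?\<phi> f x - fps_const (deriv l x) * \<psi> x" for x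
  have Pz: "P k = 0" if "k \<ge> 1" for k
  proof (rule formal_iso_lower_order_polys[OF R \<kappa>0 r a c \<psi>(2) _ _ _ _ _ _ that, where \<Delta> = \<Delta>])
    show "fps_nth (\<psi> x) 0 = \<kappa> ^ (r + 1) * x ^ r" if "x \<in> ?B" for x
      using \<kappa>(2)[OF that] dl[OF that] by (simp add: \<psi>(1) power_mult_distrib)
    show "degree (P k) \<le> r - 2" for k
      using d degree_pcompose_le[of "f' k" "[:0, \<kappa>:]"] degree_smult_le[of "\<kappa> ^ 2" "pcompose (f' k) [:0, \<kappa>:]"]
      by (auto simp: P_def d_data_def intro!: degree_diff_le dest!: spec[of _ k] elim: order_trans)
    show "fps_nth (\<Delta> x) 0 = 0" if "x \<in> ?B" for x
      using \<kappa> dl[OF that] that by (simp add: \<Delta>_def \<psi>(1) power_mult_distrib power2_eq_square power_add mult_ac)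
    show "fps_nth (\<Delta> x) k = poly (P k) x" if "x \<in> ?B" "k \<ge> 1" for x k
      using \<kappa>(2)[OF that(1)] dl[OF that(1)] that(2)
      by (simp add: \<Delta>_def \<psi>(1) form_d_series_nth P_def poly_pcompose power2_eq_square mult_ac)
    show "\<Delta> x * a x = fps_X * (fps_d (fps_d a) x + fps_d \<psi> x * c x + 2 * \<psi> x * fps_d c x)" if "x \<in> ?B" for x
      unfolding \<Delta>_def by (rule I[OF that])
    show "\<Delta> x * c x = 2 * fps_const \<kappa> * fps_d a x + fps_X * fps_d (fps_d c) x" if "x \<in> ?B" for x
      using II[OF that] unfolding \<Delta>_def by (simp add: dl[OF that] ddl[OF that])
  qed
  show ?thesis
  proof (rule that[OF \<kappa>(1)])
    show "poly (f k) x = \<kappa> ^ 2 * poly (f' k) (\<kappa> * x)" if "k \<ge> 1" for k x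
      using arg_cong[OF Pz[OF that], of "\<lambda>p. poly p x"] that by (simp add: P_def poly_pcompose mult.commute)
    show "\<forall>\<^sub>F x in at_right 0. h (pt 0 (of_real x)) $ 2 = \<kappa> * of_real x"
      by (rule eventually_at_rightI[of 0 R]) (use R \<kappa>(2) in \<open>auto simp: lh\<close>)
  qed
qed

text \<open>The constant matrix diag(1, \<kappa>) over
  \<open>t\<^sub>2 \<mapsto> \<kappa> t\<^sub>2\<close> works: with a = 1, c = 0 and l'' = 0 both
  isomorphism equations reduce to \<open>\<phi>' = \<kappa>\<^sup>2 \<phi> \<circ> l\<close>. The
  leading term satisfies it because of the root of unity, the others by hypothesis.\<close>

lemma form_d_iso_converse:
  assumes \<kappa>: "\<kappa> ^ (r + 2) = 1" and eq: "\<And>k x. k \<ge> 1 \<Longrightarrow> poly (f k) x = \<kappa> ^ 2 * poly (f' k) (\<kappa> * x)"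
  shows "formally_isomorphic (form_d r f) (form_d r f')"
proof -
  let ?\<phi> = "\<lambda>f x. fps_const (x ^ r) + Abs_fps (\<lambda>k. if k \<ge> 1 then poly (f k) x else 0)"
  define l where "l = (\<lambda>x::complex. \<kappa> * x)"
  have \<kappa>0: "\<kappa> \<noteq> 0" using \<kappa> by (auto simp: power_0_left)
  have dl: "deriv l = (\<lambda>x. \<kappa>)" unfolding l_def by (rule ext) simp
  have lh: "l holomorphic_on ball 0 1" unfolding l_def by (intro holomorphic_intros)
  have e: "?\<phi> f x - fps_const \<kappa> * (fps_const \<kappa> * ?\<phi> f' (l x)) = 0" for x
  proof (rule fps_ext)
    fix k
    have "x ^ r = \<kappa> * (\<kappa> * (\<kappa> * x) ^ r)"
    proof -
      have "\<kappa> * (\<kappa> * (\<kappa> * x) ^ r) = \<kappa> ^ (r + 2) * x ^ r"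
        by (simp add: power_mult_distrib power2_eq_square power_add mult_ac)
      then show ?thesis by (simp only: \<kappa> mult_1)
    qed
    then show "fps_nth (?\<phi> f x - fps_const \<kappa> * (fps_const \<kappa> * ?\<phi> f' (l x))) k = fps_nth 0 k"
      by (simp add: form_d_series_nth l_def eq power2_eq_square mult_ac)
  qed
  have d0: "fps_d (\<lambda>x. 1) = (\<lambda>x. 0)" "fps_d (\<lambda>x. 0) = (\<lambda>x. 0)" by (rule ext, rule fps_d_const)+
  obtain T where T: "formal_iso_over (\<lambda>t. pt (t $ 1) (l (t $ 2))) T (form_d r f) (form_d r f')"
  proof (rule that)
    show "formal_iso_over (\<lambda>t. pt (t $ 1) (l (t $ 2)))
     (\<lambda>t. mat2 1 (fps_X * (fps_d (\<lambda>x. 1) (t $ 2) + fps_const \<kappa> * ?\<phi> f' (l (t $ 2)) * 0))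
               0 (fps_const (deriv l (t $ 2)) * 1 + fps_X * fps_d (\<lambda>x. 0) (t $ 2)))
     (form_d r f) (form_d r f')"
      unfolding form_d_def
    proof (rule normal_form_iso[OF zero_less_one lh, where a = "\<lambda>x. 1" and c = "\<lambda>x. 0" and \<psi> = "\<lambda>x. fps_const \<kappa> * ?\<phi> f' (l x)"])
      show "hol_fps (ball 0 1) (\<lambda>x. fps_const \<kappa> * ?\<phi> f' (l x))"
        by (intro hol_fps_mult hol_fps_const hol_fps_compose[OF hol_fps_form_d[of UNIV] lh]) auto
    qed (use e in \<open>simp_all add: dl d0 \<kappa>0 del: fps_const_mult\<close>)
  qed
  obtain rr g where "biholomorphic_germ (\<lambda>t. pt (t $ 1) (l (t $ 2)))"
    by (rule biholomorphic_snd_map[OF zero_less_one lh]) (simp add: l_def, simp add: dl \<kappa>0, rule that)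
  with T show ?thesis unfolding formally_isomorphic_def by blast
qed

text \<open>The invariant that separates the list: the vanishing order of the leading coefficient,
  with \<open>None\<close> for the zero function. The coefficient is required to be exactly the
  power, which suffices for the listed forms.\<close>

definition lead_order :: "tpair \<Rightarrow> nat option \<Rightarrow> bool" where
  "lead_order B n \<longleftrightarrow> (\<exists>\<phi>. B = normal_form \<phi> \<and> hol_fps UNIV \<phi> \<and>
     (\<forall>x. fps_nth (\<phi> x) 0 = (case n of None \<Rightarrow> 0 | Some m \<Rightarrow> x ^ m)))"

lemma lead_order_forms:
  "lead_order form_a (Some 0)" "lead_order form_b (Some 1)" "lead_order form_c None" "lead_order (form_d r f) (Some r)"
proof -
  show "lead_order form_a (Some 0)" unfolding lead_order_def form_a_def
    by (rule exI[of _ "\<lambda>x. 1"]) simp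
  show "lead_order form_b (Some 1)" unfolding lead_order_def form_b_def
    by (rule exI[of _ fps_const]) (auto intro!: hol_fps_fps_const holomorphic_intros)
  show "lead_order form_c None" unfolding lead_order_def form_c_def
    by (rule exI[of _ "\<lambda>x. 0"]) simp
  show "lead_order (form_d r f) (Some r)" unfolding lead_order_def form_d_def
    by (rule exI, rule conjI[OF refl], rule conjI[OF hol_fps_form_d]) simp
qed

text \<open>The leading coefficients are related by
  \<open>\<phi>'(0) = (l')\<^sup>2 \<phi>(0) \<circ> l\<close>, with l(0) = 0 and l' free of zeros.
  Such a substitution preserves the vanishing order.\<close>

lemma lead_order_invariant:
  assumes "lead_order B' m" "lead_order B n" "formally_isomorphic B' B"
  shows "m = n"
proof -
  obtain \<phi>' where \<phi>': "B' = normal_form \<phi>'" "\<And>x. fps_nth (\<phi>' x) 0 = (case m of None \<Rightarrow> 0 | Some m \<Rightarrow> x ^ m)"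
    using assms(1) unfolding lead_order_def by blast
  obtain \<phi> where \<phi>: "B = normal_form \<phi>" "hol_fps UNIV \<phi>" "\<And>x. fps_nth (\<phi> x) 0 = (case n of None \<Rightarrow> 0 | Some m \<Rightarrow> x ^ m)"
    using assms(2) unfolding lead_order_def by blast
  obtain h T where h: "biholomorphic_germ h" and T: "formal_iso_over h T (normal_form \<phi>') (normal_form \<phi>)"
    using assms(3) unfolding formally_isomorphic_def \<phi>'(1) \<phi>(1) by blast
  obtain R l \<psi> a c where R: "R > 0" and l: "l holomorphic_on ball 0 R" "l 0 = 0"
    and dl: "\<And>x. x \<in> ball 0 R \<Longrightarrow> deriv l x \<noteq> 0"
    and a: "\<And>x. x \<in> ball 0 R \<Longrightarrow> fps_nth (a x) 0 \<noteq> 0"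
    and \<psi>: "\<psi> = (\<lambda>x. fps_const (deriv l x) * \<phi> (l x))"
    and I: "\<And>x. x \<in> ball 0 R \<Longrightarrow> (\<phi>' x - fps_const (deriv l x) * \<psi> x) * a x =
       fps_X * (fps_d (fps_d a) x + fps_d \<psi> x * c x + 2 * \<psi> x * fps_d c x)"
    by (rule normal_form_iso_reduce[OF h T \<phi>(2)]) (rule that)
  let ?B = "ball (0::complex) R"
  have 0: "0 \<in> ?B" using R by simp
  have eq: "fps_nth (\<phi>' x) 0 = deriv l x ^ 2 * fps_nth (\<phi> (l x)) 0" if x: "x \<in> ?B" for x
  proof -
    have "(fps_nth (\<phi>' x) 0 - deriv l x * (deriv l x * fps_nth (\<phi> (l x)) 0)) * fps_nth (a x) 0 = 0"
      using arg_cong[OF I[OF x], of "\<lambda>f. fps_nth f 0"] by (simp add: \<psi>)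
    then show ?thesis using a[OF x] by (simp add: power2_eq_square mult.assoc)
  qed
  show ?thesis
  proof (cases n)
    case None
    \<comment> \<open>A point other than 0 is used because there \<open>x\<^sup>m\<close> is nonzero
      for every m.\<close>
    have "of_real (R / 2) \<in> ?B" "of_real (R / 2) \<noteq> (0::complex)" using R by auto
    with eq[of "of_real (R / 2)"] None show ?thesis by (cases m) (auto simp: \<phi>' \<phi>)
  next
    case n: (Some n')
    show ?thesis
    proof (cases m)
      case None
      have z: "l x = 0 \<and> n' > 0" if "x \<in> ?B" for x
        using eq[OF that] dl[OF that] None n by (cases n') (auto simp: \<phi>' \<phi>)
      have "deriv l 0 = deriv (\<lambda>x. 0) 0"
        by (rule deriv_cong_ev) (use z 0 in \<open>auto simp: eventually_nhds intro!: exI[of _ ?B]\<close>)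
      with dl[OF 0] show ?thesis by simp
    next
      case m: (Some m')
      obtain k where k: "k holomorphic_on ?B" "\<And>x. l x = x * k x" "k 0 = deriv l 0"
        by (rule holomorphic_divide_x[OF l R]) (rule that)
      have "m' = n'"
      proof (rule power_order_unique[OF R, where u = "\<lambda>x. deriv l x ^ 2 * k x ^ n'"])
        show "continuous_on ?B (\<lambda>x. deriv l x ^ 2 * k x ^ n')"
          by (intro continuous_intros holomorphic_on_imp_continuous_on holomorphic_deriv k l open_ball)
        show "deriv l 0 ^ 2 * k 0 ^ n' \<noteq> 0" using dl[OF 0] k(3) by simp
        show "x ^ m' = x ^ n' * (deriv l x ^ 2 * k x ^ n')" if "x \<in> ?B" for x
          using eq[OF that] m n k(2)[of x] by (simp add: \<phi>' \<phi> power_mult_distrib mult_ac)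
      qed
      with m n show ?thesis by simp
    qed
  qed
qed

lemma lead_order_forms_abc:
  assumes "B \<in> forms_abc"
  obtains m where "lead_order B m" "m \<in> {None, Some 0, Some 1}"
    "B = (if m = None then form_c else if m = Some 0 then form_a else form_b)"
proof -
  consider "B = form_a" | "B = form_b" | "B = form_c" using assms by (auto simp: forms_abc_def)
  then show ?thesis
  proof cases
    case 1
    then show ?thesis using lead_order_forms(1) by (intro that[of "Some 0"]) simp_all
  next
    case 2
    then show ?thesis using lead_order_forms(2) by (intro that[of "Some 1"]) simp_all
  next
    case 3
    then show ?thesis using lead_order_forms(3) by (intro that[of None]) simp_all
  qed
qed

lemma lead_order_forms_d:
  assumes "B \<in> forms_d"
  obtains r where "lead_order B (Some r)" "r \<ge> 2"
proof -
  obtain r f where "B = form_d r f" "d_data r f" using assms unfolding forms_d_def by blast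
  then show ?thesis using lead_order_forms(4)[of r f] by (intro that[of r]) (simp_all add: d_data_def)
qed

text \<open>Forms (a), (b), (c) have the invariants 0, 1 and infinity and are recovered from them,
  while every form (d) has a finite invariant of at least 2.\<close>

lemma forms_isomorphic_eq:
  assumes B: "B \<in> forms_abc \<union> forms_d" "B' \<in> forms_abc \<union> forms_d"
    and abc: "B \<notin> forms_d \<or> B' \<notin> forms_d" and iso: "formally_isomorphic B B'"
  shows "B = B'"
proof -
  have mn: "m = n" if "lead_order B m" "lead_order B' n" for m n
    by (rule lead_order_invariant[OF that iso])
  consider "B \<in> forms_abc" "B' \<in> forms_abc" | "B \<in> forms_abc" "B' \<in> forms_d" | "B \<in> forms_d" "B' \<in> forms_abc"
    using B abc by blast
  then show ?thesis
  proof cases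
    case 1
    obtain m where m: "lead_order B m" "B = (if m = None then form_c else if m = Some 0 then form_a else form_b)"
      by (rule lead_order_forms_abc[OF 1(1)]) (rule that)
    obtain n where n: "lead_order B' n" "B' = (if n = None then form_c else if n = Some 0 then form_a else form_b)"
      by (rule lead_order_forms_abc[OF 1(2)]) (rule that)
    show ?thesis using mn[OF m(1) n(1)] m(2) n(2) by metis
  next
    case 2
    obtain m where m: "lead_order B m" "m \<in> {None, Some 0, Some 1}"
      by (rule lead_order_forms_abc[OF 2(1)]) (rule that)
    obtain r where r: "lead_order B' (Some r)" "r \<ge> 2"
      by (rule lead_order_forms_d[OF 2(2)]) (rule that)
    show ?thesis using mn[OF m(1) r(1)] m(2) r(2) by simp
  next
    case 3
    obtain m where m: "lead_order B' m" "m \<in> {None, Some 0, Some 1}"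
      by (rule lead_order_forms_abc[OF 3(2)]) (rule that)
    obtain r where r: "lead_order B (Some r)" "r \<ge> 2"
      by (rule lead_order_forms_d[OF 3(1)]) (rule that)
    have "Some r = m" by (rule mn[OF r(1) m(1)])
    then show ?thesis using m(2) r(2) by auto
  qed
qed

lemma biholomorphic_germ_id: "biholomorphic_germ (\<lambda>t. t)"
  unfolding biholomorphic_germ_def
proof (rule conjI[OF refl], rule exI[of _ UNIV], rule exI[of _ UNIV], rule exI[of _ "\<lambda>t. t"], intro conjI allI)
  show "homeomorphism UNIV UNIV (\<lambda>t. t) (\<lambda>t. t :: complex^2)" by (rule homeomorphism_ident)
qed (simp_all add: mv_holomorphic_on_nth)

text \<open>A gauge isomorphism covers the identity, so comparing \<open>\<kappa> x\<close> with x
  at one small positive x gives \<kappa> = 1, and the relation between the parameters becomes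
  equality. That both structures have the same r follows from the invariance of the vanishing
  order.\<close>

lemma form_d_gauge_isomorphic_eq:
  assumes "B \<in> forms_d" "B' \<in> forms_d" "formally_gauge_isomorphic B B'"
  shows "B = B'"
proof -
  obtain r f where B: "B = form_d r f" "d_data r f" using assms(1) by (auto simp: forms_d_def)
  obtain r' f' where B': "B' = form_d r' f'" "d_data r' f'" using assms(2) by (auto simp: forms_d_def)
  obtain T where T: "formal_iso_over (\<lambda>t. t) T B B'"
    using assms(3) unfolding formally_gauge_isomorphic_def by blast
  then have "formally_isomorphic B B'"
    unfolding formally_isomorphic_def using biholomorphic_germ_id by blast
  then have r: "r' = r"
    using lead_order_invariant[OF lead_order_forms(4) lead_order_forms(4)] B(1) B'(1) by blast
  obtain \<kappa> where \<kappa>: "\<And>k x. k \<ge> 1 \<Longrightarrow> poly (f k) x = \<kappa> ^ 2 * poly (f' k) (\<kappa> * x)"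
    "\<forall>\<^sub>F x in at_right 0. pt 0 (of_real x) $ 2 = \<kappa> * of_real x"
    by (rule form_d_iso_imp[OF B(2) B'(2)[unfolded r] biholomorphic_germ_id T[unfolded B(1) B'(1) r]]) (rule that)
  obtain x :: real where "x > 0" "pt 0 (of_real x) $ 2 = \<kappa> * of_real x"
    by (rule eventually_at_right_0_obtain[OF \<kappa>(2)]) (rule that)
  then have "\<kappa> = 1" by simp
  with \<kappa>(1) have eq: "poly (f k) x = poly (f' k) x" if "k \<ge> 1" for k x using that by simp
  have "(if k \<ge> 1 then poly (f k) x else 0) = (if k \<ge> 1 then poly (f' k) x else 0)" for k :: nat and x
    using eq by simp
  then show ?thesis unfolding B(1) B'(1) r form_d_def by (simp only:)
qed

theorem theorem21:
  shows
    "(\<forall>A. (T_structure A \<or> formal_T_structure A) \<and> over_N2 A \<longrightarrow>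
        (\<exists>B\<in>forms_abc. T_structure B \<and> formally_isomorphic A B) \<or>
        (\<exists>B\<in>forms_d. (T_structure B \<or> formal_T_structure B) \<and> formally_isomorphic A B))
     \<and>
     (\<forall>B\<in>forms_abc \<union> forms_d. \<forall>B'\<in>forms_abc \<union> forms_d.
        B \<noteq> B' \<and> (B \<notin> forms_d \<or> B' \<notin> forms_d) \<longrightarrow> \<not> formally_isomorphic B B')
     \<and>
     (\<forall>B\<in>forms_d. \<forall>B'\<in>forms_d. B \<noteq> B' \<longrightarrow> \<not> formally_gauge_isomorphic B B')
     \<and>
     (\<forall>r f f'. d_data r f \<and> d_data r f' \<longrightarrow>
        (formally_isomorphic (form_d r f) (form_d r f') \<longleftrightarrow>
         (\<exists>c::complex. c ^ (r + 2) = 1 \<and>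
            (\<forall>k\<ge>1. \<forall>t\<^sub>2. poly (f' k) t\<^sub>2 = inverse (c ^ 2) * poly (f k) (t\<^sub>2 / c)))))"
proof (intro conjI allI ballI impI)
  fix A assume A: "(T_structure A \<or> formal_T_structure A) \<and> over_N2 A"
  then have fA: "formal_T_structure A"
    unfolding T_structure_def formal_T_structure_def convergent_series_def by blast
  obtain B where "B \<in> forms_abc \<union> forms_d" "formally_isomorphic A B"
    by (rule formally_isomorphic_to_list[OF fA conjunct2[OF A]]) (rule that)
  then show "(\<exists>B\<in>forms_abc. T_structure B \<and> formally_isomorphic A B) \<or>
        (\<exists>B\<in>forms_d. (T_structure B \<or> formal_T_structure B) \<and> formally_isomorphic A B)"
    using T_structure_forms_abc formal_T_structure_forms_d by blast
next
  fix B B' assume B: "B \<in> forms_abc \<union> forms_d" "B' \<in> forms_abc \<union> forms_d"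
    and ne: "B \<noteq> B' \<and> (B \<notin> forms_d \<or> B' \<notin> forms_d)"
  then show "\<not> formally_isomorphic B B'" using forms_isomorphic_eq by blast
next
  fix B B' assume "B \<in> forms_d" "B' \<in> forms_d" "B \<noteq> B'"
  then show "\<not> formally_gauge_isomorphic B B'" using form_d_gauge_isomorphic_eq by blast
next
  fix r f f' assume d: "d_data r f \<and> d_data r f'"
  show "formally_isomorphic (form_d r f) (form_d r f') \<longleftrightarrow>
         (\<exists>c::complex. c ^ (r + 2) = 1 \<and>
            (\<forall>k\<ge>1. \<forall>t\<^sub>2. poly (f' k) t\<^sub>2 = inverse (c ^ 2) * poly (f k) (t\<^sub>2 / c)))"
  proof
    assume "formally_isomorphic (form_d r f) (form_d r f')"
    then obtain h T where h: "biholomorphic_germ h" and T: "formal_iso_over h T (form_d r f) (form_d r f')"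
      unfolding formally_isomorphic_def by blast
    obtain \<kappa> where \<kappa>: "\<kappa> ^ (r + 2) = 1" "\<And>k x. k \<ge> 1 \<Longrightarrow> poly (f k) x = \<kappa> ^ 2 * poly (f' k) (\<kappa> * x)"
      by (rule form_d_iso_imp[OF conjunct1[OF d] conjunct2[OF d] h T]) (rule that)
    then have "\<kappa> \<noteq> 0" by (auto simp: power_0_left)
    \<comment> \<open>The relation \<open>f(x) = \<kappa>\<^sup>2 f'(\<kappa> x)\<close> is solved
      for f' by substituting \<open>x = t\<^sub>2 / \<kappa>\<close>, so the root of unity is the
      slope of the coordinate change itself.\<close>
    with \<kappa> show "\<exists>c::complex. c ^ (r + 2) = 1 \<and>
        (\<forall>k\<ge>1. \<forall>t\<^sub>2. poly (f' k) t\<^sub>2 = inverse (c ^ 2) * poly (f k) (t\<^sub>2 / c))"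
      by (intro exI[of _ \<kappa>]) simp
  next
    assume "\<exists>c::complex. c ^ (r + 2) = 1 \<and>
        (\<forall>k\<ge>1. \<forall>t\<^sub>2. poly (f' k) t\<^sub>2 = inverse (c ^ 2) * poly (f k) (t\<^sub>2 / c))"
    then obtain c :: complex where c: "c ^ (r + 2) = 1"
      "\<And>k x. k \<ge> 1 \<Longrightarrow> poly (f' k) x = inverse (c ^ 2) * poly (f k) (x / c)" by blast
    then have "c \<noteq> 0" by (auto simp: power_0_left)
    with c show "formally_isomorphic (form_d r f) (form_d r f')"
      by (intro form_d_iso_converse[of c]) simp_all
  qed
qed

end
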